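(* Let $X$ be a rigid decomposition groupoid and let $U_X$ be the strict simplicial groupoid of subdivided intervals of $X$. Then the mapping groupoid $\operatorname{map}(X,U_X)$, whose objects are the strict culf maps $X\to U_X$ and whose arrows are the invertible modifications, is contractible (i.e. equivalent to the terminal groupoid).
   Context: **Simplicial conventions.** $\Delta$ is the category of nonempty finite ordinals $[n]=\{0<\dots<n\}$ and monotone maps. A map $g:[m]\to[n]$ is *active* if $g(0)=0$ and $g(m)=n$; it is *inert* if $g(i+1)=g(i)+1$ for all $0\le i<m$. Pushouts in $\Delta$ of active maps along inert maps exist. A simplicial groupoid is a strict functor $\Delta^{\mathrm{op}}\to\mathbf{Grpd}$; sets are regarded as discrete groupoids, and $\Delta^n$ is the standard $n$-simplex. An $n$-simplex of $X$ is an object $\lambda$ of $X_n$, equivalently a simplicial map $\lambda:\Delta^n\to X$. Its long edge $\operatorname{long}(\lambda)\in X_1$ is its image under the unique active map $[1]\to[n]$. Write $d_\bot=d_0$ and $d_\top=d_n$ for the outer face maps. **Rigid decomposition groupoids.** A simplicial groupoid $X$ is a *rigid decomposition groupoid* if (i) $d_1:X_2\to X_1$ is a discrete fibration, (ii) $s_0:X_0\to X_1$ is fully faithful, (iii) $X$ sends every pushout square in $\Delta$ of an active map along an inert map to a strict pullback of groupoids. **Discrete algebraic intervals.** A discrete algebraic interval is a simplicial set satisfying the strict Segal condition (i.e. isomorphic to the nerve of a category) together with a chosen initial object and a chosen terminal object. Each $\Delta^n$ is one, with initial $0$ and terminal $n$. A simplicial map between discrete algebraic intervals is *stretched* if it preserves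 the chosen initial and terminal objects. **Intervals of $X$.** For $X$ rigid and $f\in X_1$, $I_f$ is the simplicial groupoid with $(I_f)_n$ the strict fibre over $f$ of the functor $X_{n+2}\to X_1$ induced by the active map $[1]\to[n+2]$, with face maps $d_i:(I_f)_n\to(I_f)_{n-1}$ given by $d_{i+1}$ of $X$ and degeneracies $s_i$ given by $s_{i+1}$ of $X$. It is discrete, and is a discrete algebraic interval with chosen initial object $s_0(f)$ and chosen terminal object $s_1(f)$. The map $M_f:I_f\to X$ sends $\lambda\in(I_f)_n\subset X_{n+2}$ to $d_\top d_\bot\lambda\in X_n$. For $\lambda\in X_n$ with $f=\operatorname{long}(\lambda)$, $\phi_\lambda:\Delta^n\to I_f$ is the unique stretched map with $M_f\circ\phi_\lambda=\lambda$. **The simplicial groupoid $U_X$.** The objects of $(U_X)_n$ are the pairs $(I_f,\phi_\lambda)$, one for each object $\lambda\in X_n$, with $f=\operatorname{long}(\lambda)$. An arrow $(I_f,\phi_\lambda)\to(I_g,\phi_\mu)$ is an isomorphism of simplicial sets $F:I_f\to I_g$ with $F\phi_\lambda=\phi_\mu$ (no compatibility with $M_f,M_g$ is required). For $p:[n']\to[n]$ and $\lambda\in X_n$ put $\lambda'=\lambda\circ p$, $f'=\operatorname{long}(\lambda')$; there is a unique simplicial map $c^p_\lambda:I_{f'}\to I_f$ with $c^p_\lambda\phi_{\lambda'}=\phi_\lambda p$ and $M_fc^p_\lambda=M_{f'}$. Then $p^*(I_f,\phi_\lambda)=(I_{f'},\phi_{\lambda'})$, and $p^*$ sends $F:(I_f,\phi_\lambda)\to(I_g,\phi_\mu)$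 to the unique isomorphism $F':I_{f'}\to I_{g'}$ with $F'\phi_{\lambda'}=\phi_{\mu'}$ and $c^p_\mu F'=Fc^p_\lambda$. **Mapping groupoid.** A strict culf map $X\to U_X$ is a simplicial map whose naturality square on every active map is a strict pullback of groupoids. A modification $\Gamma:J\Rightarrow J'$ between simplicial maps is a family of natural transformations $\Gamma_n:J_n\Rightarrow J'_n$ ($n\ge0$) such that $p^*\Gamma_n=\Gamma_m p^*$ (whiskering) for every $p:[m]\to[n]$ in $\Delta$, equivalently for all face and degeneracy maps. *)

theory Defs
  imports "HOL-Library.FuncSet"
begin

section \<open>Groupoids, functors, natural transformations\<close>

record ('o, 'a) groupoid =
  Ob :: "'o set"
  Ar :: "'a set"
  Dom :: "'a \<Rightarrow> 'o"
  Cod :: "'a \<Rightarrow> 'o"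
  Ident :: "'o \<Rightarrow> 'a"
  Comp :: "'a \<Rightarrow> 'a \<Rightarrow> 'a"  \<comment> \<open>\<open>Comp G g f\<close> is \<open>g\<close> after \<open>f\<close>\<close>

locale groupoid =
  fixes G :: "('o, 'a) groupoid"
  assumes Dom_closed: "\<And>f. f \<in> Ar G \<Longrightarrow> Dom G f \<in> Ob G"
    and Cod_closed: "\<And>f. f \<in> Ar G \<Longrightarrow> Cod G f \<in> Ob G"
    and Ident_closed: "\<And>x. x \<in> Ob G \<Longrightarrow> Ident G x \<in> Ar G"
    and Dom_Ident: "\<And>x. x \<in> Ob G \<Longrightarrow> Dom G (Ident G x) = x"
    and Cod_Ident: "\<And>x. x \<in> Ob G \<Longrightarrow> Cod G (Ident G x) = x"
    and Comp_closed: "\<And>f g. f \<in> Ar G \<Longrightarrow> g \<in> Ar G \<Longrightarrow> Cod G f = Dom G g \<Longrightarrow> Comp G g f \<in> Ar G"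
    and Dom_Comp: "\<And>f g. f \<in> Ar G \<Longrightarrow> g \<in> Ar G \<Longrightarrow> Cod G f = Dom G g \<Longrightarrow>
        Dom G (Comp G g f) = Dom G f"
    and Cod_Comp: "\<And>f g. f \<in> Ar G \<Longrightarrow> g \<in> Ar G \<Longrightarrow> Cod G f = Dom G g \<Longrightarrow>
        Cod G (Comp G g f) = Cod G g"
    and Comp_Ident_right: "\<And>f. f \<in> Ar G \<Longrightarrow> Comp G f (Ident G (Dom G f)) = f"
    and Comp_Ident_left: "\<And>f. f \<in> Ar G \<Longrightarrow> Comp G (Ident G (Cod G f)) f = f"
    and Comp_assoc: "\<And>f g h. f \<in> Ar G \<Longrightarrow> g \<in> Ar G \<Longrightarrow> h \<in> Ar G \<Longrightarrow>
        Cod G f = Dom G g \<Longrightarrow> Cod G g = Dom G h \<Longrightarrow>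
        Comp G h (Comp G g f) = Comp G (Comp G h g) f"
    and inverse_ex: "\<And>f. f \<in> Ar G \<Longrightarrow> \<exists>g \<in> Ar G. Dom G g = Cod G f \<and> Cod G g = Dom G f \<and>
        Comp G g f = Ident G (Dom G f) \<and> Comp G f g = Ident G (Cod G f)"

definition terminal_groupoid :: "(unit, unit) groupoid" where
  "terminal_groupoid = \<lparr>Ob = UNIV, Ar = UNIV, Dom = (\<lambda>_. ()), Cod = (\<lambda>_. ()),
    Ident = (\<lambda>_. ()), Comp = (\<lambda>_ _. ())\<rparr>"

record ('o, 'a, 'p, 'b) gfun =
  onOb :: "'o \<Rightarrow> 'p"
  onAr :: "'a \<Rightarrow> 'b"

locale groupoid_functor = A: groupoid A + B: groupoid B
  for A :: "('o, 'a) groupoid" and B :: "('p, 'b) groupoid" +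
  fixes F :: "('o, 'a, 'p, 'b) gfun"
  assumes onOb_closed: "\<And>x. x \<in> Ob A \<Longrightarrow> onOb F x \<in> Ob B"
    and onAr_closed: "\<And>f. f \<in> Ar A \<Longrightarrow> onAr F f \<in> Ar B"
    and onAr_Dom: "\<And>f. f \<in> Ar A \<Longrightarrow> Dom B (onAr F f) = onOb F (Dom A f)"
    and onAr_Cod: "\<And>f. f \<in> Ar A \<Longrightarrow> Cod B (onAr F f) = onOb F (Cod A f)"
    and onAr_Ident: "\<And>x. x \<in> Ob A \<Longrightarrow> onAr F (Ident A x) = Ident B (onOb F x)"
    and onAr_Comp: "\<And>f g. f \<in> Ar A \<Longrightarrow> g \<in> Ar A \<Longrightarrow> Cod A f = Dom A g \<Longrightarrow>
        onAr F (Comp A g f) = Comp B (onAr F g) (onAr F f)"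

definition id_gfun :: "('o, 'a, 'o, 'a) gfun" where
  "id_gfun = \<lparr>onOb = (\<lambda>x. x), onAr = (\<lambda>f. f)\<rparr>"

definition comp_gfun ::
    "('p, 'b, 'q, 'c) gfun \<Rightarrow> ('o, 'a, 'p, 'b) gfun \<Rightarrow> ('o, 'a, 'q, 'c) gfun" where
  "comp_gfun G F = \<lparr>onOb = onOb G \<circ> onOb F, onAr = onAr G \<circ> onAr F\<rparr>"

definition fully_faithful ::
    "('o, 'a) groupoid \<Rightarrow> ('p, 'b) groupoid \<Rightarrow> ('o, 'a, 'p, 'b) gfun \<Rightarrow> bool" where
  "fully_faithful A B F \<longleftrightarrow> (\<forall>x \<in> Ob A. \<forall>y \<in> Ob A.
     bij_betw (onAr F) {f \<in> Ar A. Dom A f = x \<and> Cod A f = y}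
       {g \<in> Ar B. Dom B g = onOb F x \<and> Cod B g = onOb F y})"

definition discrete_fibration ::
    "('o, 'a) groupoid \<Rightarrow> ('p, 'b) groupoid \<Rightarrow> ('o, 'a, 'p, 'b) gfun \<Rightarrow> bool" where
  "discrete_fibration E B F \<longleftrightarrow> (\<forall>e \<in> Ob E. \<forall>b \<in> Ar B. Cod B b = onOb F e \<longrightarrow>
     (\<exists>!a. a \<in> Ar E \<and> Cod E a = e \<and> onAr F a = b))"

text \<open>For functors \<open>a : P \<rightarrow> A\<close>, \<open>b : P \<rightarrow> B\<close>, \<open>u : A \<rightarrow> C\<close>, \<open>v : B \<rightarrow> C\<close>: the square
  \<open>u a = v b\<close> commutes strictly and the comparison functor from \<open>P\<close> to the strict fibre product
  of \<open>u\<close> and \<open>v\<close> is an isomorphism, that is, bijective on objects and on arrows.\<close>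

definition strict_pullback ::
    "('o, 'a) groupoid \<Rightarrow> ('p, 'b) groupoid \<Rightarrow> ('q, 'c) groupoid \<Rightarrow>
     ('o, 'a, 'p, 'b) gfun \<Rightarrow> ('o, 'a, 'q, 'c) gfun \<Rightarrow>
     ('p, 'b, 'r, 'd) gfun \<Rightarrow> ('q, 'c, 'r, 'd) gfun \<Rightarrow> bool" where
  "strict_pullback P A B a b u v \<longleftrightarrow>
     bij_betw (\<lambda>x. (onOb a x, onOb b x)) (Ob P)
       {(y, z). y \<in> Ob A \<and> z \<in> Ob B \<and> onOb u y = onOb v z} \<and>
     bij_betw (\<lambda>f. (onAr a f, onAr b f)) (Ar P)
       {(g, h). g \<in> Ar A \<and> h \<in> Ar B \<and> onAr u g = onAr v h}"

text \<open>Components are required to be extensional, so that equal natural transformations are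
  equal functions.\<close>

locale nat_transformation = F: groupoid_functor A B F + G: groupoid_functor A B G
  for A :: "('o, 'a) groupoid" and B :: "('p, 'b) groupoid"
    and F :: "('o, 'a, 'p, 'b) gfun" and G :: "('o, 'a, 'p, 'b) gfun" +
  fixes \<eta> :: "'o \<Rightarrow> 'b"
  assumes component_ext: "\<eta> \<in> extensional (Ob A)"
    and component_closed: "\<And>x. x \<in> Ob A \<Longrightarrow> \<eta> x \<in> Ar B"
    and component_Dom: "\<And>x. x \<in> Ob A \<Longrightarrow> Dom B (\<eta> x) = onOb F x"
    and component_Cod: "\<And>x. x \<in> Ob A \<Longrightarrow> Cod B (\<eta> x) = onOb G x"
    and natural: "\<And>f. f \<in> Ar A \<Longrightarrow>
        Comp B (onAr G f) (\<eta> (Dom A f)) = Comp B (\<eta> (Cod A f)) (onAr F f)"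

text \<open>Natural transformations between groupoids are automatically invertible.\<close>

definition equivalent_groupoids :: "('o, 'a) groupoid \<Rightarrow> ('p, 'b) groupoid \<Rightarrow> bool" where
  "equivalent_groupoids A B \<longleftrightarrow> (\<exists>F G \<eta> \<epsilon>.
     groupoid_functor A B F \<and> groupoid_functor B A G \<and>
     nat_transformation A A id_gfun (comp_gfun G F) \<eta> \<and>
     nat_transformation B B (comp_gfun F G) id_gfun \<epsilon>)"

definition contractible_groupoid :: "('o, 'a) groupoid \<Rightarrow> bool" where
  "contractible_groupoid G \<longleftrightarrow> equivalent_groupoids G terminal_groupoid"


section \<open>The simplex category\<close>

text \<open>A map \<open>[m] \<rightarrow> [n]\<close> is a monotone function \<open>{..m} \<rightarrow> {..n}\<close>, extended by
  \<open>undefined\<close>; the composite of \<open>p : [l] \<rightarrow> [m]\<close> and \<open>q : [m] \<rightarrow> [n]\<close> is \<open>compose {..l} q p\<close>.\<close>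

definition Delta :: "nat \<Rightarrow> nat \<Rightarrow> (nat \<Rightarrow> nat) set" where
  "Delta m n = {p \<in> {..m} \<rightarrow>\<^sub>E {..n}. mono_on {..m} p}"

definition active :: "nat \<Rightarrow> nat \<Rightarrow> (nat \<Rightarrow> nat) \<Rightarrow> bool" where
  "active m n g \<longleftrightarrow> g \<in> Delta m n \<and> g 0 = 0 \<and> g m = n"

definition inert :: "nat \<Rightarrow> nat \<Rightarrow> (nat \<Rightarrow> nat) \<Rightarrow> bool" where
  "inert m n g \<longleftrightarrow> g \<in> Delta m n \<and> (\<forall>i<m. g (Suc i) = g i + 1)"

definition coface :: "nat \<Rightarrow> nat \<Rightarrow> nat \<Rightarrow> nat" where  \<comment> \<open>\<open>[n] \<rightarrow> [n+1]\<close>, omits \<open>i\<close>\<close>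
  "coface n i = restrict (\<lambda>j. if j < i then j else Suc j) {..n}"

definition codegeneracy :: "nat \<Rightarrow> nat \<Rightarrow> nat \<Rightarrow> nat" where
    \<comment> \<open>\<open>[n+1] \<rightarrow> [n]\<close>, hits \<open>i\<close> twice\<close>
  "codegeneracy n i = restrict (\<lambda>j. if j \<le> i then j else j - 1) {..Suc n}"

definition long_map :: "nat \<Rightarrow> nat \<Rightarrow> nat" where
  "long_map n = restrict (\<lambda>i. if i = 0 then 0 else n) {..1}"

lemma active_long_map_iff: "active 1 n g \<longleftrightarrow> g = long_map n"
proof
  assume g: "active 1 n g"
  show "g = long_map n"
  proof
    fix i :: nat
    show "g i = long_map n i"
      using g by (cases "i = 0"; cases "i = 1")
        (auto simp: active_def Delta_def long_map_def PiE_def extensional_def)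
  qed
next
  assume "g = long_map n"
  then show "active 1 n g"
    by (auto simp: active_def Delta_def long_map_def mono_on_def)
qed

text \<open>The square \<open>h' g = g' h\<close> with \<open>g : [m] \<rightarrow> [n]\<close>, \<open>h : [m] \<rightarrow> [k]\<close>, \<open>g' : [k] \<rightarrow> [l]\<close>,
  \<open>h' : [n] \<rightarrow> [l]\<close> is a pushout in the simplex category.\<close>

definition Delta_pushout ::
    "nat \<Rightarrow> nat \<Rightarrow> nat \<Rightarrow> nat \<Rightarrow> (nat \<Rightarrow> nat) \<Rightarrow> (nat \<Rightarrow> nat) \<Rightarrow> (nat \<Rightarrow> nat) \<Rightarrow> (nat \<Rightarrow> nat) \<Rightarrow> bool"
  where
  "Delta_pushout m n k l g h g' h' \<longleftrightarrow>
     g \<in> Delta m n \<and> h \<in> Delta m k \<and> g' \<in> Delta k l \<and> h' \<in> Delta n l \<and>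
     compose {..m} h' g = compose {..m} g' h \<and>
     (\<forall>q. \<forall>u \<in> Delta n q. \<forall>v \<in> Delta k q. compose {..m} u g = compose {..m} v h \<longrightarrow>
       (\<exists>!w. w \<in> Delta l q \<and> compose {..n} w h' = u \<and> compose {..k} w g' = v))"


section \<open>Simplicial groupoids\<close>

record ('o, 'a) sgpd =
  level :: "nat \<Rightarrow> ('o, 'a) groupoid"
  act :: "nat \<Rightarrow> nat \<Rightarrow> (nat \<Rightarrow> nat) \<Rightarrow> ('o, 'a, 'o, 'a) gfun"
    \<comment> \<open>\<open>act X m n p\<close> is \<open>p\<^sup>* : X\<^sub>n \<rightarrow> X\<^sub>m\<close> for \<open>p : [m] \<rightarrow> [n]\<close>\<close>

locale simplicial_groupoid =
  fixes X :: "('o, 'a) sgpd"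
  assumes groupoid_level: "\<And>n. groupoid (level X n)"
    and functor_act: "\<And>m n p. p \<in> Delta m n \<Longrightarrow>
        groupoid_functor (level X n) (level X m) (act X m n p)"
    and act_id_Ob: "\<And>n x. x \<in> Ob (level X n) \<Longrightarrow> onOb (act X n n (restrict id {..n})) x = x"
    and act_id_Ar: "\<And>n f. f \<in> Ar (level X n) \<Longrightarrow> onAr (act X n n (restrict id {..n})) f = f"
    and act_comp_Ob: "\<And>l m n p q x. p \<in> Delta l m \<Longrightarrow> q \<in> Delta m n \<Longrightarrow> x \<in> Ob (level X n) \<Longrightarrow>
        onOb (act X l n (compose {..l} q p)) x = onOb (act X l m p) (onOb (act X m n q) x)"
    and act_comp_Ar: "\<And>l m n p q f. p \<in> Delta l m \<Longrightarrow> q \<in> Delta m n \<Longrightarrow> f \<in> Ar (level X n) \<Longrightarrow>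
        onAr (act X l n (compose {..l} q p)) f = onAr (act X l m p) (onAr (act X m n q) f)"

definition face :: "('o, 'a) sgpd \<Rightarrow> nat \<Rightarrow> nat \<Rightarrow> ('o, 'a, 'o, 'a) gfun" where
    \<comment> \<open>\<open>d\<^sub>i : X\<^sub>n\<^sub>+\<^sub>1 \<rightarrow> X\<^sub>n\<close>\<close>
  "face X n i = act X n (Suc n) (coface n i)"

definition degeneracy :: "('o, 'a) sgpd \<Rightarrow> nat \<Rightarrow> nat \<Rightarrow> ('o, 'a, 'o, 'a) gfun" where
    \<comment> \<open>\<open>s\<^sub>i : X\<^sub>n \<rightarrow> X\<^sub>n\<^sub>+\<^sub>1\<close>\<close>
  "degeneracy X n i = act X (Suc n) n (codegeneracy n i)"

definition long :: "('o, 'a) sgpd \<Rightarrow> nat \<Rightarrow> 'o \<Rightarrow> 'o" where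
  "long X n x = onOb (act X 1 n (long_map n)) x"

locale rigid_decomposition_groupoid = simplicial_groupoid X
  for X :: "('o, 'a) sgpd" +
  assumes d1_discrete_fibration: "discrete_fibration (level X 2) (level X 1) (face X 1 1)"
    and s0_fully_faithful: "fully_faithful (level X 0) (level X 1) (degeneracy X 0 0)"
    and pushout_to_pullback: "\<And>m n k l g h g' h'.
        active m n g \<Longrightarrow> inert m k h \<Longrightarrow> Delta_pushout m n k l g h g' h' \<Longrightarrow>
        strict_pullback (level X l) (level X n) (level X k)
          (act X n l h') (act X k l g') (act X m n g) (act X m k h)"

text \<open>Levelwise functors are required to be extensional, so that equal simplicial maps are
  equal terms.\<close>

locale simplicial_map = X: simplicial_groupoid X + Y: simplicial_groupoid Y
  for X :: "('o, 'a) sgpd" and Y :: "('p, 'b) sgpd" +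
  fixes J :: "nat \<Rightarrow> ('o, 'a, 'p, 'b) gfun"
  assumes functor_level: "\<And>n. groupoid_functor (level X n) (level Y n) (J n)"
    and onOb_ext: "\<And>n. onOb (J n) \<in> extensional (Ob (level X n))"
    and onAr_ext: "\<And>n. onAr (J n) \<in> extensional (Ar (level X n))"
    and act_onOb: "\<And>m n p x. p \<in> Delta m n \<Longrightarrow> x \<in> Ob (level X n) \<Longrightarrow>
        onOb (J m) (onOb (act X m n p) x) = onOb (act Y m n p) (onOb (J n) x)"
    and act_onAr: "\<And>m n p f. p \<in> Delta m n \<Longrightarrow> f \<in> Ar (level X n) \<Longrightarrow>
        onAr (J m) (onAr (act X m n p) f) = onAr (act Y m n p) (onAr (J n) f)"

locale strict_culf_map = simplicial_map X Y J
  for X :: "('o, 'a) sgpd" and Y :: "('p, 'b) sgpd" and J :: "nat \<Rightarrow> ('o, 'a, 'p, 'b) gfun" +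
  assumes culf: "\<And>m n p. active m n p \<Longrightarrow>
      strict_pullback (level X n) (level X m) (level Y n)
        (act X m n p) (J n) (J m) (act Y m n p)"

locale modification = J: simplicial_map X Y J + J': simplicial_map X Y J'
  for X :: "('o, 'a) sgpd" and Y :: "('p, 'b) sgpd"
    and J :: "nat \<Rightarrow> ('o, 'a, 'p, 'b) gfun" and J' :: "nat \<Rightarrow> ('o, 'a, 'p, 'b) gfun" +
  fixes \<Gamma> :: "nat \<Rightarrow> 'o \<Rightarrow> 'b"
  assumes nat_level: "\<And>n. nat_transformation (level X n) (level Y n) (J n) (J' n) (\<Gamma> n)"
    and whisker: "\<And>m n p x. p \<in> Delta m n \<Longrightarrow> x \<in> Ob (level X n) \<Longrightarrow>
        onAr (act Y m n p) (\<Gamma> n x) = \<Gamma> m (onOb (act X m n p) x)"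

definition id_modification ::
    "('o, 'a) sgpd \<Rightarrow> ('p, 'b) sgpd \<Rightarrow> (nat \<Rightarrow> ('o, 'a, 'p, 'b) gfun) \<Rightarrow> nat \<Rightarrow> 'o \<Rightarrow> 'b" where
  "id_modification X Y J n = restrict (\<lambda>x. Ident (level Y n) (onOb (J n) x)) (Ob (level X n))"

definition comp_modification ::
    "('o, 'a) sgpd \<Rightarrow> ('p, 'b) sgpd \<Rightarrow> (nat \<Rightarrow> 'o \<Rightarrow> 'b) \<Rightarrow> (nat \<Rightarrow> 'o \<Rightarrow> 'b) \<Rightarrow> nat \<Rightarrow> 'o \<Rightarrow> 'b" where
  "comp_modification X Y \<Gamma>' \<Gamma> n =
     restrict (\<lambda>x. Comp (level Y n) (\<Gamma>' n x) (\<Gamma> n x)) (Ob (level X n))"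

definition invertible_modification ::
    "('o, 'a) sgpd \<Rightarrow> ('p, 'b) sgpd \<Rightarrow> (nat \<Rightarrow> ('o, 'a, 'p, 'b) gfun) \<Rightarrow>
     (nat \<Rightarrow> ('o, 'a, 'p, 'b) gfun) \<Rightarrow> (nat \<Rightarrow> 'o \<Rightarrow> 'b) \<Rightarrow> bool" where
  "invertible_modification X Y J J' \<Gamma> \<longleftrightarrow> modification X Y J J' \<Gamma> \<and>
     (\<exists>\<Gamma>'. modification X Y J' J \<Gamma>' \<and>
        comp_modification X Y \<Gamma>' \<Gamma> = id_modification X Y J \<and>
        comp_modification X Y \<Gamma> \<Gamma>' = id_modification X Y J')"

text \<open>An arrow is a modification together with its source and target: \<open>(J, \<Gamma>, J')\<close>.\<close>

definition map_groupoid :: "('o, 'a) sgpd \<Rightarrow> ('p, 'b) sgpd \<Rightarrow>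
    (nat \<Rightarrow> ('o, 'a, 'p, 'b) gfun,
     (nat \<Rightarrow> ('o, 'a, 'p, 'b) gfun) \<times> (nat \<Rightarrow> 'o \<Rightarrow> 'b) \<times> (nat \<Rightarrow> ('o, 'a, 'p, 'b) gfun)) groupoid"
  where
  "map_groupoid X Y = \<lparr>
     Ob = {J. strict_culf_map X Y J},
     Ar = {(J, \<Gamma>, J'). strict_culf_map X Y J \<and> strict_culf_map X Y J' \<and>
             invertible_modification X Y J J' \<Gamma>},
     Dom = (\<lambda>(J, \<Gamma>, J'). J),
     Cod = (\<lambda>(J, \<Gamma>, J'). J'),
     Ident = (\<lambda>J. (J, id_modification X Y J, J)),
     Comp = (\<lambda>(J', \<Gamma>', J'') (J, \<Gamma>, _). (J, comp_modification X Y \<Gamma>' \<Gamma>, J''))\<rparr>"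


section \<open>Simplicial sets with chosen endpoints\<close>

record 'x sset =
  simplices :: "nat \<Rightarrow> 'x set"
  pull :: "nat \<Rightarrow> nat \<Rightarrow> (nat \<Rightarrow> nat) \<Rightarrow> 'x \<Rightarrow> 'x"  \<comment> \<open>\<open>pull A m n p : A\<^sub>n \<rightarrow> A\<^sub>m\<close>\<close>

record 'x bipointed_sset = "'x sset" +
  initial :: 'x
  terminal :: 'x

definition sset_map ::
    "('x, 'r) sset_scheme \<Rightarrow> ('y, 's) sset_scheme \<Rightarrow> (nat \<Rightarrow> 'x \<Rightarrow> 'y) \<Rightarrow> bool" where
  "sset_map A B F \<longleftrightarrow>
     (\<forall>n. F n \<in> simplices A n \<rightarrow>\<^sub>E simplices B n) \<and>
     (\<forall>m n. \<forall>p \<in> Delta m n. \<forall>x \<in> simplices A n. F m (pull A m n p x) = pull B m n p (F n x))"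

definition sset_iso ::
    "('x, 'r) sset_scheme \<Rightarrow> ('y, 's) sset_scheme \<Rightarrow> (nat \<Rightarrow> 'x \<Rightarrow> 'y) \<Rightarrow> bool" where
  "sset_iso A B F \<longleftrightarrow> sset_map A B F \<and> (\<exists>G. sset_map B A G \<and>
     (\<forall>n. \<forall>x \<in> simplices A n. G n (F n x) = x) \<and> (\<forall>n. \<forall>y \<in> simplices B n. F n (G n y) = y))"

definition stretched ::
    "('x, 'r) bipointed_sset_scheme \<Rightarrow> ('y, 's) bipointed_sset_scheme \<Rightarrow>
     (nat \<Rightarrow> 'x \<Rightarrow> 'y) \<Rightarrow> bool" where
  "stretched A B F \<longleftrightarrow> sset_map A B F \<and>
     F 0 (initial A) = initial B \<and> F 0 (terminal A) = terminal B"

definition std_simplex :: "nat \<Rightarrow> (nat \<Rightarrow> nat) bipointed_sset" where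
  "std_simplex n = \<lparr>simplices = (\<lambda>k. Delta k n), pull = (\<lambda>j k p q. compose {..j} q p),
     initial = restrict (\<lambda>_. 0) {..0}, terminal = restrict (\<lambda>_. n) {..0}\<rparr>"


section \<open>Intervals\<close>

text \<open>The map \<open>[m+2] \<rightarrow> [n+2]\<close> that adjoins a new bottom and a new top element to
  \<open>p : [m] \<rightarrow> [n]\<close>.  Precomposition with it shifts the indices of face and degeneracy maps by
  one, so it encodes the simplicial structure of an interval.\<close>

definition shift :: "nat \<Rightarrow> nat \<Rightarrow> (nat \<Rightarrow> nat) \<Rightarrow> nat \<Rightarrow> nat" where
  "shift m n p =
     restrict (\<lambda>i. if i = 0 then 0 else if i \<le> Suc m then Suc (p (i - 1)) else n + 2) {..m + 2}"

lemma shift_coface: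
  assumes "i \<le> Suc n"
  shows "shift n (Suc n) (coface n i) = coface (n + 2) (Suc i)"
proof
  fix j :: nat
  show "shift n (Suc n) (coface n i) j = coface (n + 2) (Suc i) j"
    using assms by (auto simp: shift_def coface_def restrict_def)
qed

lemma shift_codegeneracy:
  assumes "i \<le> n"
  shows "shift (Suc n) n (codegeneracy n i) = codegeneracy (n + 2) (Suc i)"
proof
  fix j :: nat
  show "shift (Suc n) n (codegeneracy n i) j = codegeneracy (n + 2) (Suc i) j"
    using assms by (auto simp: shift_def codegeneracy_def restrict_def)
qed

text \<open>For rigid \<open>X\<close> the functors \<open>long : X\<^sub>n\<^sub>+\<^sub>2 \<rightarrow> X\<^sub>1\<close> are discrete fibrations, so their strict
  fibres have only identity arrows and are given by their sets of objects.\<close>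

definition interval :: "('o, 'a) sgpd \<Rightarrow> 'o \<Rightarrow> 'o bipointed_sset" where
  "interval X f = \<lparr>
     simplices = (\<lambda>n. {x. x \<in> Ob (level X (n + 2)) \<and> long X (n + 2) x = f}),
     pull = (\<lambda>m n p. onOb (act X (m + 2) (n + 2) (shift m n p))),
     initial = onOb (degeneracy X 1 0) f,
     terminal = onOb (degeneracy X 1 1) f\<rparr>"

definition middle :: "('o, 'a) sgpd \<Rightarrow> nat \<Rightarrow> 'o \<Rightarrow> 'o" where
    \<comment> \<open>the map \<open>M\<^sub>f : I\<^sub>f \<rightarrow> X\<close> in degree \<open>n\<close>; the formula does not depend on \<open>f\<close>\<close>
  "middle X n x = onOb (face X n (Suc n)) (onOb (face X (Suc n) 0) x)"

definition subdivision :: "('o, 'a) sgpd \<Rightarrow> nat \<Rightarrow> 'o \<Rightarrow> nat \<Rightarrow> (nat \<Rightarrow> nat) \<Rightarrow> 'o" where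
    \<comment> \<open>\<open>\<phi>\<^sub>x\<close>; as a simplicial map, \<open>x\<close> sends \<open>q : [k] \<rightarrow> [n]\<close> to \<open>q\<^sup>* x\<close>\<close>
  "subdivision X n x = (THE \<phi>. stretched (std_simplex n) (interval X (long X n x)) \<phi> \<and>
     (\<forall>k. \<forall>q \<in> Delta k n. middle X k (\<phi> k q) = onOb (act X k n q) x))"

definition interval_incl ::
    "('o, 'a) sgpd \<Rightarrow> nat \<Rightarrow> nat \<Rightarrow> (nat \<Rightarrow> nat) \<Rightarrow> 'o \<Rightarrow> nat \<Rightarrow> 'o \<Rightarrow> 'o" where
    \<comment> \<open>\<open>c\<^sup>p\<^sub>x\<close> for \<open>p : [m] \<rightarrow> [n]\<close> and \<open>x\<close> in degree \<open>n\<close>\<close>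
  "interval_incl X m n p x = (let x' = onOb (act X m n p) x; I' = interval X (long X m x') in
     THE c. sset_map I' (interval X (long X n x)) c \<and>
       (\<forall>k. \<forall>q \<in> Delta k m.
          c k (subdivision X m x' k q) = subdivision X n x k (compose {..k} p q)) \<and>
       (\<forall>k. \<forall>\<sigma> \<in> simplices I' k. middle X k (c k \<sigma>) = middle X k \<sigma>))"


section \<open>The simplicial groupoid of subdivided intervals\<close>

type_synonym 'o subint = "'o bipointed_sset \<times> (nat \<Rightarrow> (nat \<Rightarrow> nat) \<Rightarrow> 'o)"

type_synonym 'o subint_arrow = "'o subint \<times> (nat \<Rightarrow> 'o \<Rightarrow> 'o) \<times> 'o subint"

definition subint :: "('o, 'a) sgpd \<Rightarrow> nat \<Rightarrow> 'o \<Rightarrow> 'o subint" where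
  "subint X n x = (interval X (long X n x), subdivision X n x)"

definition subint_groupoid :: "('o, 'a) sgpd \<Rightarrow> nat \<Rightarrow> ('o subint, 'o subint_arrow) groupoid" where
  "subint_groupoid X n = \<lparr>
     Ob = subint X n ` Ob (level X n),
     Ar = {((I, \<phi>), F, (I', \<phi>')).
             (I, \<phi>) \<in> subint X n ` Ob (level X n) \<and> (I', \<phi>') \<in> subint X n ` Ob (level X n) \<and>
             sset_iso I I' F \<and> (\<forall>k. \<forall>q \<in> Delta k n. F k (\<phi> k q) = \<phi>' k q)},
     Dom = (\<lambda>(A, F, B). A),
     Cod = (\<lambda>(A, F, B). B),
     Ident = (\<lambda>A. (A, \<lambda>k. restrict id (simplices (fst A) k), A)),
     Comp = (\<lambda>(_, G, C) (A, F, _). (A, \<lambda>k. compose (simplices (fst A) k) (G k) (F k), C))\<rparr>"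

text \<open>The pair \<open>(I\<^sub>f, \<phi>\<^sub>x)\<close> determines \<open>x\<close>: the degenerate simplex \<open>s\<^sub>0 f\<close> of \<open>I\<^sub>f\<close> determines
  \<open>f\<close>, and \<open>x = M\<^sub>f \<phi>\<^sub>x\<close>.\<close>

definition subint_simplex :: "('o, 'a) sgpd \<Rightarrow> nat \<Rightarrow> 'o subint \<Rightarrow> 'o" where
  "subint_simplex X n = inv_into (Ob (level X n)) (subint X n)"

definition subint_act_Ob ::
    "('o, 'a) sgpd \<Rightarrow> nat \<Rightarrow> nat \<Rightarrow> (nat \<Rightarrow> nat) \<Rightarrow> 'o subint \<Rightarrow> 'o subint" where
  "subint_act_Ob X m n p A = subint X m (onOb (act X m n p) (subint_simplex X n A))"

definition subint_act_Ar ::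
    "('o, 'a) sgpd \<Rightarrow> nat \<Rightarrow> nat \<Rightarrow> (nat \<Rightarrow> nat) \<Rightarrow> 'o subint_arrow \<Rightarrow> 'o subint_arrow" where
  "subint_act_Ar X m n p = (\<lambda>(A, F, B).
     let A' = subint_act_Ob X m n p A; B' = subint_act_Ob X m n p B;
         c = interval_incl X m n p (subint_simplex X n A);
         d = interval_incl X m n p (subint_simplex X n B)
     in (A', THE F'. sset_iso (fst A') (fst B') F' \<and>
               (\<forall>k. \<forall>q \<in> Delta k m. F' k (snd A' k q) = snd B' k q) \<and>
               (\<forall>k. \<forall>\<sigma> \<in> simplices (fst A') k. d k (F' k \<sigma>) = F k (c k \<sigma>)), B'))"

definition subdivided_intervals :: "('o, 'a) sgpd \<Rightarrow> ('o subint, 'o subint_arrow) sgpd" where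
  "subdivided_intervals X = \<lparr>level = subint_groupoid X,
          act = (\<lambda>m n p. \<lparr>onOb = subint_act_Ob X m n p, onAr = subint_act_Ar X m n p\<rparr>)\<rparr>"

end

theory Submission
  imports Defs
begin

text \<open>Both the objects and the arrows of \<open>X\<close> form simplicial sets satisfying the pushout axiom,
  and in such a set an \<open>n\<close>-simplex and a \<open>3\<close>-simplex whose middle edge is its long edge glue
  uniquely to an \<open>(n+2)\<close>-simplex.  Gluing gives explicit formulas for \<open>\<phi>\<^sub>x\<close>, \<open>c\<^sup>p\<^sub>x\<close> and the action
  of \<open>U\<^sub>X\<close> on arrows.  As the functors \<open>long\<close> are discrete fibrations, an arrow \<open>a\<close> of \<open>X\<close> acts by
  transport along \<open>long a\<close>, which makes \<open>x \<mapsto> (I\<^bsub>long x\<^esub>, \<phi>\<^sub>x)\<close> a culf map.  On objects, any culf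
  map \<open>J\<close> is a simplicial map \<open>j\<close> from the simplices of \<open>X\<close> to themselves which restricts to
  isomorphisms \<open>I\<^sub>f \<rightarrow> I\<^bsub>j f\<^esub>\<close>, and these form a modification from the canonical map to \<open>J\<close>.  It is
  the only one: active maps act on arrows of \<open>U\<^sub>X\<close> without changing the underlying map, so the
  component at \<open>x\<close> agrees with that at any \<open>s \<in> I\<^bsub>long x\<^esub>\<close>, which sends \<open>s\<close> to \<open>j s\<close> since
  it sends \<open>\<phi>\<^sub>s\<close> to \<open>\<phi>\<^bsub>j s\<^esub>\<close>.\<close>

text \<open>Adjoining two endpoints (\<open>shift\<close>) is left adjoint to the inclusion of the
  active maps into the simplex category, with unit \<open>mid\<close> and counit
  \<open>clamp\<close>. This adjunction and gluing generate all of the calculus of intervals.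

  The obstacle is that an arrow of U_X need not be compatible with the maps M_f, so it cannot be
  followed by taking middle parts. It does preserve the subdivision, hence the simplex
  \<open>pls 1 f\<close>, which records the endpoints of the interval. Therefore it commutes with
  \<open>pls\<close>, and since \<open>mdl\<close> undoes \<open>pls\<close>, its value at s can be
  read off two degrees higher, where inclusions of intervals are determined by gluing.

  The maps phi, c and p^*F are given by definite descriptions, so each formula needs a uniqueness
  proof. For phi it rests on the fact that a simplex of I_f running from the initial to the terminal
  object has degenerate first and last edges when viewed in X.

  Running the same calculus on arrows, with \<open>Dom\<close> and \<open>Cod\<close> preserving
  gluings, is what makes transport simplicial and compatible with c.\<close>

declare add_2_eq_Suc [simp del] add_2_eq_Suc' [simp del] One_nat_def [simp del]


section \<open>Maps in the simplex category\<close>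

lemma Delta_iff:
  "p \<in> Delta m n \<longleftrightarrow> p \<in> extensional {..m} \<and> (\<forall>i\<le>m. p i \<le> n) \<and>
     (\<forall>i j. i \<le> j \<longrightarrow> j \<le> m \<longrightarrow> p i \<le> p j)"
  by (auto simp: Delta_def PiE_def Pi_def mono_on_def)

lemma Delta_compose: "p \<in> Delta l m \<Longrightarrow> q \<in> Delta m n \<Longrightarrow> compose {..l} q p \<in> Delta l n"
  by (auto simp: Delta_iff compose_def)

lemma Delta_id: "restrict id {..n} \<in> Delta n n"
  by (auto simp: Delta_iff)

lemma Delta_le: "p \<in> Delta m n \<Longrightarrow> i \<le> m \<Longrightarrow> p i \<le> n"
  by (simp add: Delta_iff)

lemma Delta_mono: "p \<in> Delta m n \<Longrightarrow> i \<le> j \<Longrightarrow> j \<le> m \<Longrightarrow> p i \<le> p j"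
  by (simp add: Delta_iff)

lemma Delta_outside: "p \<in> Delta m n \<Longrightarrow> \<not> i \<le> m \<Longrightarrow> p i = undefined"
  by (auto simp: Delta_iff extensional_def)

lemma Delta_eqI:
  "p \<in> Delta m n \<Longrightarrow> q \<in> Delta m n \<Longrightarrow> (\<And>i. i \<le> m \<Longrightarrow> p i = q i) \<Longrightarrow> p = q"
  by (auto simp: Delta_iff intro: extensionalityI)

lemma activeD: "active m n p \<Longrightarrow> p \<in> Delta m n" "active m n p \<Longrightarrow> p 0 = 0"
  "active m n p \<Longrightarrow> p m = n"
  by (auto simp: active_def)

definition mid :: "nat \<Rightarrow> nat \<Rightarrow> nat" where
  "mid n = restrict Suc {..n}"

text \<open>Truncated subtraction sends both 0 and 1 to 0, and \<open>min\<close> sends both n + 1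
  and n + 2 to n, so each new endpoint is merged with its neighbour.\<close>

definition clamp :: "nat \<Rightarrow> nat \<Rightarrow> nat" where
  "clamp n = restrict (\<lambda>i. min (i - 1) n) {..n + 2}"

lemma mid_Delta: "mid n \<in> Delta n (n + 2)"
  by (auto simp: Delta_iff mid_def)

lemma clamp_active: "active (n + 2) n (clamp n)"
  by (auto simp: active_def Delta_iff clamp_def)

lemma clamp_Delta: "clamp n \<in> Delta (n + 2) n"
  by (rule activeD(1)[OF clamp_active])

lemma long_active: "active 1 n (long_map n)"
  using active_long_map_iff by blast

lemma long_Delta: "long_map n \<in> Delta 1 n"
  by (rule activeD(1)[OF long_active])

lemma shift_Delta: "p \<in> Delta m n \<Longrightarrow> shift m n p \<in> Delta (m + 2) (n + 2)"
  unfolding Delta_iff[of "shift m n p"]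
  by (auto simp: shift_def Delta_le Delta_mono intro: le_SucI)

lemma shift_active: "p \<in> Delta m n \<Longrightarrow> active (m + 2) (n + 2) (shift m n p)"
  using shift_Delta[of p m n] by (auto simp: active_def shift_def)

lemma shift_compose:
  assumes "p \<in> Delta l m" "q \<in> Delta m n"
  shows "compose {..l + 2} (shift m n q) (shift l m p) = shift l n (compose {..l} q p)"
proof
  fix i show "compose {..l + 2} (shift m n q) (shift l m p) i = shift l n (compose {..l} q p) i"
    using Delta_le[OF assms(1), of "i - 1"] by (auto simp: compose_def shift_def)
qed

lemma shift_id: "shift n n (restrict id {..n}) = restrict id {..n + 2}"
  by (rule ext) (auto simp: shift_def)

lemma clamp_mid: "compose {..n} (clamp n) (mid n) = restrict id {..n}"
  by (rule ext) (auto simp: compose_def clamp_def mid_def)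

lemma shift_mid:
  assumes "p \<in> Delta m n"
  shows "compose {..m} (shift m n p) (mid m) = compose {..m} (mid n) p"
  using Delta_le[OF assms] by (intro ext) (auto simp: compose_def shift_def mid_def)

text \<open>Naturality of the counit. The adjoined endpoints go to p 0 and p m on one side and to 0
  and n on the other; activity of p makes the two agree.\<close>

lemma active_clamp:
  assumes "active m n p"
  shows "compose {..m + 2} (clamp n) (shift m n p) = compose {..m + 2} p (clamp m)"
proof
  fix i
  have "p (i - 1) \<le> n" if "i \<le> Suc m"
    using Delta_le[OF activeD(1)[OF assms]] that by simp
  moreover have "i = m + 2" if "i \<le> m + 2" "\<not> i \<le> Suc m"
    using that by simp
  ultimately show "compose {..m + 2} (clamp n) (shift m n p) i = compose {..m + 2} p (clamp m) i"
    using activeD[OF assms] by (auto simp: compose_def shift_def clamp_def min_def)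
qed

text \<open>The second triangle identity. Acting on simplices, it exhibits every simplex s of an
  interval as the value of phi_s at \<open>mid\<close>.\<close>

lemma clamp_shift_mid: "compose {..n + 2} (clamp (n + 2)) (shift n (n + 2) (mid n)) = restrict id {..n + 2}"
  by (rule ext) (auto simp: compose_def clamp_def mid_def shift_def)

lemma active_compose: "active l m p \<Longrightarrow> active m n q \<Longrightarrow> active l n (compose {..l} q p)"
  by (auto simp: active_def Delta_compose) (auto simp: compose_def)

lemma compose_long: "active m n p \<Longrightarrow> compose {..1} p (long_map m) = long_map n"
  using active_compose[OF long_active] active_long_map_iff by blast

lemma compose_assoc_Delta:
  "p \<in> Delta k l \<Longrightarrow> compose {..k} r (compose {..k} q p) = compose {..k} (compose {..l} r q) p"
  by (rule ext) (auto simp: compose_def Delta_le)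

lemma compose_id_Delta:
  "p \<in> Delta m n \<Longrightarrow> compose {..m} p (restrict id {..m}) = p"
  "p \<in> Delta m n \<Longrightarrow> compose {..m} (restrict id {..n}) p = p"
  by (rule ext, auto simp: compose_def Delta_le Delta_outside)+

text \<open>The segment of [k] from b to b + m is replaced by a copy of [n], keeping b points before
  it and t points after it. A map out of the result consists of a map on the outer parts and one on
  the new segment; since g is active they meet at both ends of the segment, so they join to a
  monotone map.\<close>

lemma pushout_active_inert:
  assumes g: "active m n g"
  shows "Delta_pushout m n (b + m + t) (b + n + t) g (restrict (\<lambda>i. b + i) {..m})
    (restrict (\<lambda>i. if i < b then i else if i \<le> b + m then b + g (i - b) else i - m + n)
      {..b + m + t})
    (restrict (\<lambda>i. b + i) {..n})"
    (is "Delta_pushout m n ?k ?l g ?h ?g' ?h'")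
proof -
  note [simp] = activeD(2,3)[OF g]
  note gD = activeD(1)[OF g]
  have g_le: "g i \<le> n" if "i \<le> m" for i using Delta_le[OF gD] that .
  have g_le': "g (i - b) \<le> n" if "i \<le> b + m" for i using g_le that by simp
  have g': "?g' \<in> Delta ?k ?l"
  proof -
    have "?g' i \<le> ?g' j" if "i \<le> j" "j \<le> ?k" for i j
      using that g_le'[of i] Delta_mono[OF gD, of "i - b" "j - b"] by auto
    moreover have "?g' i \<le> ?l" if "i \<le> ?k" for i
      using that g_le'[of i] by auto
    ultimately show ?thesis by (auto simp: Delta_iff simp del: restrict_apply)
  qed
  have ex: "\<exists>!w. w \<in> Delta ?l q \<and> compose {..n} w ?h' = u \<and> compose {..?k} w ?g' = v"
    if u: "u \<in> Delta n q" and v: "v \<in> Delta ?k q"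
      and eq: "compose {..m} u g = compose {..m} v ?h" for q u v
  proof -
    have uv: "u (g i) = v (b + i)" if "i \<le> m" for i
      using fun_cong[OF eq, of i] that by (simp add: compose_def)
    \<comment> \<open>The ends of the replaced segment come from 0 and m, which g sends to 0 and n.
      These two equations give monotonicity across the junctions.\<close>
    have u0: "u 0 = v b" and un: "u n = v (b + m)"
      using uv[of 0] uv[of m] by simp_all
    define w where "w = restrict (\<lambda>i. if i < b then v i else if i \<le> b + n then u (i - b)
      else v (i - n + m)) {..?l}"
    have w_le: "w i \<le> q" if "i \<le> ?l" for i
      using that Delta_le[OF v, of i] Delta_le[OF v, of "i - n + m"] Delta_le[OF u, of "i - b"]
      by (auto simp: w_def)
    have w_mono: "w i \<le> w j" if ij: "i \<le> j" "j \<le> ?l" for i j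
    proof -
      have 1: "v i \<le> u k" if "i < b" "k \<le> n" for i k
        using Delta_mono[OF v, of i b] Delta_mono[OF u, of 0 k] that u0 by simp
      have 2: "u k \<le> v (j - n + m)" if "k \<le> n" "b + n < j" "j \<le> ?l" for j k
      proof -
        have "u k \<le> u n" using Delta_mono[OF u, of k n] that by simp
        also have "\<dots> \<le> v (j - n + m)"
          unfolding un by (rule Delta_mono[OF v]) (use that in linarith)+
        finally show ?thesis .
      qed
      show ?thesis
        using ij 1[of i "j - b"] 2[of "i - b" j] Delta_mono[OF v, of i j]
          Delta_mono[OF v, of i "j - n + m"] Delta_mono[OF v, of "i - n + m" "j - n + m"]
          Delta_mono[OF u, of "i - b" "j - b"]
        by (auto simp: w_def)
    qed
    have w: "w \<in> Delta ?l q"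
      using w_le w_mono by (auto simp: Delta_iff w_def simp del: restrict_apply)
    have wh: "compose {..n} w ?h' = u"
      using Delta_outside[OF u] by (intro ext) (auto simp: compose_def w_def)
    have wg: "compose {..?k} w ?g' = v"
    proof
      fix i
      have "w (b + g (i - b)) = v i" if "\<not> i < b" "i \<le> b + m"
      proof -
        have "i - b \<le> m" using that by simp
        then show ?thesis using that g_le[of "i - b"] uv[of "i - b"] by (auto simp: w_def)
      qed
      moreover have "w (i - m + n) = v i" if "\<not> i \<le> b + m" "i \<le> ?k"
        using that by (auto simp: w_def)
      moreover have "w i = v i" if "i < b" using that by (auto simp: w_def)
      ultimately show "compose {..?k} w ?g' i = v i"
        using Delta_outside[OF v, of i] by (auto simp: compose_def)
    qed
    show ?thesis
    proof (rule ex1I[of _ w])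
      show "w \<in> Delta ?l q \<and> compose {..n} w ?h' = u \<and> compose {..?k} w ?g' = v"
        using w wh wg by blast
    next
      fix w' assume w': "w' \<in> Delta ?l q \<and> compose {..n} w' ?h' = u \<and> compose {..?k} w' ?g' = v"
      have h: "w' (b + i) = w (b + i)" if "i \<le> n" for i
        using w' wh that by (metis (no_types, lifting) atMost_iff compose_eq restrict_apply')
      have k: "w' (?g' i) = w (?g' i)" if "i \<le> ?k" for i
        using w' wg that by (metis (no_types, lifting) atMost_iff compose_eq)
      \<comment> \<open>The images of \<open>?h'\<close> and \<open>?g'\<close> cover [l]: the new
        segment by the former, everything outside it by the latter.\<close>
      show "w' = w"
      proof (rule Delta_eqI)
        fix i assume i: "i \<le> ?l"
        show "w' i = w i"
        proof (cases "i < b")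
          case True
          then show ?thesis using k[of i] by simp
        next
          case False
          show ?thesis
          proof (cases "i \<le> b + n")
            case True
            then show ?thesis using h[of "i - b"] False by simp
          next
            case F: False
            \<comment> \<open>The point i - n + m is the preimage of i under the last clause of
              \<open>?g'\<close>.\<close>
            have "i - n + m \<le> ?k" "\<not> i - n + m \<le> b + m" "i - n + m - m + n = i"
              using F i by linarith+
            then show ?thesis using k[of "i - n + m"] by (simp del: Nat.diff_add_assoc2)
          qed
        qed
      qed (use w w' in auto)
    qed
  qed
  have "compose {..m} ?h' g = compose {..m} ?g' ?h"
    using g_le by (intro ext) (auto simp: compose_def)
  moreover have "?h \<in> Delta m ?k" "?h' \<in> Delta n ?l" by (auto simp: Delta_iff)
  ultimately show ?thesis
    unfolding Delta_pushout_def using gD g' ex by blast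
qed

lemma inert_add: "b + m \<le> k \<Longrightarrow> inert m k (restrict (\<lambda>i. b + i) {..m})"
  by (auto simp: inert_def Delta_iff)


section \<open>Gluing and intervals in decomposition sets\<close>

text \<open>Of the strict pullbacks only the unique fillers are kept, so that one development serves
  for the objects and for the arrows of X.\<close>

locale decomposition_set =
  fixes S :: "nat \<Rightarrow> 'x set" and P :: "nat \<Rightarrow> nat \<Rightarrow> (nat \<Rightarrow> nat) \<Rightarrow> 'x \<Rightarrow> 'x"
  assumes P_closed: "p \<in> Delta m n \<Longrightarrow> x \<in> S n \<Longrightarrow> P m n p x \<in> S m"
    and P_id: "x \<in> S n \<Longrightarrow> P n n (restrict id {..n}) x = x"
    and P_comp: "p \<in> Delta l m \<Longrightarrow> q \<in> Delta m n \<Longrightarrow> x \<in> S n \<Longrightarrow>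
        P l n (compose {..l} q p) x = P l m p (P m n q x)"
    and P_pushout: "active m n g \<Longrightarrow> inert m k h \<Longrightarrow> Delta_pushout m n k l g h g' h' \<Longrightarrow>
        y \<in> S n \<Longrightarrow> z \<in> S k \<Longrightarrow> P m n g y = P m k h z \<Longrightarrow>
        \<exists>!x. x \<in> S l \<and> P n l h' x = y \<and> P k l g' x = z"
begin

text \<open>\<open>lg\<close>, \<open>mdl\<close> and \<open>sh\<close> are the long edge, the map \<open>M\<^sub>f\<close> and the simplicial structure of
  \<open>I\<^sub>f\<close>, and \<open>pls n x\<close> is the top simplex \<open>\<phi>\<^sub>x(id)\<close> of \<open>\<phi>\<^sub>x\<close>; thus \<open>\<phi>\<^sub>x(q) = sh k n q (pls n x)\<close>.\<close>

definition lg :: "nat \<Rightarrow> 'x \<Rightarrow> 'x" where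
  "lg n = P 1 n (long_map n)"

definition mdl :: "nat \<Rightarrow> 'x \<Rightarrow> 'x" where
  "mdl n = P n (n + 2) (mid n)"

definition pls :: "nat \<Rightarrow> 'x \<Rightarrow> 'x" where
  "pls n = P (n + 2) n (clamp n)"

definition sh :: "nat \<Rightarrow> nat \<Rightarrow> (nat \<Rightarrow> nat) \<Rightarrow> 'x \<Rightarrow> 'x" where
  "sh m n p = P (m + 2) (n + 2) (shift m n p)"

section \<open>Identities between long edges, middle parts, subdivisions and restrictions\<close>

lemma lg_closed [simp]: "x \<in> S n \<Longrightarrow> lg n x \<in> S 1"
  unfolding lg_def by (rule P_closed[OF long_Delta])

lemma mdl_closed [simp]: "x \<in> S (n + 2) \<Longrightarrow> mdl n x \<in> S n"
  unfolding mdl_def by (rule P_closed[OF mid_Delta])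

lemma pls_closed [simp]: "x \<in> S n \<Longrightarrow> pls n x \<in> S (n + 2)"
  unfolding pls_def by (rule P_closed[OF clamp_Delta])

lemma sh_closed [simp]: "p \<in> Delta m n \<Longrightarrow> x \<in> S (n + 2) \<Longrightarrow> sh m n p x \<in> S (m + 2)"
  unfolding sh_def by (rule P_closed[OF shift_Delta])

lemma sh_id: "x \<in> S (n + 2) \<Longrightarrow> sh n n (restrict id {..n}) x = x"
  unfolding sh_def shift_id by (rule P_id)

lemma sh_comp: "p \<in> Delta l m \<Longrightarrow> q \<in> Delta m n \<Longrightarrow> x \<in> S (n + 2) \<Longrightarrow>
    sh l n (compose {..l} q p) x = sh l m p (sh m n q x)"
  unfolding sh_def shift_compose[symmetric] by (intro P_comp shift_Delta)

lemma lg_active: "active m n q \<Longrightarrow> x \<in> S n \<Longrightarrow> lg m (P m n q x) = lg n x"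
  unfolding lg_def by (subst P_comp[symmetric]) (auto simp: compose_long long_Delta activeD(1))

lemma lg_sh: "p \<in> Delta m n \<Longrightarrow> x \<in> S (n + 2) \<Longrightarrow> lg (m + 2) (sh m n p x) = lg (n + 2) x"
  unfolding sh_def by (intro lg_active shift_active)

lemma lg_pls: "x \<in> S n \<Longrightarrow> lg (n + 2) (pls n x) = lg n x"
  unfolding pls_def by (intro lg_active clamp_active)

lemma lg_1: "x \<in> S 1 \<Longrightarrow> lg 1 x = x"
proof -
  have "long_map 1 = restrict id {..1}"
    by (rule ext) (auto simp: long_map_def)
  then show "x \<in> S 1 \<Longrightarrow> lg 1 x = x" using P_id[of x 1] by (simp add: lg_def)
qed

lemma mdl_pls: "x \<in> S n \<Longrightarrow> mdl n (pls n x) = x"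
  unfolding mdl_def pls_def
  by (subst P_comp[symmetric]) (auto simp: clamp_mid clamp_Delta mid_Delta P_id simp del: restrict_apply)

lemma mdl_sh: "p \<in> Delta m n \<Longrightarrow> x \<in> S (n + 2) \<Longrightarrow> mdl m (sh m n p x) = P m n p (mdl n x)"
  unfolding mdl_def sh_def
  by (simp only: P_comp[symmetric] mid_Delta shift_Delta shift_mid)

lemma pls_active: "active m n q \<Longrightarrow> x \<in> S n \<Longrightarrow> pls m (P m n q x) = sh m n q (pls n x)"
  unfolding pls_def sh_def
  by (simp only: P_comp[symmetric] clamp_Delta shift_Delta activeD(1) active_clamp)

lemma sh_mid_pls: "x \<in> S (n + 2) \<Longrightarrow> sh n (n + 2) (mid n) (pls (n + 2) x) = x"
  unfolding sh_def pls_def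
  by (simp only: P_comp[symmetric] clamp_Delta shift_Delta mid_Delta clamp_shift_mid P_id)

lemma sh_long_pls: "x \<in> S n \<Longrightarrow> sh 1 n (long_map n) (pls n x) = pls 1 (lg n x)"
  unfolding lg_def by (simp add: pls_active long_active)

lemma lg_mdl: "x \<in> S (n + 2) \<Longrightarrow> lg n (mdl n x) = mdl 1 (sh 1 n (long_map n) x)"
  by (simp add: mdl_sh long_Delta lg_def)

text \<open>The pushout with b = t = 1: extending the long edge [1] -> [n] along the middle edge
  \<open>mid 1\<close> of [3] gives [n + 2], and the leg from [3] is the shifted long edge.\<close>

lemma gluing:
  assumes "x \<in> S n" "t \<in> S 3" "lg n x = mdl 1 t"
  shows "\<exists>!r. r \<in> S (n + 2) \<and> mdl n r = x \<and> sh 1 n (long_map n) r = t"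
proof -
  have h: "restrict (\<lambda>i. 1 + i) {..k} = mid k" for k
    by (rule ext) (auto simp: mid_def)
  have s: "restrict (\<lambda>i. if i < 1 then i else if i \<le> 1 + 1 then 1 + long_map n (i - 1) else i - 1 + n)
      {..1 + 1 + 1} = shift 1 n (long_map n)"
    by (rule ext) (auto simp: shift_def long_map_def)
  have "Delta_pushout 1 n (1 + 1 + 1) (1 + n + 1) (long_map n) (mid 1) (shift 1 n (long_map n)) (mid n)"
    using pushout_active_inert[OF long_active, where b = 1 and t = 1, of n] unfolding h s .
  moreover have "1 + 1 + 1 = (3::nat)" "1 + n + 1 = n + 2" by simp_all
  ultimately have "Delta_pushout 1 n 3 (n + 2) (long_map n) (mid 1) (shift 1 n (long_map n)) (mid n)"
    by (simp only:)
  moreover have "inert 1 3 (mid 1)"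
    using inert_add[of 1 1 3] by (simp only: h)
  ultimately show ?thesis
    using P_pushout[OF long_active, of 3 "mid 1" n "n + 2"] assms
    by (simp add: lg_def mdl_def sh_def)
qed

definition glue :: "nat \<Rightarrow> 'x \<Rightarrow> 'x \<Rightarrow> 'x" where
  "glue n x t = (THE r. r \<in> S (n + 2) \<and> mdl n r = x \<and> sh 1 n (long_map n) r = t)"

lemma
  assumes "x \<in> S n" "t \<in> S 3" "lg n x = mdl 1 t"
  shows glue_closed: "glue n x t \<in> S (n + 2)"
    and mdl_glue: "mdl n (glue n x t) = x"
    and sh_long_glue: "sh 1 n (long_map n) (glue n x t) = t"
  using theI'[OF gluing[OF assms]] by (simp_all add: glue_def)

lemma glue_unique:
  assumes "r \<in> S (n + 2)" "mdl n r = x" "sh 1 n (long_map n) r = t"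
  shows "r = glue n x t"
proof -
  have "t \<in> S 3"
    using sh_closed[OF long_Delta assms(1)] assms(3) by simp
  then show ?thesis
    unfolding glue_def using assms lg_mdl[OF assms(1)] mdl_closed[OF assms(1)]
    by (intro the1_equality[symmetric] gluing) simp_all
qed

text \<open>If the outer 3-simplex of r is doubly degenerate, then r and \<open>pls\<close> of its
  middle part glue the same data, because the long edge of that middle part is f.\<close>

lemma eq_pls:
  assumes r: "r \<in> S (n + 2)" and l: "sh 1 n (long_map n) r = pls 1 f" and f: "f \<in> S 1"
  shows "r = pls n (mdl n r)"
proof -
  have m: "mdl n r \<in> S n" using r by simp
  have *: "lg n (mdl n r) = f"
    using lg_mdl[OF r] mdl_pls[OF f] l by simp
  have "r = glue n (mdl n r) (pls 1 f)"
    using r l by (intro glue_unique) auto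
  also have "\<dots> = pls n (mdl n r)"
    by (rule glue_unique[symmetric]) (use m in \<open>auto simp: mdl_pls sh_long_pls *\<close>)
  finally show ?thesis .
qed

text \<open>The restriction of \<open>\<phi>\<^sub>x\<close> along \<open>long(p)\<close>: the factorization of \<open>long x\<close> into the part
  before \<open>p\<close>, the long edge of \<open>p\<^sup>*x\<close>, and the part after \<open>p\<close>.\<close>

definition split3 :: "nat \<Rightarrow> nat \<Rightarrow> (nat \<Rightarrow> nat) \<Rightarrow> 'x \<Rightarrow> 'x" where
  "split3 m n p x = sh 1 n (compose {..1} p (long_map m)) (pls n x)"

lemma split3_closed: "p \<in> Delta m n \<Longrightarrow> x \<in> S n \<Longrightarrow> split3 m n p x \<in> S 3"
  unfolding split3_def
  using sh_closed[OF Delta_compose[OF long_Delta]] pls_closed by simp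

lemma mdl_split3: "p \<in> Delta m n \<Longrightarrow> x \<in> S n \<Longrightarrow> mdl 1 (split3 m n p x) = lg m (P m n p x)"
  unfolding split3_def
  by (simp only: mdl_sh Delta_compose[OF long_Delta] pls_closed mdl_pls lg_def P_comp long_Delta)

lemma lg_split3: "p \<in> Delta m n \<Longrightarrow> x \<in> S n \<Longrightarrow> lg 3 (split3 m n p x) = lg n x"
  using lg_sh[OF Delta_compose[OF long_Delta], of p m n "pls n x"]
  by (simp add: split3_def lg_pls)

text \<open>The formula for c: s is inserted as the middle part of the factorization of long x,
  which gives a simplex of degree k + 4. Restricting along \<open>mid k\<close> then drops its
  vertices 1 and k + 3, the endpoints of s.\<close>

definition incl :: "nat \<Rightarrow> nat \<Rightarrow> (nat \<Rightarrow> nat) \<Rightarrow> 'x \<Rightarrow> nat \<Rightarrow> 'x \<Rightarrow> 'x" where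
  "incl m n p x k s = sh k (k + 2) (mid k) (glue (k + 2) s (split3 m n p x))"

definition ivl :: "'x \<Rightarrow> nat \<Rightarrow> 'x set" where
  "ivl f k = {s. s \<in> S (k + 2) \<and> lg (k + 2) s = f}"

lemma sh_ivl: "q \<in> Delta j k \<Longrightarrow> s \<in> ivl f k \<Longrightarrow> sh j k q s \<in> ivl f j"
  by (simp add: ivl_def lg_sh)

lemma pls_ivl: "s \<in> ivl f k \<Longrightarrow> pls (k + 2) s \<in> ivl f (k + 2)"
  unfolding ivl_def using pls_closed[of s "k + 2"] lg_pls[of s "k + 2"] by simp

lemma pls_in_ivl: "x \<in> S n \<Longrightarrow> pls n x \<in> ivl (lg n x) n"
  by (simp add: ivl_def lg_pls)

context
  fixes m n p x
  assumes p: "p \<in> Delta m n" and x: "x \<in> S n"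
begin

lemma glue_split3:
  assumes "s \<in> ivl (lg m (P m n p x)) k"
  shows "glue (k + 2) s (split3 m n p x) \<in> S (k + 2 + 2)"
    "mdl (k + 2) (glue (k + 2) s (split3 m n p x)) = s"
    "sh 1 (k + 2) (long_map (k + 2)) (glue (k + 2) s (split3 m n p x)) = split3 m n p x"
  using glue_closed[of s "k + 2" "split3 m n p x"] mdl_glue[of s "k + 2" "split3 m n p x"]
    sh_long_glue[of s "k + 2" "split3 m n p x"] assms split3_closed[OF p x] mdl_split3[OF p x]
  unfolding ivl_def by simp_all

lemma glue_split3_ivl:
  assumes "s \<in> ivl (lg m (P m n p x)) k"
  shows "glue (k + 2) s (split3 m n p x) \<in> ivl (lg n x) (k + 2)"
proof -
  let ?r = "glue (k + 2) s (split3 m n p x)"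
  note g = glue_split3[OF assms]
  have "lg (k + 2 + 2) ?r = lg (1 + 2) (sh 1 (k + 2) (long_map (k + 2)) ?r)"
    by (rule lg_sh[OF long_Delta g(1), symmetric])
  also have "\<dots> = lg n x"
    unfolding g(3) using lg_split3[OF p x] by simp
  finally show ?thesis using g(1) by (simp add: ivl_def)
qed

lemma incl_ivl:
  assumes "s \<in> ivl (lg m (P m n p x)) k"
  shows "incl m n p x k s \<in> ivl (lg n x) k"
  unfolding incl_def by (rule sh_ivl[OF mid_Delta glue_split3_ivl[OF assms]])

lemma mdl_incl:
  assumes "s \<in> ivl (lg m (P m n p x)) k"
  shows "mdl k (incl m n p x k s) = mdl k s"
  unfolding incl_def
  by (simp only: mdl_sh[OF mid_Delta glue_split3(1)[OF assms]] glue_split3(2)[OF assms])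
    (simp add: mdl_def)

text \<open>Gluing is natural in s: the shift of q fixes both endpoints of s, so the outer 3-simplex
  stays the same and uniqueness of gluing applies.\<close>

lemma glue_sh:
  assumes s: "s \<in> ivl (lg m (P m n p x)) k" and q: "q \<in> Delta j k"
  shows "glue (j + 2) (sh j k q s) (split3 m n p x) =
    sh (j + 2) (k + 2) (shift j k q) (glue (k + 2) s (split3 m n p x))"
proof -
  let ?r = "glue (k + 2) s (split3 m n p x)" and ?q = "shift j k q"
  note g = glue_split3[OF s]
  note q' = shift_Delta[OF q]
  show ?thesis
  proof (rule glue_unique[symmetric])
    show "sh (j + 2) (k + 2) ?q ?r \<in> S (j + 2 + 2)" by (rule sh_closed[OF q' g(1)])
    show "mdl (j + 2) (sh (j + 2) (k + 2) ?q ?r) = sh j k q s"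
      by (simp only: mdl_sh[OF q' g(1)] g(2)) (simp add: sh_def)
    show "sh 1 (j + 2) (long_map (j + 2)) (sh (j + 2) (k + 2) ?q ?r) = split3 m n p x"
      using g(3) compose_long[OF shift_active[OF q]]
      by (simp only: sh_comp[OF long_Delta q' g(1), symmetric])
  qed
qed

lemma incl_sh:
  assumes s: "s \<in> ivl (lg m (P m n p x)) k" and q: "q \<in> Delta j k"
  shows "incl m n p x j (sh j k q s) = sh j k q (incl m n p x k s)"
proof -
  let ?r = "glue (k + 2) s (split3 m n p x)" and ?q = "shift j k q"
  note g = glue_split3[OF s]
  note q' = shift_Delta[OF q]
  have "incl m n p x j (sh j k q s) = sh j (j + 2) (mid j) (sh (j + 2) (k + 2) ?q ?r)"
    by (simp only: incl_def glue_sh[OF s q])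
  also have "\<dots> = sh j (k + 2) (compose {..j} (mid k) q) ?r"
    using shift_mid[OF q] by (simp only: sh_comp[OF mid_Delta q' g(1), symmetric])
  also have "\<dots> = sh j k q (incl m n p x k s)"
    unfolding incl_def by (rule sh_comp[OF q mid_Delta g(1)])
  finally show ?thesis .
qed

text \<open>When s is the top simplex of the subdivision by p^*x, the glued simplex is a value of
  phi_x, namely at p with its first and last values repeated.\<close>

lemma glue_pls:
  "glue (m + 2) (pls m (P m n p x)) (split3 m n p x) =
    sh (m + 2) n (compose {..m + 2} p (clamp m)) (pls n x)"
proof -
  let ?q = "compose {..m + 2} p (clamp m)"
  have q: "?q \<in> Delta (m + 2) n" by (rule Delta_compose[OF clamp_Delta p])
  note plx = pls_closed[OF x]
  show ?thesis
  proof (rule glue_unique[symmetric])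
    show "sh (m + 2) n ?q (pls n x) \<in> S (m + 2 + 2)" by (rule sh_closed[OF q plx])
    show "mdl (m + 2) (sh (m + 2) n ?q (pls n x)) = pls m (P m n p x)"
      unfolding mdl_sh[OF q plx] mdl_pls[OF x] unfolding pls_def
      by (rule P_comp[OF clamp_Delta p x])
    show "sh 1 (m + 2) (long_map (m + 2)) (sh (m + 2) n ?q (pls n x)) = split3 m n p x"
      unfolding split3_def sh_comp[OF long_Delta q plx, symmetric]
        compose_assoc_Delta[OF long_Delta, symmetric] compose_long[OF clamp_active] ..
  qed
qed

lemma incl_pls: "incl m n p x m (pls m (P m n p x)) = sh m n p (pls n x)"
proof -
  have "compose {..m} (compose {..m + 2} p (clamp m)) (mid m) = p"
    unfolding compose_assoc_Delta[OF mid_Delta, symmetric] clamp_mid by (rule compose_id_Delta[OF p])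
  then show ?thesis
    by (simp only: incl_def glue_pls
        sh_comp[OF mid_Delta Delta_compose[OF clamp_Delta p] pls_closed[OF x], symmetric])
qed

end

text \<open>Collapsing an edge is the pushout of the active map \<open>[1] \<rightarrow> [0]\<close> along an inert map.\<close>

lemma degenerate_edge:
  assumes t: "t \<in> S (b + 1 + c)" and z: "z \<in> S 0"
    and e: "P 1 (b + 1 + c) (restrict (\<lambda>i. b + i) {..1}) t = P 1 0 (restrict (\<lambda>_. 0) {..1}) z"
  shows "\<exists>y \<in> S (b + c). t = P (b + 1 + c) (b + c)
    (restrict (\<lambda>i. if i \<le> b then i else i - 1) {..b + 1 + c}) y"
proof -
  let ?s = "restrict (\<lambda>_. 0) {..1::nat} :: nat \<Rightarrow> nat"
  have s: "active 1 0 ?s" by (auto simp: active_def Delta_iff)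
  have h: "restrict (\<lambda>i. if i < b then i else if i \<le> b + 1 then b + ?s (i - b) else i - 1 + 0) {..b + 1 + c}
    = restrict (\<lambda>i. if i \<le> b then i else i - 1) {..b + 1 + c}"
    by (rule ext) auto
  have i: "inert 1 (b + 1 + c) (restrict (\<lambda>i. b + i) {..1})" by (rule inert_add) simp
  from P_pushout[OF s i pushout_active_inert[OF s, where b = b and t = c] z t e[symmetric]]
  show ?thesis unfolding h by auto
qed


text \<open>The hypotheses say that the first and last vertices of r, as simplices of I_f, are the
  chosen endpoints s_0 f and s_1 f. In X this makes the first and last edges of r degenerate;
  collapsing both shows that r comes from degree n along \<open>clamp\<close>.\<close>

lemma eq_pls_endpoints:
  assumes r: "r \<in> S (n + 2)"
    and i: "sh 0 n (restrict (\<lambda>_. 0) {..0}) r = P 2 1 (codegeneracy 1 0) (lg (n + 2) r)"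
    and t: "sh 0 n (restrict (\<lambda>_. n) {..0}) r = P 2 1 (codegeneracy 1 1) (lg (n + 2) r)"
  shows "r = pls n (mdl n r)"
proof -
  define f where "f = lg (n + 2) r"
  have f: "f \<in> S 1" using r by (simp add: f_def)
  let ?c = "restrict (\<lambda>_. 0) {..1::nat} :: nat \<Rightarrow> nat"
  let ?v = "\<lambda>i. restrict (\<lambda>_. i) {..0::nat} :: nat \<Rightarrow> nat"
  let ?e = "\<lambda>b. restrict (\<lambda>i. b + i) {..1::nat}"
  have cD: "?c \<in> Delta 1 0" by (auto simp: Delta_iff)
  have vD: "?v i \<in> Delta 0 k" if "i \<le> k" for i k using that by (auto simp: Delta_iff)
  have eD: "?e b \<in> Delta 1 k" if "b + 1 \<le> k" for b k using that by (auto simp: Delta_iff)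
  have dD: "codegeneracy 1 b \<in> Delta 2 1" if "b \<le> 1" for b
    using that by (auto simp: Delta_iff codegeneracy_def numeral_2_eq_2 One_nat_def)
  have svD: "shift 0 n (?v i) \<in> Delta 2 (n + 2)" if "i \<le> n" for i
    using shift_Delta[OF vD[OF that]] by simp
  \<comment> \<open>In s_b f the edge from b to b + 1 is degenerate on vertex b of f.\<close>
  have edge: "P 1 2 (?e b) (P 2 1 (codegeneracy 1 b) f) = P 1 0 ?c (P 0 1 (?v b) f)" if "b \<le> 1" for b
  proof -
    have "compose {..1} (codegeneracy 1 b) (?e b) = compose {..1} (?v b) ?c"
      using that by (intro ext) (auto simp: compose_def codegeneracy_def)
    moreover have "b + 1 \<le> 2" using that by simp
    ultimately show ?thesis
      using P_comp[OF eD dD[OF that] f, of b] P_comp[OF cD vD[OF that] f] by (simp only:)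
  qed
  have "P 1 (0 + 1 + (n + 1)) (?e 0) r = P 1 0 ?c (P 0 1 (?v 0) f)"
  proof -
    have "compose {..1} (shift 0 n (?v 0)) (?e 0) = ?e 0"
      by (rule ext) (auto simp: compose_def shift_def)
    then have "P 1 (n + 2) (?e 0) r = P 1 2 (?e 0) (sh 0 n (?v 0) r)"
      using P_comp[OF eD svD r, of 0 0] by (simp add: sh_def)
    moreover have "0 + 1 + (n + 1) = n + 2" by simp
    ultimately show ?thesis using edge[of 0] i by (simp only: f_def)
  qed
  moreover have n2: "0 + 1 + (n + 1) = n + 2" "0 + (n + 1) = n + 1" by simp_all
  ultimately obtain y where y: "y \<in> S (n + 1)"
    and ry: "r = P (n + 2) (n + 1) (restrict (\<lambda>i. if i \<le> 0 then i else i - 1) {..n + 2}) y"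
    using degenerate_edge[of r 0 "n + 1" "P 0 1 (?v 0) f"] r P_closed[OF vD f, of 0]
    unfolding n2 by blast
  let ?k = "restrict (\<lambda>i. if i \<le> 0 then i else i - 1) {..n + 2}"
  have kD: "?k \<in> Delta (n + 2) (n + 1)" by (auto simp: Delta_iff)
  \<comment> \<open>After the first collapse the last edge of r has become the last edge of y, with
    its index lowered by one.\<close>
  have "P 1 (n + 1 + 0) (?e n) y = P 1 0 ?c (P 0 1 (?v 1) f)"
  proof -
    have "compose {..1} ?k (?e (n + 1)) = ?e n"
      by (rule ext) (auto simp: compose_def)
    then have "P 1 (n + 1) (?e n) y = P 1 (n + 2) (?e (n + 1)) r"
      using P_comp[OF eD kD y, of "n + 1"] ry by simp
    also have "compose {..1} (shift 0 n (?v n)) (?e 1) = ?e (n + 1)"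
      by (rule ext) (auto simp: compose_def shift_def)
    then have "P 1 (n + 2) (?e (n + 1)) r = P 1 2 (?e 1) (sh 0 n (?v n) r)"
      using P_comp[OF eD svD r, of 1 n] by (simp add: sh_def)
    finally show ?thesis using edge[of 1] t by (simp add: f_def)
  qed
  then obtain w where w: "w \<in> S n"
    and yw: "y = P (n + 1) n (restrict (\<lambda>i. if i \<le> n then i else i - 1) {..n + 1}) w"
    using degenerate_edge[of y n 0 "P 0 1 (?v 1) f"] y P_closed[OF vD f, of 1] by auto
  let ?l = "restrict (\<lambda>i. if i \<le> n then i else i - 1) {..n + 1}"
  have lD: "?l \<in> Delta (n + 1) n" by (auto simp: Delta_iff)
  have "compose {..n + 2} ?l ?k = clamp n"
    by (rule ext) (auto simp: compose_def clamp_def)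
  then have "r = pls n w"
    using P_comp[OF kD lD w] ry yw by (simp add: pls_def)
  then show ?thesis using mdl_pls[OF w] by simp
qed


section \<open>Maps and isomorphisms of intervals\<close>

definition imap :: "'x \<Rightarrow> 'x \<Rightarrow> (nat \<Rightarrow> 'x \<Rightarrow> 'x) \<Rightarrow> bool" where
  "imap f g F \<longleftrightarrow> (\<forall>k. F k \<in> ivl f k \<rightarrow>\<^sub>E ivl g k) \<and>
     (\<forall>j k. \<forall>q \<in> Delta j k. \<forall>s \<in> ivl f k. F j (sh j k q s) = sh j k q (F k s))"

definition iiso :: "'x \<Rightarrow> 'x \<Rightarrow> (nat \<Rightarrow> 'x \<Rightarrow> 'x) \<Rightarrow> bool" where
  "iiso f g F \<longleftrightarrow> imap f g F \<and> (\<exists>G. imap g f G \<and>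
     (\<forall>k. \<forall>s \<in> ivl f k. G k (F k s) = s) \<and> (\<forall>k. \<forall>s \<in> ivl g k. F k (G k s) = s))"

lemma imapI:
  assumes "\<And>k. F k \<in> extensional (ivl f k)" "\<And>k s. s \<in> ivl f k \<Longrightarrow> F k s \<in> ivl g k"
    "\<And>j k q s. q \<in> Delta j k \<Longrightarrow> s \<in> ivl f k \<Longrightarrow> F j (sh j k q s) = sh j k q (F k s)"
  shows "imap f g F"
  unfolding imap_def PiE_def using assms by blast

lemma
  assumes "imap f g F"
  shows imap_ext: "F k \<in> extensional (ivl f k)"
    and imap_ivl: "s \<in> ivl f k \<Longrightarrow> F k s \<in> ivl g k"
    and imap_sh: "q \<in> Delta j k \<Longrightarrow> s \<in> ivl f k \<Longrightarrow> F j (sh j k q s) = sh j k q (F k s)"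
  using assms unfolding imap_def PiE_def by blast+

lemma imap_eqI:
  assumes "imap f g F" "imap f g' F'" "\<And>k s. s \<in> ivl f k \<Longrightarrow> F k s = F' k s"
  shows "F = F'"
  by (rule ext, rule extensionalityI[OF imap_ext[OF assms(1)] imap_ext[OF assms(2)] assms(3)])

definition iid :: "'x \<Rightarrow> nat \<Rightarrow> 'x \<Rightarrow> 'x" where
  "iid f = (\<lambda>k. restrict id (ivl f k))"

definition icomp :: "'x \<Rightarrow> (nat \<Rightarrow> 'x \<Rightarrow> 'x) \<Rightarrow> (nat \<Rightarrow> 'x \<Rightarrow> 'x) \<Rightarrow> nat \<Rightarrow> 'x \<Rightarrow> 'x" where
  "icomp f G F = (\<lambda>k. compose (ivl f k) (G k) (F k))"

lemma iid_apply: "s \<in> ivl f k \<Longrightarrow> iid f k s = s"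
  by (simp add: iid_def)

lemma icomp_apply: "s \<in> ivl f k \<Longrightarrow> icomp f G F k s = G k (F k s)"
  by (simp add: icomp_def compose_def)

lemma icomp_eq_iid: "(\<And>k s. s \<in> ivl f k \<Longrightarrow> G k (F k s) = s) \<Longrightarrow> icomp f G F = iid f"
  by (auto simp: icomp_def iid_def compose_def fun_eq_iff)

lemma imap_iid: "imap f f (iid f)"
  by (rule imapI) (auto simp: iid_def sh_ivl)

lemma imap_icomp:
  assumes F: "imap f g F" and G: "imap g h G"
  shows "imap f h (icomp f G F)"
  by (rule imapI)
    (simp_all add: icomp_apply sh_ivl imap_ivl[OF F] imap_ivl[OF G] imap_sh[OF F] imap_sh[OF G],
      simp add: icomp_def)

lemma iiso_imap: "iiso f g F \<Longrightarrow> imap f g F"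
  by (simp add: iiso_def)

lemma iiso_iid: "iiso f f (iid f)"
  unfolding iiso_def using imap_iid[of f] iid_apply[of _ f] by auto

lemma iiso_icomp:
  assumes "iiso f g F" "iiso g h G"
  shows "iiso f h (icomp f G F)"
proof -
  from assms obtain F' G' where *: "imap f g F" "imap g h G" "imap g f F'" "imap h g G'"
    "\<And>k s. s \<in> ivl f k \<Longrightarrow> F' k (F k s) = s" "\<And>k s. s \<in> ivl g k \<Longrightarrow> F k (F' k s) = s"
    "\<And>k s. s \<in> ivl g k \<Longrightarrow> G' k (G k s) = s" "\<And>k s. s \<in> ivl h k \<Longrightarrow> G k (G' k s) = s"
    unfolding iiso_def by metis
  show ?thesis unfolding iiso_def
    using * imap_icomp[OF *(1,2)] imap_icomp[OF *(4,3)] imap_ivl[OF *(1)] imap_ivl[OF *(2)]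
       imap_ivl[OF *(3)] imap_ivl[OF *(4)]
    by (intro conjI exI[of _ "icomp h F' G'"]) (auto simp: icomp_apply)
qed

text \<open>Compatibility with \<open>\<phi>\<^sub>x\<close> and \<open>\<phi>\<^sub>y\<close> only has to be required on the top simplex
  \<open>pls n x = \<phi>\<^sub>x(id)\<close>.\<close>

definition marked :: "nat \<Rightarrow> 'x \<Rightarrow> 'x \<Rightarrow> (nat \<Rightarrow> 'x \<Rightarrow> 'x) \<Rightarrow> bool" where
  "marked n x y F \<longleftrightarrow> imap (lg n x) (lg n y) F \<and> F n (pls n x) = pls n y"

definition arr :: "nat \<Rightarrow> 'x \<Rightarrow> 'x \<Rightarrow> (nat \<Rightarrow> 'x \<Rightarrow> 'x) \<Rightarrow> bool" where
  "arr n x y F \<longleftrightarrow> iiso (lg n x) (lg n y) F \<and> F n (pls n x) = pls n y"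

lemma marked_imap: "marked n x y F \<Longrightarrow> imap (lg n x) (lg n y) F"
  by (simp add: marked_def)

lemma marked_pls: "marked n x y F \<Longrightarrow> F n (pls n x) = pls n y"
  by (simp add: marked_def)

lemma arr_marked: "arr n x y F \<Longrightarrow> marked n x y F"
  by (simp add: arr_def marked_def iiso_imap)

lemma arrI:
  assumes "marked n x y F" "marked n y x G"
    "\<And>k s. s \<in> ivl (lg n x) k \<Longrightarrow> G k (F k s) = s"
    "\<And>k s. s \<in> ivl (lg n y) k \<Longrightarrow> F k (G k s) = s"
  shows "arr n x y F"
  using assms unfolding arr_def iiso_def marked_def by blast

lemma arrE:
  assumes "arr n x y F" "x \<in> S n"
  obtains G where "marked n x y F" "marked n y x G" "arr n y x G"
    "\<And>k s. s \<in> ivl (lg n x) k \<Longrightarrow> G k (F k s) = s"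
    "\<And>k s. s \<in> ivl (lg n y) k \<Longrightarrow> F k (G k s) = s"
proof -
  from assms(1) obtain G where "imap (lg n y) (lg n x) G"
    "\<And>k s. s \<in> ivl (lg n x) k \<Longrightarrow> G k (F k s) = s"
    "\<And>k s. s \<in> ivl (lg n y) k \<Longrightarrow> F k (G k s) = s"
    unfolding arr_def iiso_def by blast
  moreover from this have "G n (pls n y) = pls n x"
    using assms pls_in_ivl[OF assms(2)] unfolding arr_def by metis
  ultimately show ?thesis
    using that[of G] arr_marked[OF assms(1)] arrI[of n y x G F] unfolding marked_def by blast
qed

lemma marked_sh_pls:
  "marked n x y F \<Longrightarrow> x \<in> S n \<Longrightarrow> q \<in> Delta k n \<Longrightarrow> F k (sh k n q (pls n x)) = sh k n q (pls n y)"
  using imap_sh[OF marked_imap] pls_in_ivl marked_pls by metis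

lemma marked_iid: "x \<in> S n \<Longrightarrow> marked n x x (iid (lg n x))"
  by (simp add: marked_def imap_iid iid_apply pls_in_ivl)

lemma marked_icomp:
  "marked n x y F \<Longrightarrow> marked n y z G \<Longrightarrow> x \<in> S n \<Longrightarrow> marked n x z (icomp (lg n x) G F)"
  using imap_icomp by (auto simp: marked_def icomp_apply pls_in_ivl)

lemma arr_iid: "x \<in> S n \<Longrightarrow> arr n x x (iid (lg n x))"
  using marked_iid by (simp add: arr_def iiso_iid marked_def)

lemma arr_icomp:
  "arr n x y F \<Longrightarrow> arr n y z G \<Longrightarrow> x \<in> S n \<Longrightarrow> arr n x z (icomp (lg n x) G F)"
  using iiso_icomp by (auto simp: arr_def icomp_apply pls_in_ivl)

text \<open>A stretched map preserves degeneracy of the outer edges, and by \<open>eq_pls\<close> this characterizes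
  the image of \<open>pls\<close>.\<close>

lemma marked_commutes_pls:
  assumes F: "marked n x y F" and x: "x \<in> S n" and y: "y \<in> S n" and s: "s \<in> ivl (lg n x) k"
  shows "F (k + 2) (pls (k + 2) s) = pls (k + 2) (F k s)"
proof -
  note F' = marked_imap[OF F]
  let ?r = "F (k + 2) (pls (k + 2) s)"
  have s': "s \<in> S (k + 2)" "lg (k + 2) s = lg n x" using s by (simp_all add: ivl_def)
  have r: "?r \<in> S (k + 2 + 2)"
    using imap_ivl[OF F' pls_ivl[OF s]] by (simp add: ivl_def)
  have "F 1 (pls 1 (lg n x)) = pls 1 (lg n y)"
    using marked_sh_pls[OF F x long_Delta] by (simp add: sh_long_pls x y)
  then have "sh 1 (k + 2) (long_map (k + 2)) ?r = pls 1 (lg n y)"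
    using imap_sh[OF F' long_Delta pls_ivl[OF s]] sh_long_pls[OF s'(1)] s'(2) by simp
  then have *: "?r = pls (k + 2) (mdl (k + 2) ?r)"
    by (rule eq_pls[OF r _ lg_closed[OF y]])
  \<comment> \<open>Since s is the value of phi_s at \<open>mid\<close>, F s is the same face of
    \<open>?r\<close>; and as \<open>?r\<close> lies in the image of \<open>pls\<close>, that face
    is its middle part.\<close>
  have "F k s = sh k (k + 2) (mid k) ?r"
    using imap_sh[OF F' mid_Delta pls_ivl[OF s]] sh_mid_pls[OF s'(1)] by simp
  also have "\<dots> = mdl (k + 2) ?r"
    using * sh_mid_pls[OF mdl_closed[OF r]] by metis
  finally show ?thesis using * by simp
qed

text \<open>Preservation of middle parts makes s the middle part of c (pls s), and the value of c on
  the top simplex fixes the outer part. So c (pls s) is a gluing, and c s is its face along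
  \<open>mid\<close>.\<close>

lemma incl_unique:
  assumes p: "p \<in> Delta m n" and x: "x \<in> S n"
    and c: "imap (lg m (P m n p x)) (lg n x) c"
    and cp: "c m (pls m (P m n p x)) = sh m n p (pls n x)"
    and cm: "\<And>k s. s \<in> ivl (lg m (P m n p x)) k \<Longrightarrow> mdl k (c k s) = mdl k s"
    and s: "s \<in> ivl (lg m (P m n p x)) k"
  shows "c (k + 2) (pls (k + 2) s) = glue (k + 2) s (split3 m n p x)"
    and "c k s = incl m n p x k s"
proof -
  have s': "s \<in> S (k + 2)" "lg (k + 2) s = lg m (P m n p x)" using s by (simp_all add: ivl_def)
  let ?r = "c (k + 2) (pls (k + 2) s)"
  have px: "P m n p x \<in> S m" by (rule P_closed[OF p x])
  show *: "?r = glue (k + 2) s (split3 m n p x)"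
  proof (rule glue_unique)
    show "?r \<in> S (k + 2 + 2)"
      using imap_ivl[OF c pls_ivl[OF s]] by (simp add: ivl_def)
    show "mdl (k + 2) ?r = s"
      using cm[OF pls_ivl[OF s]] mdl_pls[OF s'(1)] by simp
    \<comment> \<open>The outer part of c (pls s) depends only on the long edge of s, so it can be
      computed on the top simplex over p^*x instead.\<close>
    have "sh 1 (k + 2) (long_map (k + 2)) ?r = c 1 (pls 1 (lg m (P m n p x)))"
      using imap_sh[OF c long_Delta pls_ivl[OF s]] sh_long_pls[OF s'(1)] s'(2) by simp
    also have "\<dots> = c 1 (sh 1 m (long_map m) (pls m (P m n p x)))"
      by (simp add: sh_long_pls px)
    also have "\<dots> = split3 m n p x"
      using imap_sh[OF c long_Delta pls_in_ivl[OF px]] cp sh_comp[OF long_Delta p pls_closed[OF x]]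
      by (simp add: split3_def)
    finally show "sh 1 (k + 2) (long_map (k + 2)) ?r = split3 m n p x" .
  qed
  show "c k s = incl m n p x k s"
    unfolding incl_def *[symmetric]
    using imap_sh[OF c mid_Delta pls_ivl[OF s]] sh_mid_pls[OF s'(1)] by simp
qed

definition inclr :: "nat \<Rightarrow> nat \<Rightarrow> (nat \<Rightarrow> nat) \<Rightarrow> 'x \<Rightarrow> nat \<Rightarrow> 'x \<Rightarrow> 'x" where
  "inclr m n p x = (\<lambda>k. restrict (incl m n p x k) (ivl (lg m (P m n p x)) k))"

lemma inclr_apply: "s \<in> ivl (lg m (P m n p x)) k \<Longrightarrow> inclr m n p x k s = incl m n p x k s"
  by (simp add: inclr_def)

lemma imap_inclr:
  assumes "p \<in> Delta m n" "x \<in> S n"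
  shows "imap (lg m (P m n p x)) (lg n x) (inclr m n p x)"
  using assms by (intro imapI) (auto simp: inclr_def sh_ivl incl_sh incl_ivl)

lemma incl_pls_pls:
  assumes p: "p \<in> Delta m n" and x: "x \<in> S n" and s: "s \<in> ivl (lg m (P m n p x)) k"
  shows "incl m n p x (k + 2) (pls (k + 2) s) = glue (k + 2) s (split3 m n p x)"
  using incl_unique(1)[OF p x imap_inclr[OF p x] _ _ s] p x
  by (simp add: inclr_apply incl_pls mdl_incl pls_in_ivl P_closed pls_ivl[OF s])

text \<open>An active p does not change the long edge, so both intervals are the same and the
  identity meets the conditions that determine the inclusion.\<close>

lemma incl_active:
  assumes p: "active m n p" and x: "x \<in> S n" and s: "s \<in> ivl (lg n x) k"
  shows "incl m n p x k s = s"
proof -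
  note p' = activeD(1)[OF p]
  have l: "lg m (P m n p x) = lg n x" by (rule lg_active[OF p x])
  have "iid (lg n x) k s = incl m n p x k s"
    by (rule incl_unique(2)[OF p' x])
      (use s in \<open>simp_all add: l imap_iid iid_apply pls_active[OF p x] sh_ivl[OF p' pls_in_ivl[OF x]]\<close>)
  then show ?thesis using s by (simp add: iid_apply)
qed

text \<open>The composite of the two inclusions preserves middle parts and has the right value on
  the top simplex, so uniqueness identifies it.\<close>

lemma incl_compose:
  assumes p: "p \<in> Delta l m" and q: "q \<in> Delta m n" and x: "x \<in> S n"
    and s: "s \<in> ivl (lg l (P l n (compose {..l} q p) x)) k"
  shows "incl l n (compose {..l} q p) x k s = incl m n q x k (incl l m p (P m n q x) k s)"
proof -
  note qp = Delta_compose[OF p q]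
  let ?x' = "P m n q x"
  have x': "?x' \<in> S m" by (rule P_closed[OF q x])
  have e: "P l n (compose {..l} q p) x = P l m p ?x'" by (rule P_comp[OF p q x])
  let ?x'' = "P l m p ?x'"
  have x'': "?x'' \<in> S l" by (rule P_closed[OF p x'])
  let ?c = "icomp (lg l ?x'') (inclr m n q x) (inclr l m p ?x')"
  have ca: "?c k s = incl m n q x k (incl l m p ?x' k s)" if "s \<in> ivl (lg l ?x'') k" for k s
    using that by (simp add: icomp_apply inclr_apply incl_ivl[OF p x'])
  have "?c k s = incl l n (compose {..l} q p) x k s"
  proof (rule incl_unique(2)[OF qp x, unfolded e])
    show "imap (lg l ?x'') (lg n x) ?c"
      by (rule imap_icomp[OF imap_inclr[OF p x'] imap_inclr[OF q x]])
    show "?c l (pls l ?x'') = sh l n (compose {..l} q p) (pls n x)"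
      by (simp add: ca pls_in_ivl[OF x''] incl_pls[OF p x'] incl_sh[OF q x] pls_in_ivl[OF x'] p
          incl_pls[OF q x] sh_comp[OF p q pls_closed[OF x]])
    show "mdl k (?c k s) = mdl k s" if "s \<in> ivl (lg l ?x'') k" for k s
      using that by (simp add: ca mdl_incl[OF q x] mdl_incl[OF p x'] incl_ivl[OF p x'])
  qed (use s e in simp)
  then show ?thesis using s e ca by simp
qed

text \<open>The isomorphism \<open>p\<^sup>*F\<close> is read off from \<open>F\<close> because \<open>s\<close> is the middle part of \<open>pls s\<close> and the
  inclusion of intervals, which sends \<open>pls s\<close> to the gluing below, preserves middle parts.\<close>

definition res :: "nat \<Rightarrow> nat \<Rightarrow> (nat \<Rightarrow> nat) \<Rightarrow> 'x \<Rightarrow> (nat \<Rightarrow> 'x \<Rightarrow> 'x) \<Rightarrow> nat \<Rightarrow> 'x \<Rightarrow> 'x" where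
  "res m n p x F = (\<lambda>k. restrict (\<lambda>s. mdl (k + 2) (F (k + 2) (glue (k + 2) s (split3 m n p x))))
     (ivl (lg m (P m n p x)) k))"

text \<open>The equation is evaluated at \<open>pls s\<close> rather than at s: there G can be moved
  past \<open>pls\<close>, and taking middle parts removes the inclusion on the left.\<close>

lemma res_unique:
  assumes p: "p \<in> Delta m n" and x: "x \<in> S n" and y: "y \<in> S n"
    and G: "marked m (P m n p x) (P m n p y) G"
    and eq: "\<And>k s. s \<in> ivl (lg m (P m n p x)) k \<Longrightarrow>
      incl m n p y k (G k s) = F k (incl m n p x k s)"
  shows "G = res m n p x F"
proof (intro ext)
  fix k s
  let ?x' = "P m n p x" and ?y' = "P m n p y"
  have x': "?x' \<in> S m" and y': "?y' \<in> S m" using P_closed p x y by blast+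
  show "G k s = res m n p x F k s"
  proof (cases "s \<in> ivl (lg m ?x') k")
    case True
    note s = True
    have Gs: "G k s \<in> ivl (lg m ?y') k"
      by (rule imap_ivl[OF marked_imap[OF G] s])
    have GS: "G k s \<in> S (k + 2)" using Gs by (simp add: ivl_def)
    have "G k s = mdl (k + 2) (pls (k + 2) (G k s))"
      by (simp add: mdl_pls[OF GS])
    also have "\<dots> = mdl (k + 2) (incl m n p y (k + 2) (pls (k + 2) (G k s)))"
      by (rule mdl_incl[OF p y pls_ivl[OF Gs], symmetric])
    also have "\<dots> = mdl (k + 2) (F (k + 2) (incl m n p x (k + 2) (pls (k + 2) s)))"
      unfolding marked_commutes_pls[OF G x' y' s, symmetric] eq[OF pls_ivl[OF s]] ..
    also have "\<dots> = res m n p x F k s"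
      using s by (simp add: res_def incl_pls_pls[OF p x s])
    finally show ?thesis .
  next
    case False
    then show ?thesis
      using imap_ext[OF marked_imap[OF G], of k] by (simp add: res_def extensional_def)
  qed
qed

context
  fixes m n p x y F
  assumes p: "p \<in> Delta m n" and x: "x \<in> S n" and y: "y \<in> S n" and F: "marked n x y F"
begin

lemma marked_split3: "F 1 (split3 m n p x) = split3 m n p y"
  unfolding split3_def by (rule marked_sh_pls[OF F x Delta_compose[OF long_Delta p]])

lemma res_aux:
  assumes s: "s \<in> ivl (lg m (P m n p x)) k"
  defines "r \<equiv> F (k + 2) (glue (k + 2) s (split3 m n p x))"
  shows res_apply: "res m n p x F k s = mdl (k + 2) r"
    and res_r: "r \<in> ivl (lg n y) (k + 2)"
    and "sh 1 (k + 2) (long_map (k + 2)) r = split3 m n p y"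
    and res_ivl: "res m n p x F k s \<in> ivl (lg m (P m n p y)) k"
proof -
  note F' = marked_imap[OF F]
  show *: "res m n p x F k s = mdl (k + 2) r"
    using s by (simp add: res_def r_def)
  note g = glue_split3_ivl[OF p x s]
  show r: "r \<in> ivl (lg n y) (k + 2)"
    unfolding r_def by (rule imap_ivl[OF F' g])
  then have rS: "r \<in> S (k + 2 + 2)" by (simp add: ivl_def)
  show l: "sh 1 (k + 2) (long_map (k + 2)) r = split3 m n p y"
    unfolding r_def imap_sh[OF F' long_Delta g, symmetric] glue_split3(3)[OF p x s]
    by (rule marked_split3)
  show "res m n p x F k s \<in> ivl (lg m (P m n p y)) k"
    unfolding * ivl_def using mdl_closed[OF rS] lg_mdl[OF rS] l mdl_split3[OF p y] by simp
qed

text \<open>F carries \<open>split3\<close> of x to \<open>split3\<close> of y. Hence F applied to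
  the gluing over x is the gluing over y of its own middle part, which is the value of
  \<open>res\<close>.\<close>

lemma incl_res:
  assumes s: "s \<in> ivl (lg m (P m n p x)) k"
  shows "incl m n p y k (res m n p x F k s) = F k (incl m n p x k s)"
proof -
  let ?r = "F (k + 2) (glue (k + 2) s (split3 m n p x))"
  have "?r = glue (k + 2) (res m n p x F k s) (split3 m n p y)"
    by (rule glue_unique) (use res_aux[OF s] in \<open>simp_all add: ivl_def\<close>)
  then have "incl m n p y k (res m n p x F k s) = sh k (k + 2) (mid k) ?r"
    by (simp add: incl_def)
  also have "\<dots> = F k (incl m n p x k s)"
    unfolding incl_def imap_sh[OF marked_imap[OF F] mid_Delta glue_split3_ivl[OF p x s]] ..
  finally show ?thesis .
qed

lemma marked_res: "marked m (P m n p x) (P m n p y) (res m n p x F)"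
  unfolding marked_def
proof
  note F' = marked_imap[OF F]
  let ?x' = "P m n p x" and ?y' = "P m n p y"
  have x': "?x' \<in> S m" and y': "?y' \<in> S m" using P_closed p x y by blast+
  show "imap (lg m ?x') (lg m ?y') (res m n p x F)"
  proof (rule imapI)
    fix k show "res m n p x F k \<in> extensional (ivl (lg m ?x') k)" by (simp add: res_def)
  next
    fix k s assume "s \<in> ivl (lg m ?x') k"
    then show "res m n p x F k s \<in> ivl (lg m ?y') k" by (rule res_ivl)
  next
    fix j k q s assume q: "q \<in> Delta j k" and s: "s \<in> ivl (lg m ?x') k"
    let ?g = "glue (k + 2) s (split3 m n p x)"
    have rS: "F (k + 2) ?g \<in> S (k + 2 + 2)" using res_r[OF s] by (simp add: ivl_def)
    have "res m n p x F j (sh j k q s) =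
        mdl (j + 2) (F (j + 2) (sh (j + 2) (k + 2) (shift j k q) ?g))"
      by (simp only: res_apply[OF sh_ivl[OF q s]] glue_sh[OF p x s q])
    also have "\<dots> = mdl (j + 2) (sh (j + 2) (k + 2) (shift j k q) (F (k + 2) ?g))"
      by (simp only: imap_sh[OF F' shift_Delta[OF q] glue_split3_ivl[OF p x s]])
    also have "\<dots> = P (j + 2) (k + 2) (shift j k q) (mdl (k + 2) (F (k + 2) ?g))"
      by (rule mdl_sh[OF shift_Delta[OF q] rS])
    also have "\<dots> = sh j k q (res m n p x F k s)"
      by (simp only: sh_def res_apply[OF s])
    finally show "res m n p x F j (sh j k q s) = sh j k q (res m n p x F k s)" .
  qed
  have "res m n p x F m (pls m ?x') = mdl (m + 2) (F (m + 2) (glue (m + 2) (pls m ?x') (split3 m n p x)))"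
    by (rule res_apply[OF pls_in_ivl[OF x']])
  \<comment> \<open>Here the glued simplex is a value of phi_x, so F takes it to the corresponding
    value of phi_y, which is again a gluing.\<close>
  also have "\<dots> = mdl (m + 2) (sh (m + 2) n (compose {..m + 2} p (clamp m)) (pls n y))"
    unfolding glue_pls[OF p x] marked_sh_pls[OF F x Delta_compose[OF clamp_Delta p]] ..
  also have "\<dots> = pls m ?y'"
    unfolding glue_pls[OF p y, symmetric]
    by (rule glue_split3(2)[OF p y pls_in_ivl[OF y']])
  finally show "res m n p x F m (pls m ?x') = pls m ?y'" .
qed

end

lemma res_iid:
  assumes p: "p \<in> Delta m n" and x: "x \<in> S n"
  shows "res m n p x (iid (lg n x)) = iid (lg m (P m n p x))"
  by (rule res_unique[OF p x x marked_iid[OF P_closed[OF p x]], symmetric])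
    (simp add: iid_apply incl_ivl[OF p x])

lemma res_icomp:
  assumes p: "p \<in> Delta m n" and xyz: "x \<in> S n" "y \<in> S n" "z \<in> S n"
    and F: "marked n x y F" and G: "marked n y z G"
  shows "res m n p x (icomp (lg n x) G F) =
    icomp (lg m (P m n p x)) (res m n p y G) (res m n p x F)"
proof (rule res_unique[OF p xyz(1,3), symmetric])
  note rF = marked_res[OF p xyz(1,2) F] and rG = marked_res[OF p xyz(2,3) G]
  show "marked m (P m n p x) (P m n p z)
      (icomp (lg m (P m n p x)) (res m n p y G) (res m n p x F))"
    by (rule marked_icomp[OF rF rG P_closed[OF p xyz(1)]])
  show "incl m n p z k (icomp (lg m (P m n p x)) (res m n p y G) (res m n p x F) k s) =
      icomp (lg n x) G F k (incl m n p x k s)" if s: "s \<in> ivl (lg m (P m n p x)) k" for k s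
    by (simp add: icomp_apply s incl_ivl[OF p xyz(1)] incl_res[OF p xyz(2,3) G]
        incl_res[OF p xyz(1,2) F] imap_ivl[OF marked_imap[OF rF]])
qed

text \<open>Over an active map both inclusions of intervals are identities, so F itself solves the
  equation that characterizes its restriction.\<close>

lemma res_active:
  assumes p: "active m n p" and x: "x \<in> S n" and y: "y \<in> S n" and F: "marked n x y F"
  shows "res m n p x F = F"
proof (rule res_unique[OF activeD(1)[OF p] x y, symmetric])
  note l = lg_active[OF p x] lg_active[OF p y]
  show "marked m (P m n p x) (P m n p y) F"
    using marked_imap[OF F] marked_sh_pls[OF F x activeD(1)[OF p]]
    by (simp add: marked_def l pls_active[OF p] x y)
  show "incl m n p y k (F k s) = F k (incl m n p x k s)" if "s \<in> ivl (lg m (P m n p x)) k" for k s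
    using that imap_ivl[OF marked_imap[OF F]] by (simp add: l incl_active[OF p] x y)
qed

lemma res_compose:
  assumes p: "p \<in> Delta l m" and q: "q \<in> Delta m n" and x: "x \<in> S n" and y: "y \<in> S n"
    and F: "marked n x y F"
  shows "res l n (compose {..l} q p) x F = res l m p (P m n q x) (res m n q x F)"
proof (rule res_unique[OF Delta_compose[OF p q] x y, symmetric])
  have x': "P m n q x \<in> S m" and y': "P m n q y \<in> S m" using P_closed q x y by blast+
  note rF = marked_res[OF q x y F]
  note rrF = marked_res[OF p x' y' rF]
  note e = P_comp[OF p q x] P_comp[OF p q y]
  show "marked l (P l n (compose {..l} q p) x) (P l n (compose {..l} q p) y)
      (res l m p (P m n q x) (res m n q x F))"
    unfolding e by (rule rrF)
  fix k s assume "s \<in> ivl (lg l (P l n (compose {..l} q p) x)) k"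
  then have s: "s \<in> ivl (lg l (P l m p (P m n q x))) k" by (simp only: e)
  have rs: "res l m p (P m n q x) (res m n q x F) k s \<in> ivl (lg l (P l m p (P m n q y))) k"
    by (rule imap_ivl[OF marked_imap[OF rrF] s])
  show "incl l n (compose {..l} q p) y k (res l m p (P m n q x) (res m n q x F) k s) =
      F k (incl l n (compose {..l} q p) x k s)"
    using s rs by (simp add: incl_compose[OF p q] x y e incl_res[OF p x' y' rF]
        incl_res[OF q x y F] incl_ivl[OF p x'])
qed

text \<open>Restriction respects identities and composites, so the restriction of an inverse is
  inverse to the restriction.\<close>

lemma arr_res:
  assumes p: "p \<in> Delta m n" and x: "x \<in> S n" and y: "y \<in> S n" and F: "arr n x y F"
  shows "arr m (P m n p x) (P m n p y) (res m n p x F)"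
proof -
  from F x obtain G where G: "marked n x y F" "marked n y x G" "arr n y x G"
    "\<And>k s. s \<in> ivl (lg n x) k \<Longrightarrow> G k (F k s) = s"
    "\<And>k s. s \<in> ivl (lg n y) k \<Longrightarrow> F k (G k s) = s"
    using arrE[OF F x] by metis
  have "icomp (lg n x) G F = iid (lg n x)" "icomp (lg n y) F G = iid (lg n y)"
    using G(4,5) by (auto intro!: icomp_eq_iid)
  then have *: "icomp (lg m (P m n p x)) (res m n p y G) (res m n p x F) = iid (lg m (P m n p x))"
    "icomp (lg m (P m n p y)) (res m n p x F) (res m n p y G) = iid (lg m (P m n p y))"
    using res_icomp[OF p x y x G(1,2)] res_icomp[OF p y x y G(2,1)] res_iid[OF p x] res_iid[OF p y]
    by simp_all
  show ?thesis
  proof (rule arrI[OF marked_res[OF p x y G(1)] marked_res[OF p y x G(2)]])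
    show "res m n p y G k (res m n p x F k s) = s" if "s \<in> ivl (lg m (P m n p x)) k" for k s
      using that fun_cong[OF fun_cong[OF *(1), of k], of s] by (simp add: icomp_apply iid_apply)
    show "res m n p x F k (res m n p y G k s) = s" if "s \<in> ivl (lg m (P m n p y)) k" for k s
      using that fun_cong[OF fun_cong[OF *(2), of k], of s] by (simp add: icomp_apply iid_apply)
  qed
qed

end

text \<open>Three maps are treated this way: \<open>Dom\<close> and \<open>Cod\<close> from arrows
  to objects of X, and the map on simplices induced by a culf map to U_X.\<close>

locale decomposition_map = S: decomposition_set S P + T: decomposition_set T Q
  for S :: "nat \<Rightarrow> 'x set" and P and T :: "nat \<Rightarrow> 'y set" and Q +
  fixes h :: "nat \<Rightarrow> 'x \<Rightarrow> 'y"
  assumes h_closed: "x \<in> S n \<Longrightarrow> h n x \<in> T n"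
    and h_P: "p \<in> Delta m n \<Longrightarrow> x \<in> S n \<Longrightarrow> h m (P m n p x) = Q m n p (h n x)"
begin

lemma h_lg: "x \<in> S n \<Longrightarrow> h 1 (S.lg n x) = T.lg n (h n x)"
  by (simp add: S.lg_def T.lg_def h_P long_Delta)

lemma h_mdl: "x \<in> S (n + 2) \<Longrightarrow> h n (S.mdl n x) = T.mdl n (h (n + 2) x)"
  by (simp add: S.mdl_def T.mdl_def h_P mid_Delta)

lemma h_pls: "x \<in> S n \<Longrightarrow> h (n + 2) (S.pls n x) = T.pls n (h n x)"
  by (simp add: S.pls_def T.pls_def h_P clamp_Delta)

lemma h_sh: "p \<in> Delta m n \<Longrightarrow> x \<in> S (n + 2) \<Longrightarrow> h (m + 2) (S.sh m n p x) = T.sh m n p (h (n + 2) x)"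
  by (simp add: S.sh_def T.sh_def h_P shift_Delta)

lemma h_ivl: "s \<in> S.ivl f k \<Longrightarrow> h (k + 2) s \<in> T.ivl (h 1 f) k"
  by (auto simp: S.ivl_def T.ivl_def h_closed h_lg)

text \<open>A simplicial map sends gluings to gluings by uniqueness, so it commutes with everything
  built from them.\<close>

lemma h_incl:
  assumes p: "p \<in> Delta m n" and x: "x \<in> S n" and s: "s \<in> S.ivl (S.lg m (P m n p x)) k"
  shows "h (k + 2) (S.incl m n p x k s) = T.incl m n p (h n x) k (h (k + 2) s)"
proof -
  let ?t = "S.split3 m n p x" let ?g = "S.glue (k + 2) s ?t"
  note g = S.glue_split3[OF p x s]
  have t: "h (1 + 2) ?t = T.split3 m n p (h n x)"
    unfolding S.split3_def T.split3_def
    by (simp only: h_sh[OF Delta_compose[OF long_Delta p] S.pls_closed[OF x]] h_pls[OF x])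
  have "h (k + 2 + 2) ?g = T.glue (k + 2) (h (k + 2) s) (T.split3 m n p (h n x))"
    by (rule T.glue_unique)
      (simp_all only: h_closed[OF g(1)] h_mdl[OF g(1), symmetric] g(2,3)
        h_sh[OF long_Delta g(1), symmetric] t)
  then show ?thesis
    unfolding S.incl_def T.incl_def by (simp only: h_sh[OF mid_Delta g(1)])
qed

end


section \<open>The simplicial groupoid of subdivided intervals\<close>

lemma strict_pullback_ex1:
  assumes "strict_pullback P A B a b u v"
  shows "y \<in> Ob A \<Longrightarrow> z \<in> Ob B \<Longrightarrow> onOb u y = onOb v z \<Longrightarrow>
      \<exists>!x. x \<in> Ob P \<and> onOb a x = y \<and> onOb b x = z"
    and "g \<in> Ar A \<Longrightarrow> h \<in> Ar B \<Longrightarrow> onAr u g = onAr v h \<Longrightarrow>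
      \<exists>!f. f \<in> Ar P \<and> onAr a f = g \<and> onAr b f = h"
proof -
  have *: "\<exists>!x. x \<in> A \<and> k x = y" if "bij_betw k A B" "y \<in> B" for k :: "'x \<Rightarrow> 'y" and A B y
    using that unfolding bij_betw_def inj_on_def by blast
  note p = assms[unfolded strict_pullback_def]
  show "\<exists>!x. x \<in> Ob P \<and> onOb a x = y \<and> onOb b x = z"
    if "y \<in> Ob A" "z \<in> Ob B" "onOb u y = onOb v z"
    using *[OF conjunct1[OF p], of "(y, z)"] that by simp
  show "\<exists>!f. f \<in> Ar P \<and> onAr a f = g \<and> onAr b f = h"
    if "g \<in> Ar A" "h \<in> Ar B" "onAr u g = onAr v h"
    using *[OF conjunct2[OF p], of "(g, h)"] that by simp
qed

context rigid_decomposition_groupoid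
begin

section \<open>Objects and arrows of X as decomposition sets\<close>

lemma
  assumes "p \<in> Delta m n"
  shows act_Ob: "x \<in> Ob (level X n) \<Longrightarrow> onOb (act X m n p) x \<in> Ob (level X m)"
    and act_Ar: "a \<in> Ar (level X n) \<Longrightarrow> onAr (act X m n p) a \<in> Ar (level X m)"
    and act_Dom: "a \<in> Ar (level X n) \<Longrightarrow>
      Dom (level X m) (onAr (act X m n p) a) = onOb (act X m n p) (Dom (level X n) a)"
    and act_Cod: "a \<in> Ar (level X n) \<Longrightarrow>
      Cod (level X m) (onAr (act X m n p) a) = onOb (act X m n p) (Cod (level X n) a)"
    and act_Ident: "x \<in> Ob (level X n) \<Longrightarrow>
      onAr (act X m n p) (Ident (level X n) x) = Ident (level X m) (onOb (act X m n p) x)"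
    and act_Comp: "a \<in> Ar (level X n) \<Longrightarrow> b \<in> Ar (level X n) \<Longrightarrow>
      Cod (level X n) a = Dom (level X n) b \<Longrightarrow>
      onAr (act X m n p) (Comp (level X n) b a) =
      Comp (level X m) (onAr (act X m n p) b) (onAr (act X m n p) a)"
  using groupoid_functor.onOb_closed[OF functor_act[OF assms]]
    groupoid_functor.onAr_closed[OF functor_act[OF assms]]
    groupoid_functor.onAr_Dom[OF functor_act[OF assms]]
    groupoid_functor.onAr_Cod[OF functor_act[OF assms]]
    groupoid_functor.onAr_Ident[OF functor_act[OF assms]]
    groupoid_functor.onAr_Comp[OF functor_act[OF assms]] by auto

sublocale ob: decomposition_set "\<lambda>n. Ob (level X n)" "\<lambda>m n p. onOb (act X m n p)"
proof (unfold_locales, goal_cases)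
  case (4 m n g k h l g' h' y z)
  then show ?case by (rule strict_pullback_ex1(1)[OF pushout_to_pullback])
qed (simp_all add: act_Ob act_id_Ob act_comp_Ob del: restrict_apply)

sublocale ar: decomposition_set "\<lambda>n. Ar (level X n)" "\<lambda>m n p. onAr (act X m n p)"
proof (unfold_locales, goal_cases)
  case (4 m n g k h l g' h' y z)
  then show ?case by (rule strict_pullback_ex1(2)[OF pushout_to_pullback])
qed (simp_all add: act_Ar act_id_Ar act_comp_Ar del: restrict_apply)

sublocale dom: decomposition_map "\<lambda>n. Ar (level X n)" "\<lambda>m n p. onAr (act X m n p)"
  "\<lambda>n. Ob (level X n)" "\<lambda>m n p. onOb (act X m n p)" "\<lambda>n. Dom (level X n)"
  by unfold_locales (auto simp: act_Dom groupoid.Dom_closed[OF groupoid_level])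

sublocale cod: decomposition_map "\<lambda>n. Ar (level X n)" "\<lambda>m n p. onAr (act X m n p)"
  "\<lambda>n. Ob (level X n)" "\<lambda>m n p. onOb (act X m n p)" "\<lambda>n. Cod (level X n)"
  by unfold_locales (auto simp: act_Cod groupoid.Cod_closed[OF groupoid_level])

lemma long_eq: "long X n x = ob.lg n x"
  by (simp add: long_def ob.lg_def)

lemma middle_eq: "x \<in> Ob (level X (n + 2)) \<Longrightarrow> middle X n x = ob.mdl n x"
proof -
  assume x: "x \<in> Ob (level X (n + 2))"
  \<comment> \<open>Dropping the bottom and top vertices is restriction along
    \<open>mid\<close>.\<close>
  have "compose {..n} (coface (Suc n) 0) (coface n (Suc n)) = mid n"
    by (rule ext) (auto simp: compose_def coface_def mid_def)
  moreover have "coface (Suc n) 0 \<in> Delta (Suc n) (n + 2)" "coface n (Suc n) \<in> Delta n (Suc n)"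
    by (auto simp: Delta_iff coface_def)
  moreover have e: "Suc (Suc n) = n + 2" by simp
  ultimately show ?thesis
    using act_comp_Ob[of "coface n (Suc n)" n "Suc n" "coface (Suc n) 0" "n + 2" x] x
    by (simp add: middle_def face_def ob.mdl_def e)
qed

lemma interval_simps [simp]:
  "simplices (interval X f) k = ob.ivl f k"
  "pull (interval X f) j k q = ob.sh j k q"
  "initial (interval X f) = onOb (act X 2 1 (codegeneracy 1 0)) f"
  "terminal (interval X f) = onOb (act X 2 1 (codegeneracy 1 1)) f"
  by (simp_all add: interval_def ob.ivl_def long_eq ob.sh_def degeneracy_def numeral_2_eq_2 One_nat_def)

lemma sset_map_interval: "sset_map (interval X f) (interval X g) F \<longleftrightarrow> ob.imap f g F"
  by (simp add: sset_map_def ob.imap_def)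

lemma sset_iso_interval: "sset_iso (interval X f) (interval X g) F \<longleftrightarrow> ob.iiso f g F"
  by (simp add: sset_iso_def ob.iiso_def sset_map_interval)

lemma std_simplex_simps [simp]:
  "simplices (std_simplex n) k = Delta k n"
  "pull (std_simplex n) j k p q = compose {..j} q p"
  "initial (std_simplex n) = restrict (\<lambda>_. 0) {..0}"
  "terminal (std_simplex n) = restrict (\<lambda>_. n) {..0}"
  by (simp_all add: std_simplex_def)

section \<open>Subdivisions of intervals\<close>

lemma const_Delta: "i \<le> n \<Longrightarrow> restrict (\<lambda>_. i) {..0} \<in> Delta 0 n"
  by (auto simp: Delta_iff)

lemma codegeneracy_Delta: "i \<le> 1 \<Longrightarrow> codegeneracy 1 i \<in> Delta 2 1"
  by (auto simp: Delta_iff codegeneracy_def numeral_2_eq_2 One_nat_def)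

lemma ivl_Ob: "s \<in> ob.ivl f k \<Longrightarrow> s \<in> Ob (level X (k + 2))"
  by (simp add: ob.ivl_def)

text \<open>A map out of the standard simplex is determined by its top simplex r. Stretchedness
  forces r into the image of \<open>pls\<close>, and the condition on middle parts then leaves only
  \<open>pls n x\<close>.\<close>

lemma subdivision_eq:
  assumes x: "x \<in> Ob (level X n)"
  shows "subdivision X n x = (\<lambda>k. restrict (\<lambda>q. ob.sh k n q (ob.pls n x)) (Delta k n))"
    (is "_ = ?\<phi>")
  unfolding subdivision_def
proof (rule the_equality)
  note plx = ob.pls_in_ivl[OF x]
  \<comment> \<open>The vertices 0 and n of the subdivision are the chosen endpoints of the
    interval; b is an end of the long edge that maps to i.\<close>
  have ends: "ob.sh 0 n (restrict (\<lambda>_. i) {..0}) (ob.pls n x) = onOb (act X 2 1 (codegeneracy 1 b)) (ob.lg n x)"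
    if i: "i \<le> n" and b: "b \<le> 1" "i = long_map n b" for i b
  proof -
    have s: "shift 0 n (restrict (\<lambda>_. i) {..0}) \<in> Delta 2 (n + 2)"
      using shift_Delta[OF const_Delta[OF i]] by simp
    have "compose {..2} (clamp n) (shift 0 n (restrict (\<lambda>_. i) {..0})) =
      compose {..2} (long_map n) (codegeneracy 1 b)"
    proof
      fix j :: nat
      consider "b = 0" | "b = 1" using b by linarith
      then show "compose {..2} (clamp n) (shift 0 n (restrict (\<lambda>_. i) {..0})) j =
        compose {..2} (long_map n) (codegeneracy 1 b) j"
        using i b by cases (auto simp: compose_def clamp_def shift_def long_map_def codegeneracy_def)
    qed
    then show ?thesis
      using ob.P_comp[OF s clamp_Delta x] ob.P_comp[OF codegeneracy_Delta[OF b(1)] long_Delta x]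
      by (simp add: ob.sh_def ob.pls_def ob.lg_def)
  qed
  show "stretched (std_simplex n) (interval X (long X n x)) ?\<phi> \<and>
     (\<forall>k. \<forall>q \<in> Delta k n. middle X k (?\<phi> k q) = onOb (act X k n q) x)"
    unfolding stretched_def sset_map_def
  proof (intro conjI allI ballI)
    fix k show "?\<phi> k \<in> simplices (std_simplex n) k \<rightarrow>\<^sub>E simplices (interval X (long X n x)) k"
      using plx by (auto simp: long_eq ob.sh_ivl)
  next
    fix j k p q assume "p \<in> Delta j k" "q \<in> simplices (std_simplex n) k"
    then show "?\<phi> j (pull (std_simplex n) j k p q) = pull (interval X (long X n x)) j k p (?\<phi> k q)"
      using x by (simp add: Delta_compose ob.sh_comp)
  next
    show "?\<phi> 0 (initial (std_simplex n)) = initial (interval X (long X n x))"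
      using ends[of 0 0] const_Delta[of 0 n] by (simp add: long_eq long_map_def)
    show "?\<phi> 0 (terminal (std_simplex n)) = terminal (interval X (long X n x))"
      using ends[of n 1] const_Delta[of n n] by (simp add: long_eq long_map_def)
  next
    fix k q assume "q \<in> Delta k n"
    then show "middle X k (?\<phi> k q) = onOb (act X k n q) x"
      using x by (simp add: middle_eq ob.mdl_sh ob.mdl_pls)
  qed
next
  fix \<phi> assume "stretched (std_simplex n) (interval X (long X n x)) \<phi> \<and>
     (\<forall>k. \<forall>q \<in> Delta k n. middle X k (\<phi> k q) = onOb (act X k n q) x)"
  then have map: "\<phi> k \<in> Delta k n \<rightarrow>\<^sub>E ob.ivl (ob.lg n x) k"
      and sh: "p \<in> Delta j k \<Longrightarrow> q \<in> Delta k n \<Longrightarrow> \<phi> j (compose {..j} q p) = ob.sh j k p (\<phi> k q)"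
      and i: "\<phi> 0 (restrict (\<lambda>_. 0) {..0}) = onOb (act X 2 1 (codegeneracy 1 0)) (ob.lg n x)"
      and t: "\<phi> 0 (restrict (\<lambda>_. n) {..0}) = onOb (act X 2 1 (codegeneracy 1 1)) (ob.lg n x)"
      and mdl: "q \<in> Delta k n \<Longrightarrow> middle X k (\<phi> k q) = onOb (act X k n q) x" for j k p q
    unfolding stretched_def sset_map_def long_eq by auto
  define r where "r = \<phi> n (restrict id {..n})"
  have r: "r \<in> Ob (level X (n + 2))" "ob.lg (n + 2) r = ob.lg n x"
    using PiE_mem[OF map Delta_id] by (simp_all add: r_def ob.ivl_def)
  have \<phi>: "\<phi> k q = ob.sh k n q r" if "q \<in> Delta k n" for k q
    using sh[OF that Delta_id] compose_id_Delta(2)[OF that] by (simp add: r_def)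
  have "r = ob.pls n (ob.mdl n r)"
    by (rule ob.eq_pls_endpoints[OF r(1)])
      (use i t \<phi> const_Delta[of 0 n] const_Delta[of n n] r(2) in simp_all)
  also have "ob.mdl n r = x"
    using mdl[OF Delta_id, folded r_def] x r by (simp add: middle_eq act_id_Ob)
  finally have rx: "r = ob.pls n x" .
  show "\<phi> = ?\<phi>"
  proof (intro ext)
    fix k q show "\<phi> k q = ?\<phi> k q"
      using \<phi>[of q k] PiE_arb[OF map, of q k] rx by (cases "q \<in> Delta k n") simp_all
  qed
qed

lemma subdivision_apply:
  "x \<in> Ob (level X n) \<Longrightarrow> q \<in> Delta k n \<Longrightarrow> subdivision X n x k q = ob.sh k n q (ob.pls n x)"
  by (simp add: subdivision_eq)

lemma subdivision_id:
  "x \<in> Ob (level X n) \<Longrightarrow> subdivision X n x n (restrict id {..n}) = ob.pls n x"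
  by (simp add: subdivision_apply Delta_id ob.sh_id del: restrict_apply)

lemma inj_subint: "inj_on (subint X n) (Ob (level X n))"
  by (rule inj_onI) (metis subint_def snd_conv subdivision_id ob.mdl_pls)

lemma subint_simplex_subint: "x \<in> Ob (level X n) \<Longrightarrow> subint_simplex X n (subint X n x) = x"
  by (simp add: subint_simplex_def inv_into_f_f[OF inj_subint])

lemma subint_act_Ob_subint:
  "x \<in> Ob (level X n) \<Longrightarrow> subint_act_Ob X m n p (subint X n x) = subint X m (onOb (act X m n p) x)"
  by (simp add: subint_act_Ob_def subint_simplex_subint)

lemma preserves_subdivision:
  assumes x: "x \<in> Ob (level X n)" and y: "y \<in> Ob (level X n)"
    and F: "ob.imap (ob.lg n x) (ob.lg n y) F"
  shows "(\<forall>k. \<forall>q \<in> Delta k n. F k (subdivision X n x k q) = subdivision X n y k q) \<longleftrightarrow>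
    F n (ob.pls n x) = ob.pls n y"
proof
  assume "\<forall>k. \<forall>q \<in> Delta k n. F k (subdivision X n x k q) = subdivision X n y k q"
  then show "F n (ob.pls n x) = ob.pls n y"
    using Delta_id subdivision_id x y by metis
next
  assume "F n (ob.pls n x) = ob.pls n y"
  then show "\<forall>k. \<forall>q \<in> Delta k n. F k (subdivision X n x k q) = subdivision X n y k q"
    using x y ob.marked_sh_pls[of n x y F] F by (simp add: subdivision_apply ob.marked_def)
qed

lemma arr_iff:
  assumes "x \<in> Ob (level X n)" "y \<in> Ob (level X n)"
  shows "sset_iso (interval X (long X n x)) (interval X (long X n y)) F \<and>
    (\<forall>k. \<forall>q \<in> Delta k n. F k (subdivision X n x k q) = subdivision X n y k q) \<longleftrightarrow> ob.arr n x y F"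
  unfolding ob.arr_def sset_iso_interval long_eq
  using preserves_subdivision[OF assms] ob.iiso_imap by blast

section \<open>The groupoid of subdivided intervals in one degree\<close>

lemma Ar_subint_groupoid:
  "Ar (subint_groupoid X n) = {(subint X n x, F, subint X n y) |x y F.
     x \<in> Ob (level X n) \<and> y \<in> Ob (level X n) \<and> ob.arr n x y F}"
proof (intro equalityI subsetI)
  fix a assume "a \<in> Ar (subint_groupoid X n)"
  then obtain x y F where "a = (subint X n x, F, subint X n y)" "x \<in> Ob (level X n)" "y \<in> Ob (level X n)"
    "sset_iso (interval X (long X n x)) (interval X (long X n y)) F \<and>
    (\<forall>k. \<forall>q \<in> Delta k n. F k (subdivision X n x k q) = subdivision X n y k q)"
    unfolding subint_groupoid_def subint_def by auto
  then show "a \<in> {(subint X n x, F, subint X n y) |x y F.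
     x \<in> Ob (level X n) \<and> y \<in> Ob (level X n) \<and> ob.arr n x y F}"
    using arr_iff by blast
next
  fix a assume "a \<in> {(subint X n x, F, subint X n y) |x y F.
     x \<in> Ob (level X n) \<and> y \<in> Ob (level X n) \<and> ob.arr n x y F}"
  then obtain x y F where "a = (subint X n x, F, subint X n y)" "x \<in> Ob (level X n)" "y \<in> Ob (level X n)"
    "sset_iso (interval X (long X n x)) (interval X (long X n y)) F \<and>
    (\<forall>k. \<forall>q \<in> Delta k n. F k (subdivision X n x k q) = subdivision X n y k q)"
    using arr_iff by blast
  then show "a \<in> Ar (subint_groupoid X n)"
    unfolding subint_groupoid_def by (auto simp: subint_def)
qed

lemma subint_arrowE:
  assumes "a \<in> Ar (subint_groupoid X n)"
  obtains x y F where "a = (subint X n x, F, subint X n y)"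
    "x \<in> Ob (level X n)" "y \<in> Ob (level X n)" "ob.arr n x y F"
  using assms unfolding Ar_subint_groupoid by blast

lemma subint_arrowI:
  "x \<in> Ob (level X n) \<Longrightarrow> y \<in> Ob (level X n) \<Longrightarrow> ob.arr n x y F \<Longrightarrow>
   (subint X n x, F, subint X n y) \<in> Ar (subint_groupoid X n)"
  unfolding Ar_subint_groupoid by blast

lemma subint_groupoid_simps [simp]:
  "Ob (subint_groupoid X n) = subint X n ` Ob (level X n)"
  "Dom (subint_groupoid X n) (A, F, B) = A"
  "Cod (subint_groupoid X n) (A, F, B) = B"
  "Ident (subint_groupoid X n) (subint X n x) = (subint X n x, ob.iid (ob.lg n x), subint X n x)"
  "Comp (subint_groupoid X n) (B', G, C) (subint X n x, F, B) = (subint X n x, ob.icomp (ob.lg n x) G F, C)"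
  by (simp_all add: subint_groupoid_def subint_def ob.iid_def ob.icomp_def long_eq)

lemma subint_eq_iff:
  "x \<in> Ob (level X n) \<Longrightarrow> y \<in> Ob (level X n) \<Longrightarrow> subint X n x = subint X n y \<longleftrightarrow> x = y"
  using inj_subint by (auto simp: inj_on_def)

lemma groupoid_subint: "groupoid (subint_groupoid X n)"
proof
  fix f assume f: "f \<in> Ar (subint_groupoid X n)"
  then obtain x y F where F: "f = (subint X n x, F, subint X n y)"
    "x \<in> Ob (level X n)" "y \<in> Ob (level X n)" "ob.arr n x y F"
    by (rule subint_arrowE)
  note Fi = ob.marked_imap[OF ob.arr_marked[OF F(4)]]
  show "Dom (subint_groupoid X n) f \<in> Ob (subint_groupoid X n)" "Cod (subint_groupoid X n) f \<in> Ob (subint_groupoid X n)"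
    using F by simp_all
  show "Comp (subint_groupoid X n) f (Ident (subint_groupoid X n) (Dom (subint_groupoid X n) f)) = f"
    "Comp (subint_groupoid X n) (Ident (subint_groupoid X n) (Cod (subint_groupoid X n) f)) f = f"
    using F by (auto intro!: ob.imap_eqI[OF ob.imap_icomp[OF ob.imap_iid Fi] Fi]
        ob.imap_eqI[OF ob.imap_icomp[OF Fi ob.imap_iid] Fi]
        simp: ob.icomp_apply ob.iid_apply ob.imap_ivl[OF Fi])
  obtain G where G: "ob.marked n x y F" "ob.marked n y x G" "ob.arr n y x G"
    "\<And>k s. s \<in> ob.ivl (ob.lg n x) k \<Longrightarrow> G k (F k s) = s"
    "\<And>k s. s \<in> ob.ivl (ob.lg n y) k \<Longrightarrow> F k (G k s) = s"
    using ob.arrE[OF F(4,2)] by metis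
  note Gi = ob.marked_imap[OF G(2)]
  have "ob.icomp (ob.lg n x) G F = ob.iid (ob.lg n x)"
    by (rule ob.icomp_eq_iid) (rule G(4))
  moreover have "ob.icomp (ob.lg n y) F G = ob.iid (ob.lg n y)"
    by (rule ob.icomp_eq_iid) (rule G(5))
  ultimately show "\<exists>g\<in>Ar (subint_groupoid X n). Dom (subint_groupoid X n) g = Cod (subint_groupoid X n) f \<and>
      Cod (subint_groupoid X n) g = Dom (subint_groupoid X n) f \<and>
      Comp (subint_groupoid X n) g f = Ident (subint_groupoid X n) (Dom (subint_groupoid X n) f) \<and>
      Comp (subint_groupoid X n) f g = Ident (subint_groupoid X n) (Cod (subint_groupoid X n) f)"
    using F by (intro bexI[of _ "(subint X n y, G, subint X n x)"]) (simp_all add: subint_arrowI G)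
  fix g assume "g \<in> Ar (subint_groupoid X n)" and fg: "Cod (subint_groupoid X n) f = Dom (subint_groupoid X n) g"
  then obtain z G where G: "g = (subint X n y, G, subint X n z)"
    "z \<in> Ob (level X n)" "ob.arr n y z G"
    using F by (auto elim!: subint_arrowE simp: subint_eq_iff)
  show "Comp (subint_groupoid X n) g f \<in> Ar (subint_groupoid X n)"
    "Dom (subint_groupoid X n) (Comp (subint_groupoid X n) g f) = Dom (subint_groupoid X n) f"
    "Cod (subint_groupoid X n) (Comp (subint_groupoid X n) g f) = Cod (subint_groupoid X n) g"
    using F G by (auto intro!: subint_arrowI ob.arr_icomp)
  fix h assume "h \<in> Ar (subint_groupoid X n)" and gh: "Cod (subint_groupoid X n) g = Dom (subint_groupoid X n) h"
  then obtain w H where H: "h = (subint X n z, H, subint X n w)"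
    "w \<in> Ob (level X n)" "ob.arr n z w H"
    using G by (auto elim!: subint_arrowE simp: subint_eq_iff)
  note Gi = ob.marked_imap[OF ob.arr_marked[OF G(3)]]
  note Hi = ob.marked_imap[OF ob.arr_marked[OF H(3)]]
  have "ob.icomp (ob.lg n x) H (ob.icomp (ob.lg n x) G F) = ob.icomp (ob.lg n x) (ob.icomp (ob.lg n y) H G) F"
    by (rule ob.imap_eqI[OF ob.imap_icomp[OF ob.imap_icomp[OF Fi Gi] Hi]
          ob.imap_icomp[OF Fi ob.imap_icomp[OF Gi Hi]]])
      (simp add: ob.icomp_apply ob.imap_ivl[OF Fi])
  then show "Comp (subint_groupoid X n) h (Comp (subint_groupoid X n) g f) =
      Comp (subint_groupoid X n) (Comp (subint_groupoid X n) h g) f"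
    using F G H by simp
next
  fix A assume "A \<in> Ob (subint_groupoid X n)"
  then obtain x where x: "A = subint X n x" "x \<in> Ob (level X n)" by auto
  then show "Ident (subint_groupoid X n) A \<in> Ar (subint_groupoid X n)"
    "Dom (subint_groupoid X n) (Ident (subint_groupoid X n) A) = A"
    "Cod (subint_groupoid X n) (Ident (subint_groupoid X n) A) = A"
    by (simp_all add: subint_arrowI ob.arr_iid)
qed

text \<open>At the identity of [m] the condition on subdivisions becomes the normalization in
  \<open>ob.incl_unique\<close>, so the definite description has \<open>ob.inclr\<close> as its only
  solution.\<close>

lemma interval_incl_eq:
  assumes p: "p \<in> Delta m n" and x: "x \<in> Ob (level X n)"
  shows "interval_incl X m n p x = ob.inclr m n p x"
proof -
  let ?x' = "onOb (act X m n p) x"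
  have x': "?x' \<in> Ob (level X m)" by (rule act_Ob[OF p x])
  note i = ob.imap_inclr[OF p x]
  note plx' = ob.pls_in_ivl[OF x']
  have inclr_pls: "ob.inclr m n p x m (ob.pls m ?x') = ob.sh m n p (ob.pls n x)"
    using ob.incl_pls[OF p x] by (simp add: ob.inclr_apply plx')
  show ?thesis
    unfolding interval_incl_def Let_def long_eq sset_map_interval interval_simps
  proof (rule the_equality)
    show "ob.imap (ob.lg m ?x') (ob.lg n x) (ob.inclr m n p x) \<and>
      (\<forall>k. \<forall>q\<in>Delta k m. ob.inclr m n p x k (subdivision X m ?x' k q) =
         subdivision X n x k (compose {..k} p q)) \<and>
      (\<forall>k. \<forall>\<sigma>\<in>ob.ivl (ob.lg m ?x') k. middle X k (ob.inclr m n p x k \<sigma>) = middle X k \<sigma>)"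
    proof (intro conjI allI ballI)
      fix k q assume q: "q \<in> Delta k m"
      show "ob.inclr m n p x k (subdivision X m ?x' k q) = subdivision X n x k (compose {..k} p q)"
        using q by (simp add: subdivision_apply x x' Delta_compose[OF q p] ob.imap_sh[OF i q plx'] inclr_pls
            ob.sh_comp[OF q p])
    next
      fix k s assume s: "s \<in> ob.ivl (ob.lg m ?x') k"
      then show "middle X k (ob.inclr m n p x k s) = middle X k s"
        using ivl_Ob[OF ob.imap_ivl[OF i s]]
        by (simp add: middle_eq ivl_Ob[OF s] ob.inclr_apply ob.mdl_incl[OF p x])
    qed (rule i)
  next
    fix c assume c: "ob.imap (ob.lg m ?x') (ob.lg n x) c \<and>
      (\<forall>k. \<forall>q\<in>Delta k m. c k (subdivision X m ?x' k q) = subdivision X n x k (compose {..k} p q)) \<and>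
      (\<forall>k. \<forall>\<sigma>\<in>ob.ivl (ob.lg m ?x') k. middle X k (c k \<sigma>) = middle X k \<sigma>)"
    then have ci: "ob.imap (ob.lg m ?x') (ob.lg n x) c" by blast
    have "c m (subdivision X m ?x' m (restrict id {..m})) =
      subdivision X n x m (compose {..m} p (restrict id {..m}))"
      using c Delta_id by blast
    then have cp: "c m (ob.pls m ?x') = ob.sh m n p (ob.pls n x)"
      by (simp add: subdivision_id x' compose_id_Delta[OF p] subdivision_apply x p del: restrict_apply)
    show "c = ob.inclr m n p x"
    proof (rule ob.imap_eqI[OF ci i])
      fix k s assume s: "s \<in> ob.ivl (ob.lg m ?x') k"
      have "c k s = ob.incl m n p x k s"
      proof (rule ob.incl_unique(2)[OF p x ci cp _ s])
        fix k s assume s: "s \<in> ob.ivl (ob.lg m ?x') k"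
        then have "middle X k (c k s) = middle X k s" using c by blast
        then show "ob.mdl k (c k s) = ob.mdl k s"
          by (simp add: middle_eq ivl_Ob[OF s] ivl_Ob[OF ob.imap_ivl[OF ci s]])
      qed
      then show "c k s = ob.inclr m n p x k s" using s by (simp add: ob.inclr_apply)
    qed
  qed
qed

lemma subint_act_Ar_subint:
  assumes p: "p \<in> Delta m n" and x: "x \<in> Ob (level X n)" and y: "y \<in> Ob (level X n)"
    and F: "ob.arr n x y F"
  shows "subint_act_Ar X m n p (subint X n x, F, subint X n y) =
    (subint X m (onOb (act X m n p) x), ob.res m n p x F, subint X m (onOb (act X m n p) y))"
proof -
  let ?x' = "onOb (act X m n p) x" and ?y' = "onOb (act X m n p) y"
  have x': "?x' \<in> Ob (level X m)" and y': "?y' \<in> Ob (level X m)" using act_Ob[OF p] x y by blast+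
  note Fm = ob.arr_marked[OF F]
  \<comment> \<open>Both \<open>\<sigma>\<close> and its image under G lie in the relevant
    intervals, where \<open>inclr\<close> agrees with \<open>incl\<close>.\<close>
  have eq: "(\<forall>k. \<forall>\<sigma>\<in>simplices (fst (subint X m ?x')) k. ob.inclr m n p y k (G k \<sigma>) = F k (ob.inclr m n p x k \<sigma>)) \<longleftrightarrow>
    (\<forall>k. \<forall>\<sigma>\<in>ob.ivl (ob.lg m ?x') k. ob.incl m n p y k (G k \<sigma>) = F k (ob.incl m n p x k \<sigma>))"
    if "ob.arr m ?x' ?y' G" for G
    using ob.imap_ivl[OF ob.marked_imap[OF ob.arr_marked[OF that]]]
    by (simp add: subint_def long_eq ob.inclr_apply)
  have "(THE F'. sset_iso (fst (subint X m ?x')) (fst (subint X m ?y')) F' \<and>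
          (\<forall>k. \<forall>q \<in> Delta k m. F' k (snd (subint X m ?x') k q) = snd (subint X m ?y') k q) \<and>
          (\<forall>k. \<forall>\<sigma> \<in> simplices (fst (subint X m ?x')) k.
             ob.inclr m n p y k (F' k \<sigma>) = F k (ob.inclr m n p x k \<sigma>))) = ob.res m n p x F"
  proof (rule the_equality, goal_cases)
    case 1
    show ?case
      using arr_iff[OF x' y'] ob.arr_res[OF p x y F] eq ob.incl_res[OF p x y Fm]
      by (simp add: subint_def)
  next
    case (2 G)
    then have G: "ob.arr m ?x' ?y' G"
      using arr_iff[OF x' y'] unfolding subint_def fst_conv snd_conv by blast
    show ?case
      by (rule ob.res_unique[OF p x y ob.arr_marked[OF G]]) (use 2 eq[OF G] in blast)
  qed
  then show ?thesis
    by (simp add: subint_act_Ar_def Let_def subint_act_Ob_subint x y subint_simplex_subint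
        interval_incl_eq[OF p])
qed

section \<open>The simplicial structure of U_X\<close>

lemma subdivided_simps [simp]:
  "level (subdivided_intervals X) n = subint_groupoid X n"
  "onOb (act (subdivided_intervals X) m n p) = subint_act_Ob X m n p"
  "onAr (act (subdivided_intervals X) m n p) = subint_act_Ar X m n p"
  by (simp_all add: subdivided_intervals_def)

lemma simplicial_groupoid_subdivided: "simplicial_groupoid (subdivided_intervals X)"
proof (rule simplicial_groupoid.intro)
  fix n show "groupoid (level (subdivided_intervals X) n)" by (simp add: groupoid_subint)
next
  fix m n p assume p: "p \<in> Delta m n"
  show "groupoid_functor (level (subdivided_intervals X) n) (level (subdivided_intervals X) m)
    (act (subdivided_intervals X) m n p)"
  proof (intro groupoid_functor.intro groupoid_functor_axioms.intro, unfold subdivided_simps)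
    show "groupoid (subint_groupoid X n)" "groupoid (subint_groupoid X m)"
      by (rule groupoid_subint)+
  next
    fix A assume "A \<in> Ob (subint_groupoid X n)"
    then show "subint_act_Ob X m n p A \<in> Ob (subint_groupoid X m)"
      and "subint_act_Ar X m n p (Ident (subint_groupoid X n) A) =
        Ident (subint_groupoid X m) (subint_act_Ob X m n p A)"
      using ob.res_iid[OF p] by (auto simp: subint_act_Ob_subint act_Ob[OF p] subint_act_Ar_subint[OF p] ob.arr_iid)
  next
    fix f assume "f \<in> Ar (subint_groupoid X n)"
    then obtain x y F where F: "f = (subint X n x, F, subint X n y)"
      "x \<in> Ob (level X n)" "y \<in> Ob (level X n)" "ob.arr n x y F"
      by (rule subint_arrowE)
    then show "subint_act_Ar X m n p f \<in> Ar (subint_groupoid X m)"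
      "Dom (subint_groupoid X m) (subint_act_Ar X m n p f) = subint_act_Ob X m n p (Dom (subint_groupoid X n) f)"
      "Cod (subint_groupoid X m) (subint_act_Ar X m n p f) = subint_act_Ob X m n p (Cod (subint_groupoid X n) f)"
      by (auto simp: subint_act_Ar_subint[OF p] subint_act_Ob_subint act_Ob[OF p]
          intro!: subint_arrowI ob.arr_res[OF p])
    fix g assume "g \<in> Ar (subint_groupoid X n)" and fg: "Cod (subint_groupoid X n) f = Dom (subint_groupoid X n) g"
    then obtain z G where G: "g = (subint X n y, G, subint X n z)"
      "z \<in> Ob (level X n)" "ob.arr n y z G"
      using F by (auto elim!: subint_arrowE simp: subint_eq_iff)
    show "subint_act_Ar X m n p (Comp (subint_groupoid X n) g f) =
      Comp (subint_groupoid X m) (subint_act_Ar X m n p g) (subint_act_Ar X m n p f)"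
      using F G ob.res_icomp[OF p F(2,3) G(2) ob.arr_marked[OF F(4)] ob.arr_marked[OF G(3)]]
      by (simp add: subint_act_Ar_subint[OF p] ob.arr_icomp)
  qed
next
  fix n A assume "A \<in> Ob (level (subdivided_intervals X) n)"
  then show "onOb (act (subdivided_intervals X) n n (restrict id {..n})) A = A"
    by (auto simp: subint_act_Ob_subint act_id_Ob simp del: restrict_apply)
next
  fix n f assume "f \<in> Ar (level (subdivided_intervals X) n)"
  then obtain x y F where F: "f = (subint X n x, F, subint X n y)"
      "x \<in> Ob (level X n)" "y \<in> Ob (level X n)" "ob.arr n x y F"
    by (auto elim: subint_arrowE)
  \<comment> \<open>The identity is active, so restriction along it leaves the underlying map
    unchanged.\<close>
  have "active n n (restrict id {..n})" by (simp add: active_def Delta_id)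
  from ob.res_active[OF this F(2,3) ob.arr_marked[OF F(4)]]
  show "onAr (act (subdivided_intervals X) n n (restrict id {..n})) f = f"
    using F by (simp add: subint_act_Ar_subint[OF Delta_id] act_id_Ob del: restrict_apply)
next
  fix l m n p q A assume "p \<in> Delta l m" "q \<in> Delta m n" "A \<in> Ob (level (subdivided_intervals X) n)"
  then show "onOb (act (subdivided_intervals X) l n (compose {..l} q p)) A =
    onOb (act (subdivided_intervals X) l m p) (onOb (act (subdivided_intervals X) m n q) A)"
    by (auto simp: subint_act_Ob_subint act_Ob act_comp_Ob)
next
  fix l m n p q f assume p: "p \<in> Delta l m" and q: "q \<in> Delta m n"
    and "f \<in> Ar (level (subdivided_intervals X) n)"
  then obtain x y F where F: "f = (subint X n x, F, subint X n y)"
      "x \<in> Ob (level X n)" "y \<in> Ob (level X n)" "ob.arr n x y F"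
    by (auto elim: subint_arrowE)
  show "onAr (act (subdivided_intervals X) l n (compose {..l} q p)) f =
    onAr (act (subdivided_intervals X) l m p) (onAr (act (subdivided_intervals X) m n q) f)"
    using F ob.res_compose[OF p q F(2,3) ob.arr_marked[OF F(4)]] ob.arr_res[OF q F(2,3,4)]
    by (simp add: subint_act_Ar_subint p q Delta_compose[OF p q] act_Ob[OF q] act_comp_Ob[OF p q])
qed

end


section \<open>Groupoids of modifications\<close>

definition inverse_arrow :: "('o, 'a) groupoid \<Rightarrow> 'a \<Rightarrow> 'a" where
  "inverse_arrow G f = (SOME g. g \<in> Ar G \<and> Dom G g = Cod G f \<and> Cod G g = Dom G f \<and>
     Comp G g f = Ident G (Dom G f) \<and> Comp G f g = Ident G (Cod G f))"

context groupoid
begin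

lemma
  assumes "f \<in> Ar G"
  shows inverse_arrow_closed: "inverse_arrow G f \<in> Ar G"
    and Dom_inverse: "Dom G (inverse_arrow G f) = Cod G f"
    and Cod_inverse: "Cod G (inverse_arrow G f) = Dom G f"
    and Comp_inverse_left: "Comp G (inverse_arrow G f) f = Ident G (Dom G f)"
    and Comp_inverse_right: "Comp G f (inverse_arrow G f) = Ident G (Cod G f)"
  using someI_ex[OF inverse_ex[OF assms, unfolded Bex_def]] unfolding inverse_arrow_def by blast+

lemma inverse_unique:
  assumes f: "f \<in> Ar G" and g: "g \<in> Ar G" "Dom G g = Cod G f" "Comp G g f = Ident G (Dom G f)"
  shows "g = inverse_arrow G f"
proof -
  let ?i = "inverse_arrow G f"
  note i = inverse_arrow_closed[OF f] Dom_inverse[OF f] Cod_inverse[OF f]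
  have "g = Comp G g (Comp G f ?i)"
    using Comp_Ident_right[OF g(1)] g(2) by (simp add: Comp_inverse_right[OF f])
  also have "\<dots> = Comp G (Comp G g f) ?i"
    using f g i by (intro Comp_assoc) simp_all
  also have "\<dots> = ?i"
    using Comp_Ident_left[OF i(1)] i g(3) by simp
  finally show ?thesis .
qed

lemma inverse_inverse: "f \<in> Ar G \<Longrightarrow> inverse_arrow G (inverse_arrow G f) = f"
  using inverse_unique[OF inverse_arrow_closed, of f f]
  by (simp add: Dom_inverse Cod_inverse Comp_inverse_right)

lemma cancel_right:
  assumes f: "f \<in> Ar G" "g \<in> Ar G" and u: "u \<in> Ar G" "Cod G u = Dom G f" "Dom G f = Dom G g"
    and eq: "Comp G f u = Comp G g u"
  shows "f = g"
proof -
  let ?i = "inverse_arrow G u"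
  note i = inverse_arrow_closed[OF u(1)] Dom_inverse[OF u(1)] Cod_inverse[OF u(1)]
  have "h = Comp G (Comp G h u) ?i" if "h \<in> Ar G" "Dom G h = Dom G f" for h
    using Comp_assoc[OF i(1) u(1) that(1)] Comp_Ident_right[OF that(1)] that u i
    by (simp add: Comp_inverse_right)
  then show ?thesis using f u(3) eq by metis
qed

end

lemma (in groupoid_functor) onAr_inverse:
  assumes f: "f \<in> Ar A"
  shows "onAr F (inverse_arrow A f) = inverse_arrow B (onAr F f)"
  using f A.inverse_arrow_closed[OF f] A.Dom_inverse[OF f] A.Cod_inverse[OF f]
    onAr_Comp[OF f A.inverse_arrow_closed[OF f]]
  by (intro B.inverse_unique)
    (simp_all add: onAr_closed onAr_Dom onAr_Cod A.Comp_inverse_left onAr_Ident A.Dom_closed)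

text \<open>The definition lifts arrows with a prescribed target. Inverting before and after lifting
  prescribes the source instead, as transport along an arrow requires.\<close>

lemma discrete_fibration_lift_Dom:
  assumes F: "groupoid_functor E B F" and df: "discrete_fibration E B F"
    and e: "e \<in> Ob E" and b: "b \<in> Ar B" and eb: "Dom B b = onOb F e"
  shows "\<exists>!a. a \<in> Ar E \<and> Dom E a = e \<and> onAr F a = b"
proof -
  interpret groupoid_functor E B F by (rule F)
  let ?i = "inverse_arrow E" and ?j = "inverse_arrow B"
  have "\<exists>!a. a \<in> Ar E \<and> Cod E a = e \<and> onAr F a = ?j b"
    using df e b eb B.inverse_arrow_closed[OF b] B.Cod_inverse[OF b]
    unfolding discrete_fibration_def by auto
  then obtain a where a: "a \<in> Ar E" "Cod E a = e" "onAr F a = ?j b"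
    and u: "\<And>a'. a' \<in> Ar E \<Longrightarrow> Cod E a' = e \<Longrightarrow> onAr F a' = ?j b \<Longrightarrow> a' = a" by metis
  show ?thesis
  proof (rule ex1I[of _ "?i a"])
    show "?i a \<in> Ar E \<and> Dom E (?i a) = e \<and> onAr F (?i a) = b"
      using a b by (simp add: A.inverse_arrow_closed A.Dom_inverse onAr_inverse B.inverse_inverse)
  next
    fix a' assume a': "a' \<in> Ar E \<and> Dom E a' = e \<and> onAr F a' = b"
    then have "?i a' = a"
      by (intro u) (simp_all add: A.inverse_arrow_closed A.Cod_inverse onAr_inverse)
    then show "a' = ?i a" using A.inverse_inverse a' by metis
  qed
qed

text \<open>Parallel arrows agree: both become the unique arrow out of c after precomposition with
  \<open>\<theta>\<close> at their source, which can be cancelled. The inverses of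
  \<open>\<theta>\<close> are then automatically natural towards the constant functor at c.\<close>

lemma contractibleI:
  fixes G :: "('o, 'a) groupoid"
  assumes "groupoid G" and c: "c \<in> Ob G"
    and ex1: "\<And>x. x \<in> Ob G \<Longrightarrow> \<exists>!f. f \<in> Ar G \<and> Dom G f = c \<and> Cod G f = x"
  shows "contractible_groupoid G"
proof -
  interpret groupoid G by (rule assms)
  have "\<exists>\<theta>. \<forall>x \<in> Ob G. \<theta> x \<in> Ar G \<and> Dom G (\<theta> x) = c \<and> Cod G (\<theta> x) = x"
    using ex1 by (intro bchoice) blast
  then obtain \<theta> where \<theta>: "\<And>x. x \<in> Ob G \<Longrightarrow> \<theta> x \<in> Ar G" "\<And>x. x \<in> Ob G \<Longrightarrow> Dom G (\<theta> x) = c"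
      "\<And>x. x \<in> Ob G \<Longrightarrow> Cod G (\<theta> x) = x" by blast
  have unique: "f = g" if "f \<in> Ar G" "g \<in> Ar G" "Dom G f = Dom G g" "Cod G f = Cod G g" for f g
  proof (rule cancel_right)
    have D: "Dom G f \<in> Ob G" "Cod G f \<in> Ob G" using that by (simp_all add: Dom_closed Cod_closed)
    show "\<theta> (Dom G f) \<in> Ar G" "Cod G (\<theta> (Dom G f)) = Dom G f" using \<theta> D by blast+
    show "Comp G f (\<theta> (Dom G f)) = Comp G g (\<theta> (Dom G f))"
      using ex1[OF D(2)] that \<theta>(1,2,3)[OF D(1)] Comp_closed Dom_Comp Cod_Comp by metis
  qed (use that in simp_all)
  let ?T = "terminal_groupoid"
  let ?F = "\<lparr>onOb = \<lambda>_. (), onAr = \<lambda>_. ()\<rparr> :: ('o, 'a, unit, unit) gfun"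
  let ?H = "\<lparr>onOb = \<lambda>_. c, onAr = \<lambda>_. Ident G c\<rparr> :: (unit, unit, 'o, 'a) gfun"
  have T: "groupoid ?T" by unfold_locales (auto simp: terminal_groupoid_def)
  have Ic: "Ident G c \<in> Ar G" "Dom G (Ident G c) = c" "Cod G (Ident G c) = c"
    using c by (simp_all add: Ident_closed Dom_Ident Cod_Ident)
  have Icc: "Comp G (Ident G c) (Ident G c) = Ident G c"
    using Comp_Ident_left[OF Ic(1)] Ic by simp
  have F: "groupoid_functor G ?T ?F"
    by (intro groupoid_functor.intro groupoid_functor_axioms.intro \<open>groupoid G\<close> T)
      (auto simp: terminal_groupoid_def)
  have H: "groupoid_functor ?T G ?H"
    by (intro groupoid_functor.intro groupoid_functor_axioms.intro \<open>groupoid G\<close> T)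
      (auto simp: terminal_groupoid_def c Ic Icc)
  have comp: "comp_gfun ?H ?F = \<lparr>onOb = \<lambda>_. c, onAr = \<lambda>_. Ident G c\<rparr>"
    "comp_gfun ?F ?H = \<lparr>onOb = \<lambda>_. (), onAr = \<lambda>_. ()\<rparr>"
    by (auto simp: comp_gfun_def)
  have "nat_transformation G G id_gfun (comp_gfun ?H ?F)
    (restrict (\<lambda>x. inverse_arrow G (\<theta> x)) (Ob G))" (is "nat_transformation G G _ _ ?\<eta>")
    unfolding comp
  proof (intro nat_transformation.intro nat_transformation_axioms.intro
      groupoid_functor.intro groupoid_functor_axioms.intro \<open>groupoid G\<close>)
    fix f assume f: "f \<in> Ar G"
    note D = Dom_closed[OF f] Cod_closed[OF f]
    note e = inverse_arrow_closed Dom_inverse Cod_inverse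
    show "Comp G (onAr \<lparr>onOb = \<lambda>_. c, onAr = \<lambda>_. Ident G c\<rparr> f) (?\<eta> (Dom G f)) =
      Comp G (?\<eta> (Cod G f)) (onAr id_gfun f)"
      using f D by (intro unique)
        (simp_all add: \<theta> e id_gfun_def Ic Comp_closed Dom_Comp Cod_Comp)
  qed (auto simp: id_gfun_def c Ic Icc \<theta> inverse_arrow_closed Dom_inverse Cod_inverse)
  moreover have "nat_transformation ?T ?T (comp_gfun ?F ?H) id_gfun (\<lambda>_. ())"
    unfolding comp
    by (intro nat_transformation.intro nat_transformation_axioms.intro
        groupoid_functor.intro groupoid_functor_axioms.intro T)
      (auto simp: terminal_groupoid_def id_gfun_def)
  ultimately show ?thesis
    unfolding contractible_groupoid_def equivalent_groupoids_def using F H by blast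
qed

section \<open>Composition and inversion of modifications\<close>

lemma (in simplicial_map)
  shows J_Ob: "x \<in> Ob (level X n) \<Longrightarrow> onOb (J n) x \<in> Ob (level Y n)"
    and J_Ar: "a \<in> Ar (level X n) \<Longrightarrow> onAr (J n) a \<in> Ar (level Y n)"
    and J_Dom: "a \<in> Ar (level X n) \<Longrightarrow> Dom (level Y n) (onAr (J n) a) = onOb (J n) (Dom (level X n) a)"
    and J_Cod: "a \<in> Ar (level X n) \<Longrightarrow> Cod (level Y n) (onAr (J n) a) = onOb (J n) (Cod (level X n) a)"
  using groupoid_functor.onOb_closed[OF functor_level] groupoid_functor.onAr_closed[OF functor_level]
    groupoid_functor.onAr_Dom[OF functor_level] groupoid_functor.onAr_Cod[OF functor_level] by auto

lemma modificationI:
  assumes J: "simplicial_map X Y J" and J': "simplicial_map X Y J'"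
    and "\<And>n. \<Gamma> n \<in> extensional (Ob (level X n))"
    and "\<And>n x. x \<in> Ob (level X n) \<Longrightarrow> \<Gamma> n x \<in> Ar (level Y n)"
    and "\<And>n x. x \<in> Ob (level X n) \<Longrightarrow> Dom (level Y n) (\<Gamma> n x) = onOb (J n) x"
    and "\<And>n x. x \<in> Ob (level X n) \<Longrightarrow> Cod (level Y n) (\<Gamma> n x) = onOb (J' n) x"
    and "\<And>n f. f \<in> Ar (level X n) \<Longrightarrow>
        Comp (level Y n) (onAr (J' n) f) (\<Gamma> n (Dom (level X n) f)) =
        Comp (level Y n) (\<Gamma> n (Cod (level X n) f)) (onAr (J n) f)"
    and "\<And>m n p x. p \<in> Delta m n \<Longrightarrow> x \<in> Ob (level X n) \<Longrightarrow>
        onAr (act Y m n p) (\<Gamma> n x) = \<Gamma> m (onOb (act X m n p) x)"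
  shows "modification X Y J J' \<Gamma>"
  using assms simplicial_map.functor_level[OF J] simplicial_map.functor_level[OF J']
  by (intro modification.intro modification_axioms.intro nat_transformation.intro
      nat_transformation_axioms.intro) auto

context modification
begin

lemma
  shows comp_ext: "\<Gamma> n \<in> extensional (Ob (level X n))"
    and comp_Ar: "x \<in> Ob (level X n) \<Longrightarrow> \<Gamma> n x \<in> Ar (level Y n)"
    and comp_Dom: "x \<in> Ob (level X n) \<Longrightarrow> Dom (level Y n) (\<Gamma> n x) = onOb (J n) x"
    and comp_Cod: "x \<in> Ob (level X n) \<Longrightarrow> Cod (level Y n) (\<Gamma> n x) = onOb (J' n) x"
    and comp_natural: "f \<in> Ar (level X n) \<Longrightarrow>
        Comp (level Y n) (onAr (J' n) f) (\<Gamma> n (Dom (level X n) f)) =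
        Comp (level Y n) (\<Gamma> n (Cod (level X n) f)) (onAr (J n) f)"
  using nat_transformation.component_ext[OF nat_level] nat_transformation.component_closed[OF nat_level]
    nat_transformation.component_Dom[OF nat_level] nat_transformation.component_Cod[OF nat_level]
    nat_transformation.natural[OF nat_level] by auto

text \<open>Whiskering is respected because functors preserve inverses; naturality follows from that
  of \<open>\<Gamma>\<close> after cancelling the component at the source.\<close>

lemma modification_inverse:
  "modification X Y J' J (\<lambda>n. restrict (\<lambda>x. inverse_arrow (level Y n) (\<Gamma> n x)) (Ob (level X n)))"
    (is "modification X Y J' J ?i")
proof (rule modificationI[OF J'.simplicial_map_axioms J.simplicial_map_axioms])
  fix n show "?i n \<in> extensional (Ob (level X n))" by simp
next
  fix n interpret Y: groupoid "level Y n" by (rule J.Y.groupoid_level)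
  { fix x assume x: "x \<in> Ob (level X n)"
    then show "?i n x \<in> Ar (level Y n)" "Dom (level Y n) (?i n x) = onOb (J' n) x"
      "Cod (level Y n) (?i n x) = onOb (J n) x"
      using comp_Ar[OF x] by (simp_all add: Y.inverse_arrow_closed Y.Dom_inverse Y.Cod_inverse comp_Dom comp_Cod)
    fix m p assume p: "p \<in> Delta m n"
    interpret a: groupoid_functor "level Y n" "level Y m" "act Y m n p" by (rule J.Y.functor_act[OF p])
    have "onOb (act X m n p) x \<in> Ob (level X m)"
      using groupoid_functor.onOb_closed[OF J.X.functor_act[OF p] x] .
    then show "onAr (act Y m n p) (?i n x) = ?i m (onOb (act X m n p) x)"
      using x p by (simp add: a.onAr_inverse comp_Ar whisker) }
  fix f assume f: "f \<in> Ar (level X n)"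
  let ?x = "Dom (level X n) f" and ?y = "Cod (level X n) f"
  interpret X: groupoid "level X n" by (rule J.X.groupoid_level)
  note xy = X.Dom_closed[OF f] X.Cod_closed[OF f]
  note [simp] = xy comp_Ar comp_Dom comp_Cod f Y.inverse_arrow_closed Y.Dom_inverse Y.Cod_inverse
    J.J_Ar J'.J_Ar J.J_Dom J'.J_Dom J.J_Cod J'.J_Cod Y.Comp_closed Y.Dom_Comp Y.Cod_Comp
  let ?g = "\<Gamma> n ?x" and ?h = "\<Gamma> n ?y"
  show "Comp (level Y n) (onAr (J n) f) (?i n ?x) = Comp (level Y n) (?i n ?y) (onAr (J' n) f)"
  proof (rule Y.cancel_right[where u = ?g])
    have "Comp (level Y n) (Comp (level Y n) (onAr (J n) f) (?i n ?x)) ?g =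
      Comp (level Y n) (onAr (J n) f) (Comp (level Y n) (?i n ?x) ?g)"
      by (rule Y.Comp_assoc[symmetric]) simp_all
    also have "\<dots> = onAr (J n) f"
      using Y.Comp_Ident_right[of "onAr (J n) f"] by (simp add: Y.Comp_inverse_left)
    also have "\<dots> = Comp (level Y n) (Comp (level Y n) (?i n ?y) ?h) (onAr (J n) f)"
      using Y.Comp_Ident_left[of "onAr (J n) f"] by (simp add: Y.Comp_inverse_left)
    also have "\<dots> = Comp (level Y n) (?i n ?y) (Comp (level Y n) ?h (onAr (J n) f))"
      by (rule Y.Comp_assoc[symmetric]) simp_all
    also have "\<dots> = Comp (level Y n) (?i n ?y) (Comp (level Y n) (onAr (J' n) f) ?g)"
      by (simp only: comp_natural[OF f])
    also have "\<dots> = Comp (level Y n) (Comp (level Y n) (?i n ?y) (onAr (J' n) f)) ?g"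
      by (rule Y.Comp_assoc) simp_all
    finally show "Comp (level Y n) (Comp (level Y n) (onAr (J n) f) (?i n ?x)) ?g =
      Comp (level Y n) (Comp (level Y n) (?i n ?y) (onAr (J' n) f)) ?g" .
  qed simp_all
qed

lemma invertible: "invertible_modification X Y J J' \<Gamma>"
  unfolding invertible_modification_def
  using modification_axioms modification_inverse
  by (intro conjI exI[of _ "\<lambda>n. restrict (\<lambda>x. inverse_arrow (level Y n) (\<Gamma> n x)) (Ob (level X n))"])
    (auto simp: comp_modification_def id_modification_def restrict_def fun_eq_iff comp_Ar comp_Dom comp_Cod
      groupoid.Comp_inverse_left[OF J.Y.groupoid_level] groupoid.Comp_inverse_right[OF J.Y.groupoid_level])

end

lemma invertible_modification_iff:
  "invertible_modification X Y J J' \<Gamma> \<longleftrightarrow> modification X Y J J' \<Gamma>"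
  using modification.invertible unfolding invertible_modification_def by blast

lemma modification_eqI:
  assumes "modification X Y J J' \<Gamma>" "modification X Y J J' \<Gamma>'"
    and "\<And>n x. x \<in> Ob (level X n) \<Longrightarrow> \<Gamma> n x = \<Gamma>' n x"
  shows "\<Gamma> = \<Gamma>'"
  by (rule ext, rule extensionalityI[OF modification.comp_ext[OF assms(1)]
        modification.comp_ext[OF assms(2)] assms(3)])

lemma modification_id:
  assumes "simplicial_map X Y J"
  shows "modification X Y J J (id_modification X Y J)"
proof -
  interpret simplicial_map X Y J by (rule assms)
  show ?thesis
  proof (rule modificationI[OF assms assms])
    fix n interpret g: groupoid "level Y n" by (rule Y.groupoid_level)
    interpret x: groupoid "level X n" by (rule X.groupoid_level)
    show "id_modification X Y J n \<in> extensional (Ob (level X n))" by (simp add: id_modification_def)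
    show "Comp (level Y n) (onAr (J n) f) (id_modification X Y J n (Dom (level X n) f)) =
        Comp (level Y n) (id_modification X Y J n (Cod (level X n) f)) (onAr (J n) f)"
      if f: "f \<in> Ar (level X n)" for f
      using g.Comp_Ident_left[OF J_Ar[OF f]] g.Comp_Ident_right[OF J_Ar[OF f]] f
      by (simp add: id_modification_def x.Dom_closed x.Cod_closed J_Dom J_Cod)
    fix x assume x: "x \<in> Ob (level X n)"
    then show "id_modification X Y J n x \<in> Ar (level Y n)"
      "Dom (level Y n) (id_modification X Y J n x) = onOb (J n) x"
      "Cod (level Y n) (id_modification X Y J n x) = onOb (J n) x"
      by (simp_all add: id_modification_def J_Ob g.Ident_closed g.Dom_Ident g.Cod_Ident)
    fix m p assume p: "p \<in> Delta m n"
    then show "onAr (act Y m n p) (id_modification X Y J n x) =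
        id_modification X Y J m (onOb (act X m n p) x)"
      using x groupoid_functor.onOb_closed[OF X.functor_act[OF p] x]
        groupoid_functor.onAr_Ident[OF Y.functor_act[OF p] J_Ob[OF x]]
      by (simp add: id_modification_def act_onOb)
  qed
qed

lemma modification_comp:
  assumes "modification X Y J J' \<Gamma>" "modification X Y J' J'' \<Gamma>'"
  shows "modification X Y J J'' (comp_modification X Y \<Gamma>' \<Gamma>)"
proof -
  interpret A: modification X Y J J' \<Gamma> by (rule assms)
  interpret B: modification X Y J' J'' \<Gamma>' by (rule assms)
  show ?thesis
  proof (rule modificationI[OF A.J.simplicial_map_axioms B.J'.simplicial_map_axioms])
    fix n interpret Y: groupoid "level Y n" by (rule A.J.Y.groupoid_level)
    interpret X: groupoid "level X n" by (rule A.J.X.groupoid_level)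
    note [simp] = A.comp_Ar A.comp_Dom A.comp_Cod B.comp_Ar B.comp_Dom B.comp_Cod
      Y.Comp_closed Y.Dom_Comp Y.Cod_Comp X.Dom_closed X.Cod_closed
      A.J.J_Ar A.J'.J_Ar B.J'.J_Ar A.J.J_Dom A.J'.J_Dom B.J'.J_Dom A.J.J_Cod A.J'.J_Cod B.J'.J_Cod
    show "comp_modification X Y \<Gamma>' \<Gamma> n \<in> extensional (Ob (level X n))"
      by (simp add: comp_modification_def)
    show "Comp (level Y n) (onAr (J'' n) f) (comp_modification X Y \<Gamma>' \<Gamma> n (Dom (level X n) f)) =
        Comp (level Y n) (comp_modification X Y \<Gamma>' \<Gamma> n (Cod (level X n) f)) (onAr (J n) f)"
      if f: "f \<in> Ar (level X n)" for f
    proof -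
      let ?x = "Dom (level X n) f" and ?y = "Cod (level X n) f"
      have "Comp (level Y n) (onAr (J'' n) f) (Comp (level Y n) (\<Gamma>' n ?x) (\<Gamma> n ?x)) =
        Comp (level Y n) (Comp (level Y n) (onAr (J'' n) f) (\<Gamma>' n ?x)) (\<Gamma> n ?x)"
        using f by (intro Y.Comp_assoc) simp_all
      also have "\<dots> = Comp (level Y n) (Comp (level Y n) (\<Gamma>' n ?y) (onAr (J' n) f)) (\<Gamma> n ?x)"
        by (simp only: B.comp_natural[OF f])
      also have "\<dots> = Comp (level Y n) (\<Gamma>' n ?y) (Comp (level Y n) (onAr (J' n) f) (\<Gamma> n ?x))"
        using f by (intro Y.Comp_assoc[symmetric]) simp_all
      also have "\<dots> = Comp (level Y n) (\<Gamma>' n ?y) (Comp (level Y n) (\<Gamma> n ?y) (onAr (J n) f))"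
        by (simp only: A.comp_natural[OF f])
      also have "\<dots> = Comp (level Y n) (Comp (level Y n) (\<Gamma>' n ?y) (\<Gamma> n ?y)) (onAr (J n) f)"
        using f by (intro Y.Comp_assoc) simp_all
      finally show ?thesis using f by (simp add: comp_modification_def)
    qed
    fix x assume x: "x \<in> Ob (level X n)"
    then show "comp_modification X Y \<Gamma>' \<Gamma> n x \<in> Ar (level Y n)"
      "Dom (level Y n) (comp_modification X Y \<Gamma>' \<Gamma> n x) = onOb (J n) x"
      "Cod (level Y n) (comp_modification X Y \<Gamma>' \<Gamma> n x) = onOb (J'' n) x"
      by (simp_all add: comp_modification_def)
    fix m p assume p: "p \<in> Delta m n"
    show "onAr (act Y m n p) (comp_modification X Y \<Gamma>' \<Gamma> n x) =
        comp_modification X Y \<Gamma>' \<Gamma> m (onOb (act X m n p) x)"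
      using x groupoid_functor.onOb_closed[OF A.J.X.functor_act[OF p] x]
      by (simp add: comp_modification_def groupoid_functor.onAr_Comp[OF A.J.Y.functor_act[OF p]]
          A.whisker[OF p] B.whisker[OF p])
  qed
qed

section \<open>The mapping groupoid\<close>

lemma groupoid_map: "groupoid (map_groupoid X Y)"
proof -
  let ?M = "map_groupoid X Y"
  have Ar: "f \<in> Ar ?M \<longleftrightarrow> (\<exists>J \<Gamma> J'. f = (J, \<Gamma>, J') \<and> strict_culf_map X Y J \<and> strict_culf_map X Y J' \<and>
      modification X Y J J' \<Gamma>)" for f
    by (auto simp: map_groupoid_def invertible_modification_iff)
  have simps: "Ob ?M = {J. strict_culf_map X Y J}" "Dom ?M (J, \<Gamma>, J') = J" "Cod ?M (J, \<Gamma>, J') = J'"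
    "Ident ?M J = (J, id_modification X Y J, J)"
    "Comp ?M (K, \<Gamma>', K') (J, \<Gamma>, J') = (J, comp_modification X Y \<Gamma>' \<Gamma>, K')" for J \<Gamma> J' K \<Gamma>' K'
    by (simp_all add: map_groupoid_def)
  note sm = strict_culf_map.axioms(1)
  show ?thesis
  proof (rule groupoid.intro)
    fix J assume "J \<in> Ob ?M"
    then show "Ident ?M J \<in> Ar ?M" "Dom ?M (Ident ?M J) = J" "Cod ?M (Ident ?M J) = J"
      unfolding Ar using modification_id[OF sm] by (auto simp: simps)
  next
    fix f assume "f \<in> Ar ?M"
    then obtain J \<Gamma> J' where f: "f = (J, \<Gamma>, J')" "strict_culf_map X Y J" "strict_culf_map X Y J'"
      "modification X Y J J' \<Gamma>" unfolding Ar by blast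
    interpret F: modification X Y J J' \<Gamma> by (rule f)
    show "Dom ?M f \<in> Ob ?M" "Cod ?M f \<in> Ob ?M" using f by (simp_all add: simps)
    have "comp_modification X Y \<Gamma> (id_modification X Y J) = \<Gamma>"
    proof (rule modification_eqI[OF modification_comp[OF modification_id[OF sm[OF f(2)]] f(4)] f(4)])
      fix n x assume x: "x \<in> Ob (level X n)"
      then show "comp_modification X Y \<Gamma> (id_modification X Y J) n x = \<Gamma> n x"
        using groupoid.Comp_Ident_right[OF F.J.Y.groupoid_level F.comp_Ar[OF x]]
        by (simp add: comp_modification_def id_modification_def F.comp_Dom)
    qed
    then show "Comp ?M f (Ident ?M (Dom ?M f)) = f" by (simp add: f(1) simps)
    have "comp_modification X Y (id_modification X Y J') \<Gamma> = \<Gamma>"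
    proof (rule modification_eqI[OF modification_comp[OF f(4) modification_id[OF sm[OF f(3)]]] f(4)])
      fix n x assume x: "x \<in> Ob (level X n)"
      then show "comp_modification X Y (id_modification X Y J') \<Gamma> n x = \<Gamma> n x"
        using groupoid.Comp_Ident_left[OF F.J.Y.groupoid_level F.comp_Ar[OF x]]
        by (simp add: comp_modification_def id_modification_def F.comp_Cod)
    qed
    then show "Comp ?M (Ident ?M (Cod ?M f)) f = f" by (simp add: f(1) simps)
    obtain \<Gamma>' where "modification X Y J' J \<Gamma>'"
      "comp_modification X Y \<Gamma>' \<Gamma> = id_modification X Y J"
      "comp_modification X Y \<Gamma> \<Gamma>' = id_modification X Y J'"
      using F.invertible unfolding invertible_modification_def by blast
    then show "\<exists>g\<in>Ar ?M. Dom ?M g = Cod ?M f \<and> Cod ?M g = Dom ?M f \<and>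
        Comp ?M g f = Ident ?M (Dom ?M f) \<and> Comp ?M f g = Ident ?M (Cod ?M f)"
      using f by (intro bexI[of _ "(J', \<Gamma>', J)"]) (auto simp: simps Ar)
    fix g assume "g \<in> Ar ?M" and fg: "Cod ?M f = Dom ?M g"
    then obtain \<Delta> K where g: "g = (J', \<Delta>, K)" "strict_culf_map X Y K" "modification X Y J' K \<Delta>"
      unfolding Ar using f(1) by (auto simp: simps)
    show "Comp ?M g f \<in> Ar ?M" "Dom ?M (Comp ?M g f) = Dom ?M f" "Cod ?M (Comp ?M g f) = Cod ?M g"
      using f g modification_comp[OF f(4) g(3)] by (simp_all add: simps Ar)
    fix h assume "h \<in> Ar ?M" and gh: "Cod ?M g = Dom ?M h"
    then obtain \<Theta> L where h: "h = (K, \<Theta>, L)" "strict_culf_map X Y L" "modification X Y K L \<Theta>"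
      unfolding Ar using g(1) by (auto simp: simps)
    interpret G: modification X Y J' K \<Delta> by (rule g)
    interpret H: modification X Y K L \<Theta> by (rule h)
    have "comp_modification X Y \<Theta> (comp_modification X Y \<Delta> \<Gamma>) =
      comp_modification X Y (comp_modification X Y \<Theta> \<Delta>) \<Gamma>"
    proof (rule modification_eqI[OF modification_comp[OF modification_comp[OF f(4) g(3)] h(3)]
            modification_comp[OF f(4) modification_comp[OF g(3) h(3)]]])
      fix n x assume x: "x \<in> Ob (level X n)"
      then show "comp_modification X Y \<Theta> (comp_modification X Y \<Delta> \<Gamma>) n x =
        comp_modification X Y (comp_modification X Y \<Theta> \<Delta>) \<Gamma> n x"
        using groupoid.Comp_assoc[OF F.J.Y.groupoid_level F.comp_Ar[OF x] G.comp_Ar[OF x] H.comp_Ar[OF x]]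
        by (simp add: comp_modification_def F.comp_Cod G.comp_Dom G.comp_Cod H.comp_Dom)
    qed
    then show "Comp ?M h (Comp ?M g f) = Comp ?M (Comp ?M h g) f"
      by (simp add: f(1) g(1) h(1) simps)
  qed
qed


section \<open>Culf maps to the subdivided intervals\<close>

context rigid_decomposition_groupoid
begin

text \<open>Induction on the number of edges; with one edge, taking the long edge changes nothing.
  Otherwise omit vertex 1 of x and lift b there by induction. The first edge of that lift is lifted
  to the triangle of x on the vertices 0, 1, 2 through the discrete fibration d_1. The two lifts
  glue because [2 + t] is the pushout of [2] and [1 + t] along [1].\<close>

lemma long_lift_Suc:
  assumes "x \<in> Ob (level X (1 + t))" "b \<in> Ar (level X 1)" "Dom (level X 1) b = ob.lg (1 + t) x"
  shows "\<exists>!a. a \<in> Ar (level X (1 + t)) \<and> Dom (level X (1 + t)) a = x \<and> ar.lg (1 + t) a = b"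
  using assms
proof (induction t arbitrary: x)
  case 0
  then have "Dom (level X 1) b = x" using ob.lg_1[of x] by simp
  moreover have "a \<in> Ar (level X 1) \<Longrightarrow> ar.lg 1 a = a" for a by (rule ar.lg_1)
  moreover have "(1::nat) + 0 = 1" by simp
  ultimately show ?case unfolding \<open>1 + 0 = 1\<close> using 0(2) by metis
next
  case (Suc t)
  have e2: "1 + Suc t = 2 + t" by simp
  have x: "x \<in> Ob (level X (2 + t))" and bx: "Dom (level X 1) b = ob.lg (2 + t) x"
    using Suc.prems unfolding e2 by blast+
  let ?g = "long_map 2"
  define h where "h = restrict (\<lambda>i. i) {..1::nat}"
  define g' where "g' = restrict (\<lambda>i. if i \<le> 1 then long_map 2 i else i - 1 + 2) {..1 + t}"
  define h' where "h' = restrict (\<lambda>i. i) {..2::nat}"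
  have po: "Delta_pushout 1 2 (1 + t) (2 + t) ?g h g' h'"
    using pushout_active_inert[OF long_active, where b = 0 and t = t, of 2]
    by (simp add: h_def g'_def h'_def cong del: if_weak_cong)
  have h: "inert 1 (1 + t) h" using inert_add[of 0 1 "1 + t"] by (simp add: h_def)
  note D = po[unfolded Delta_pushout_def]
  have hD: "h \<in> Delta 1 (1 + t)" and g'D: "g' \<in> Delta (1 + t) (2 + t)" and h'D: "h' \<in> Delta 2 (2 + t)"
    and eq: "compose {..1} h' ?g = compose {..1} g' h"
    using D by blast+
  have g'a: "active (1 + t) (2 + t) g'"
    using g'D by (auto simp: active_def g'_def long_map_def)
  have face: "face X 1 1 = act X 1 2 ?g"
  proof -
    have "coface 1 1 = ?g" by (rule ext) (auto simp: coface_def long_map_def)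
    then show ?thesis by (simp add: face_def numeral_2_eq_2)
  qed
  let ?y = "onOb (act X (1 + t) (2 + t) g') x" and ?z = "onOb (act X 2 (2 + t) h') x"
  have y: "?y \<in> Ob (level X (1 + t))" and z: "?z \<in> Ob (level X 2)" using act_Ob x g'D h'D by blast+
  have "Dom (level X 1) b = ob.lg (1 + t) ?y"
    using ob.lg_active[OF g'a x] bx by simp
  from Suc.IH[OF y Suc.prems(2) this]
  obtain ay where ay: "ay \<in> Ar (level X (1 + t))" "Dom (level X (1 + t)) ay = ?y" "ar.lg (1 + t) ay = b"
    and ayu: "\<And>a. a \<in> Ar (level X (1 + t)) \<Longrightarrow> Dom (level X (1 + t)) a = ?y \<Longrightarrow>
      ar.lg (1 + t) a = b \<Longrightarrow> a = ay" by metis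
  let ?e = "onAr (act X 1 (1 + t) h) ay"
  have e: "?e \<in> Ar (level X 1)" by (rule act_Ar[OF hD ay(1)])
  have "Dom (level X 1) ?e = onOb (act X 1 (1 + t) h) ?y"
    by (simp only: act_Dom[OF hD ay(1)] ay(2))
  also have "\<dots> = onOb (act X 1 2 ?g) ?z"
    by (simp only: act_comp_Ob[OF hD g'D x, symmetric] act_comp_Ob[OF long_Delta h'D x, symmetric] eq)
  finally have "Dom (level X 1) ?e = onOb (face X 1 1) ?z" by (simp only: face)
  from discrete_fibration_lift_Dom[OF _ d1_discrete_fibration z e this]
  have "\<exists>!a. a \<in> Ar (level X 2) \<and> Dom (level X 2) a = ?z \<and> onAr (act X 1 2 ?g) a = ?e"
    using functor_act[OF long_Delta] by (simp only: face)
  then obtain az where az: "az \<in> Ar (level X 2)" "Dom (level X 2) az = ?z" "onAr (act X 1 2 ?g) az = ?e"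
    and azu: "\<And>a. a \<in> Ar (level X 2) \<Longrightarrow> Dom (level X 2) a = ?z \<Longrightarrow>
      onAr (act X 1 2 ?g) a = ?e \<Longrightarrow> a = az" by metis
  obtain a where a: "a \<in> Ar (level X (2 + t))" "onAr (act X 2 (2 + t) h') a = az"
      "onAr (act X (1 + t) (2 + t) g') a = ay"
    and au: "\<And>a'. a' \<in> Ar (level X (2 + t)) \<Longrightarrow> onAr (act X 2 (2 + t) h') a' = az \<Longrightarrow>
      onAr (act X (1 + t) (2 + t) g') a' = ay \<Longrightarrow> a' = a"
    using ar.P_pushout[OF long_active h po az(1) ay(1) az(3)] by metis
  have "\<exists>!a. a \<in> Ar (level X (2 + t)) \<and> Dom (level X (2 + t)) a = x \<and> ar.lg (2 + t) a = b"
  proof (rule ex1I[of _ a])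
    have Da: "Dom (level X (2 + t)) a \<in> Ob (level X (2 + t))"
      by (rule groupoid.Dom_closed[OF groupoid_level a(1)])
    have zy: "onOb (act X 1 2 ?g) ?z = onOb (act X 1 (1 + t) h) ?y"
      by (simp only: act_comp_Ob[OF hD g'D x, symmetric] act_comp_Ob[OF long_Delta h'D x, symmetric] eq)
    \<comment> \<open>The source of a and x have the same two restrictions, so they agree by
      uniqueness of gluing for objects.\<close>
    have "Dom (level X (2 + t)) a = x"
    proof -
      have "onOb (act X 2 (2 + t) h') (Dom (level X (2 + t)) a) = ?z"
        "onOb (act X (1 + t) (2 + t) g') (Dom (level X (2 + t)) a) = ?y"
        by (simp_all only: act_Dom[OF h'D a(1), symmetric] act_Dom[OF g'D a(1), symmetric] a(2,3) az(2) ay(2))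
      then show ?thesis
        using ob.P_pushout[OF long_active h po z y zy] Da x by metis
    qed
    moreover have "ar.lg (2 + t) a = b"
      using ar.lg_active[OF g'a a(1)] a(3) ay(3) by simp
    ultimately show "a \<in> Ar (level X (2 + t)) \<and> Dom (level X (2 + t)) a = x \<and> ar.lg (2 + t) a = b"
      using a(1) by blast
  next
    fix a' assume "a' \<in> Ar (level X (2 + t)) \<and> Dom (level X (2 + t)) a' = x \<and> ar.lg (2 + t) a' = b"
    then have a': "a' \<in> Ar (level X (2 + t))" "Dom (level X (2 + t)) a' = x" "ar.lg (2 + t) a' = b" by auto
    have 1: "onAr (act X (1 + t) (2 + t) g') a' = ay"
      by (rule ayu) (simp_all only: act_Ar[OF g'D a'(1)] act_Dom[OF g'D a'(1)] a' ar.lg_active[OF g'a a'(1)])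
    have "onAr (act X 1 2 ?g) (onAr (act X 2 (2 + t) h') a') = ?e"
      unfolding 1[symmetric] by (simp only: act_comp_Ar[OF hD g'D a'(1), symmetric]
          act_comp_Ar[OF long_Delta h'D a'(1), symmetric] eq)
    then have "onAr (act X 2 (2 + t) h') a' = az"
      by (intro azu) (simp_all only: act_Ar[OF h'D a'(1)] act_Dom[OF h'D a'(1)] a')
    then show "a' = a" using au[OF a'(1)] 1 by blast
  qed
  then show ?case unfolding e2 .
qed

lemma long_lift:
  assumes "s \<in> ob.ivl f k" "b \<in> Ar (level X 1)" "Dom (level X 1) b = f"
  shows "\<exists>!a. a \<in> Ar (level X (k + 2)) \<and> Dom (level X (k + 2)) a = s \<and> ar.lg (k + 2) a = b"
proof -
  have "1 + Suc k = k + 2" by simp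
  then show ?thesis using long_lift_Suc[of s "Suc k" b] assms by (simp only: ob.ivl_def mem_Collect_eq)
qed

section \<open>Transport along arrows of X in degree one\<close>

definition lift :: "'a \<Rightarrow> nat \<Rightarrow> 'o \<Rightarrow> 'a" where
  "lift b k s = (THE a. a \<in> Ar (level X (k + 2)) \<and> Dom (level X (k + 2)) a = s \<and> ar.lg (k + 2) a = b)"

definition transport :: "'a \<Rightarrow> nat \<Rightarrow> 'o \<Rightarrow> 'o" where
  "transport b k = restrict (\<lambda>s. Cod (level X (k + 2)) (lift b k s)) (ob.ivl (Dom (level X 1) b) k)"

lemma
  assumes "b \<in> Ar (level X 1)" "s \<in> ob.ivl (Dom (level X 1) b) k"
  shows lift_ivl: "lift b k s \<in> ar.ivl b k"
    and lift_Ar: "lift b k s \<in> Ar (level X (k + 2))"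
    and Dom_lift: "Dom (level X (k + 2)) (lift b k s) = s"
  using theI'[OF long_lift[OF assms(2,1) refl]] unfolding lift_def ar.ivl_def by blast+

lemma lift_unique:
  assumes "a \<in> ar.ivl b k" "Dom (level X (k + 2)) a = s"
  shows "lift b k s = a"
proof -
  have b: "b \<in> Ar (level X 1)" and a: "a \<in> Ar (level X (k + 2))" "ar.lg (k + 2) a = b"
    using assms(1) by (auto simp: ar.ivl_def)
  have "s \<in> ob.ivl (Dom (level X 1) b) k" using dom.h_ivl[OF assms(1)] assms(2) by simp
  then show ?thesis
    unfolding lift_def using long_lift[OF _ b refl] a assms(2) by (intro the1_equality) auto
qed

lemma transport_apply:
  "s \<in> ob.ivl (Dom (level X 1) b) k \<Longrightarrow> transport b k s = Cod (level X (k + 2)) (lift b k s)"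
  by (simp add: transport_def)

text \<open>Lifts are unique, so a transport is computed by exhibiting any suitable arrow: a
  restriction or a composite of lifts, an identity, an arrow in the image of \<open>ar.pls\<close>,
  or an included lift.\<close>

lemma transport_eq:
  assumes "a \<in> ar.ivl b k" "Dom (level X (k + 2)) a = s"
  shows "transport b k s = Cod (level X (k + 2)) a"
  using dom.h_ivl[OF assms(1)] assms(2) lift_unique[OF assms] by (simp add: transport_apply)

lemma imap_transport:
  assumes b: "b \<in> Ar (level X 1)"
  shows "ob.imap (Dom (level X 1) b) (Cod (level X 1) b) (transport b)"
proof (rule ob.imapI)
  fix k show "transport b k \<in> extensional (ob.ivl (Dom (level X 1) b) k)" by (simp add: transport_def)
  fix s assume s: "s \<in> ob.ivl (Dom (level X 1) b) k"
  note l = lift_ivl[OF b s] lift_Ar[OF b s] Dom_lift[OF b s]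
  show "transport b k s \<in> ob.ivl (Cod (level X 1) b) k"
    using cod.h_ivl[OF l(1)] s by (simp add: transport_apply)
  fix j q assume q: "q \<in> Delta j k"
  have "transport b j (ob.sh j k q s) = Cod (level X (j + 2)) (ar.sh j k q (lift b k s))"
    by (rule transport_eq[OF ar.sh_ivl[OF q l(1)]]) (simp only: dom.h_sh[OF q l(2)] l(3))
  also have "\<dots> = ob.sh j k q (transport b k s)"
    by (simp only: cod.h_sh[OF q l(2)] transport_apply[OF s])
  finally show "transport b j (ob.sh j k q s) = ob.sh j k q (transport b k s)" .
qed

lemma transport_Comp:
  assumes b: "b \<in> Ar (level X 1)" and c: "c \<in> Ar (level X 1)" and bc: "Cod (level X 1) b = Dom (level X 1) c"
  shows "transport (Comp (level X 1) c b) = ob.icomp (Dom (level X 1) b) (transport c) (transport b)"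
proof -
  interpret G1: groupoid "level X 1" by (rule groupoid_level)
  note cb = G1.Comp_closed[OF b c bc] G1.Dom_Comp[OF b c bc] G1.Cod_Comp[OF b c bc]
  note tb = imap_transport[OF b] and tc = imap_transport[OF c]
  show ?thesis
  proof (rule ob.imap_eqI)
    show "ob.imap (Dom (level X 1) b) (Cod (level X 1) c) (transport (Comp (level X 1) c b))"
      using imap_transport[OF cb(1)] cb by simp
    show "ob.imap (Dom (level X 1) b) (Cod (level X 1) c)
      (ob.icomp (Dom (level X 1) b) (transport c) (transport b))"
      by (rule ob.imap_icomp[OF tb]) (use tc bc in simp)
    fix k s assume s: "s \<in> ob.ivl (Dom (level X 1) b) k"
    interpret G: groupoid "level X (k + 2)" by (rule groupoid_level)
    let ?s = "transport b k s"
    have s': "?s \<in> ob.ivl (Dom (level X 1) c) k" using ob.imap_ivl[OF tb s] bc by simp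
    note l = lift_Ar[OF b s] lift_Ar[OF c s']
    have co: "Cod (level X (k + 2)) (lift b k s) = Dom (level X (k + 2)) (lift c k ?s)"
      using Dom_lift[OF c s'] transport_apply[OF s] by simp
    have "ar.lg (k + 2) (Comp (level X (k + 2)) (lift c k ?s) (lift b k s)) = Comp (level X 1) c b"
      using act_Comp[OF long_Delta l co] lift_ivl[OF b s] lift_ivl[OF c s']
      by (simp add: ar.lg_def ar.ivl_def)
    then have "transport (Comp (level X 1) c b) k s =
      Cod (level X (k + 2)) (Comp (level X (k + 2)) (lift c k ?s) (lift b k s))"
      using G.Comp_closed[OF l co] G.Dom_Comp[OF l co] Dom_lift[OF b s]
      by (intro transport_eq) (simp_all add: ar.ivl_def)
    then show "transport (Comp (level X 1) c b) k s =
      ob.icomp (Dom (level X 1) b) (transport c) (transport b) k s"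
      using G.Cod_Comp[OF l co] s s' by (simp add: ob.icomp_apply transport_apply)
  qed
qed

lemma transport_Ident:
  assumes f: "f \<in> Ob (level X 1)"
  shows "transport (Ident (level X 1) f) = ob.iid f"
proof -
  interpret G1: groupoid "level X 1" by (rule groupoid_level)
  note i = G1.Ident_closed[OF f] G1.Dom_Ident[OF f] G1.Cod_Ident[OF f]
  show ?thesis
  proof (rule ob.imap_eqI[OF imap_transport[OF i(1), unfolded i(2,3)] ob.imap_iid])
    fix k s assume s: "s \<in> ob.ivl f k"
    then have s': "s \<in> Ob (level X (k + 2))" "ob.lg (k + 2) s = f" by (simp_all add: ob.ivl_def)
    interpret G: groupoid "level X (k + 2)" by (rule groupoid_level)
    have "ar.lg (k + 2) (Ident (level X (k + 2)) s) = Ident (level X 1) f"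
      using act_Ident[OF long_Delta s'(1)] s'(2) by (simp add: ar.lg_def ob.lg_def)
    then have "transport (Ident (level X 1) f) k s = Cod (level X (k + 2)) (Ident (level X (k + 2)) s)"
      using s' by (intro transport_eq) (simp_all add: ar.ivl_def G.Ident_closed G.Dom_Ident)
    then show "transport (Ident (level X 1) f) k s = ob.iid f k s"
      using s s' by (simp add: ob.iid_apply G.Cod_Ident)
  qed
qed

text \<open>The arrow \<open>ar.pls n a\<close> lies over the long edge of a and runs from the top
  simplex of the source to that of the target.\<close>

lemma marked_transport:
  assumes a: "a \<in> Ar (level X n)"
  shows "ob.marked n (Dom (level X n) a) (Cod (level X n) a) (transport (ar.lg n a))"
  using imap_transport[OF ar.lg_closed[OF a]] transport_eq[OF ar.pls_in_ivl[OF a]]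
  by (simp add: ob.marked_def dom.h_lg a cod.h_lg dom.h_pls cod.h_pls)

lemma arr_transport:
  assumes a: "a \<in> Ar (level X n)"
  shows "ob.arr n (Dom (level X n) a) (Cod (level X n) a) (transport (ar.lg n a))"
proof -
  interpret G1: groupoid "level X 1" by (rule groupoid_level)
  interpret G: groupoid "level X n" by (rule groupoid_level)
  interpret l: groupoid_functor "level X n" "level X 1" "act X 1 n (long_map n)"
    by (rule functor_act[OF long_Delta])
  let ?b = "ar.lg n a" and ?c = "inverse_arrow (level X n) a"
  have b: "?b \<in> Ar (level X 1)" by (rule ar.lg_closed[OF a])
  have c: "ar.lg n ?c = inverse_arrow (level X 1) ?b"
    using l.onAr_inverse[OF a] by (simp add: ar.lg_def)
  note i = G1.inverse_arrow_closed[OF b] G1.Dom_inverse[OF b] G1.Cod_inverse[OF b]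
  have left: "ob.icomp (Dom (level X 1) ?b) (transport (ar.lg n ?c)) (transport ?b) = ob.iid (Dom (level X 1) ?b)"
    using transport_Comp[OF b i(1)] i c transport_Ident[OF G1.Dom_closed[OF b]]
    by (simp add: G1.Comp_inverse_left[OF b])
  have right: "ob.icomp (Cod (level X 1) ?b) (transport ?b) (transport (ar.lg n ?c)) = ob.iid (Cod (level X 1) ?b)"
    using transport_Comp[OF i(1) b] i c transport_Ident[OF G1.Cod_closed[OF b]]
    by (simp add: G1.Comp_inverse_right[OF b])
  show ?thesis
  proof (rule ob.arrI[OF marked_transport[OF a]])
    show "ob.marked n (Cod (level X n) a) (Dom (level X n) a) (transport (ar.lg n ?c))"
      using marked_transport[OF G.inverse_arrow_closed[OF a]] G.Dom_inverse[OF a] G.Cod_inverse[OF a] by simp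
    show "transport (ar.lg n ?c) k (transport ?b k s) = s" if "s \<in> ob.ivl (ob.lg n (Dom (level X n) a)) k" for k s
      using that fun_cong[OF fun_cong[OF left, of k], of s]
      by (simp add: dom.h_lg[OF a] ob.icomp_apply ob.iid_apply)
    show "transport ?b k (transport (ar.lg n ?c) k s) = s" if "s \<in> ob.ivl (ob.lg n (Cod (level X n) a)) k" for k s
      using that fun_cong[OF fun_cong[OF right, of k], of s]
      by (simp add: cod.h_lg[OF a] ob.icomp_apply ob.iid_apply)
  qed
qed

text \<open>Inclusions of intervals exist for arrows too and commute with \<open>Dom\<close> and
  \<open>Cod\<close>. Including a lift therefore gives a lift of the long edge of a, so transport
  commutes with inclusions, and this characterizes \<open>ob.res\<close>.\<close>

lemma res_transport:
  assumes p: "p \<in> Delta m n" and a: "a \<in> Ar (level X n)"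
  shows "ob.res m n p (Dom (level X n) a) (transport (ar.lg n a)) =
    transport (ar.lg m (onAr (act X m n p) a))"
proof (rule ob.res_unique[OF p _ _ _, symmetric])
  show D: "Dom (level X n) a \<in> Ob (level X n)" and C: "Cod (level X n) a \<in> Ob (level X n)"
    using a by (rule dom.h_closed cod.h_closed)+
  let ?pa = "onAr (act X m n p) a"
  have pa: "?pa \<in> Ar (level X m)" by (rule act_Ar[OF p a])
  show "ob.marked m (onOb (act X m n p) (Dom (level X n) a)) (onOb (act X m n p) (Cod (level X n) a))
      (transport (ar.lg m ?pa))"
    using marked_transport[OF pa] by (simp add: act_Dom[OF p a] act_Cod[OF p a])
  fix k s assume "s \<in> ob.ivl (ob.lg m (onOb (act X m n p) (Dom (level X n) a))) k"
  then have s: "s \<in> ob.ivl (Dom (level X 1) (ar.lg m ?pa)) k"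
    by (simp add: dom.h_lg[OF pa] act_Dom[OF p a])
  note b = ar.lg_closed[OF pa]
  let ?l = "lift (ar.lg m ?pa) k s"
  note l = lift_ivl[OF b s]
  have "transport (ar.lg n a) k (ob.incl m n p (Dom (level X n) a) k s) =
    Cod (level X (k + 2)) (ar.incl m n p a k ?l)"
    by (rule transport_eq[OF ar.incl_ivl[OF p a l]]) (simp add: dom.h_incl[OF p a l] Dom_lift[OF b s])
  then show "ob.incl m n p (Cod (level X n) a) k (transport (ar.lg m ?pa) k s) =
    transport (ar.lg n a) k (ob.incl m n p (Dom (level X n) a) k s)"
    by (simp add: cod.h_incl[OF p a l] transport_apply[OF s])
qed

section \<open>The canonical culf map\<close>

definition canonical :: "nat \<Rightarrow> ('o, 'a, 'o subint, 'o subint_arrow) gfun" where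
  "canonical n = \<lparr>onOb = restrict (subint X n) (Ob (level X n)),
     onAr = restrict (\<lambda>a. (subint X n (Dom (level X n) a), transport (ar.lg n a),
       subint X n (Cod (level X n) a))) (Ar (level X n))\<rparr>"

lemma canonical_simps:
  "x \<in> Ob (level X n) \<Longrightarrow> onOb (canonical n) x = subint X n x"
  "a \<in> Ar (level X n) \<Longrightarrow> onAr (canonical n) a = (subint X n (Dom (level X n) a), transport (ar.lg n a),
       subint X n (Cod (level X n) a))"
  by (simp_all add: canonical_def)

lemma simplicial_map_canonical: "simplicial_map X (subdivided_intervals X) canonical"
proof (intro simplicial_map.intro simplicial_map_axioms.intro simplicial_groupoid_subdivided
    simplicial_groupoid_axioms groupoid_functor.intro groupoid_functor_axioms.intro groupoid_level,
    unfold subdivided_simps)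
  fix n interpret G: groupoid "level X n" by (rule groupoid_level)
  interpret l: groupoid_functor "level X n" "level X 1" "act X 1 n (long_map n)"
    by (rule functor_act[OF long_Delta])
  show "groupoid (subint_groupoid X n)" by (rule groupoid_subint)
  show "onOb (canonical n) \<in> extensional (Ob (level X n))" "onAr (canonical n) \<in> extensional (Ar (level X n))"
    by (simp_all add: canonical_def)
  { fix x assume x: "x \<in> Ob (level X n)"
    show "onOb (canonical n) x \<in> Ob (subint_groupoid X n)"
      using x by (simp add: canonical_simps)
    show "onAr (canonical n) (Ident (level X n) x) = Ident (subint_groupoid X n) (onOb (canonical n) x)"
      using x l.onAr_Ident[OF x] transport_Ident[OF ob.lg_closed[OF x]]
      by (simp add: canonical_simps G.Ident_closed G.Dom_Ident G.Cod_Ident ar.lg_def ob.lg_def)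
    show "onOb (canonical m) (onOb (act X m n p) x) = subint_act_Ob X m n p (onOb (canonical n) x)"
      if "p \<in> Delta m n" for m p
      using that x by (simp add: canonical_simps act_Ob subint_act_Ob_subint) }
  fix f assume f: "f \<in> Ar (level X n)"
  note D = G.Dom_closed[OF f] G.Cod_closed[OF f]
  show "onAr (canonical n) f \<in> Ar (subint_groupoid X n)"
    using f D arr_transport[OF f] by (simp add: canonical_simps subint_arrowI)
  show "Dom (subint_groupoid X n) (onAr (canonical n) f) = onOb (canonical n) (Dom (level X n) f)"
    "Cod (subint_groupoid X n) (onAr (canonical n) f) = onOb (canonical n) (Cod (level X n) f)"
    using f D by (simp_all add: canonical_simps)
  show "onAr (canonical m) (onAr (act X m n p) f) = subint_act_Ar X m n p (onAr (canonical n) f)"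
    if p: "p \<in> Delta m n" for m p
    using f D by (simp add: canonical_simps act_Ar[OF p] subint_act_Ar_subint[OF p D arr_transport[OF f]]
        res_transport[OF p f] act_Dom[OF p] act_Cod[OF p])
  fix g assume g: "g \<in> Ar (level X n)" and fg: "Cod (level X n) f = Dom (level X n) g"
  have "transport (ar.lg n (Comp (level X n) g f)) =
      ob.icomp (ob.lg n (Dom (level X n) f)) (transport (ar.lg n g)) (transport (ar.lg n f))"
    using transport_Comp[OF ar.lg_closed[OF f] ar.lg_closed[OF g]] l.onAr_Comp[OF f g fg]
    by (simp add: dom.h_lg f g cod.h_lg fg) (simp add: ar.lg_def)
  then show "onAr (canonical n) (Comp (level X n) g f) =
      Comp (subint_groupoid X n) (onAr (canonical n) g) (onAr (canonical n) f)"
    using f g fg by (simp add: canonical_simps G.Comp_closed G.Dom_Comp G.Cod_Comp)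
qed

text \<open>Unique lifting is available in degree n + 2 for every n: \<open>ar.pls\<close> of the
  two arrows are lifts of the same long edge at the same simplex, and their middle parts are a and
  a'.\<close>

lemma arrow_eqI:
  assumes a: "a \<in> Ar (level X n)" "a' \<in> Ar (level X n)"
    and D: "Dom (level X n) a = Dom (level X n) a'" and l: "ar.lg n a = ar.lg n a'"
  shows "a = a'"
proof -
  have "ar.pls n a = ar.pls n a'"
    using lift_unique[OF ar.pls_in_ivl[OF a(1)] refl] lift_unique[OF ar.pls_in_ivl[OF a(2)] refl]
    by (simp add: dom.h_pls a D l)
  then show ?thesis using ar.mdl_pls a by metis
qed

text \<open>An object of U_X already determines its simplex x. For arrows, the data are an arrow b
  of X from p^*x to p^*y and an arrow of U_X from x to y whose underlying map F is transport along
  the long edge of b. Lifting that edge at the top simplex over x ends at the one over y, since F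
  preserves subdivisions; the middle part of this lift is the required arrow.\<close>

lemma strict_culf_canonical: "strict_culf_map X (subdivided_intervals X) canonical"
proof (intro strict_culf_map.intro strict_culf_map_axioms.intro simplicial_map_canonical)
  fix m n p assume p: "active m n p"
  note pD = activeD(1)[OF p]
  show "strict_pullback (level X n) (level X m) (level (subdivided_intervals X) n)
    (act X m n p) (canonical n) (canonical m) (act (subdivided_intervals X) m n p)"
    unfolding strict_pullback_def subdivided_simps
  proof
    show "bij_betw (\<lambda>x. (onOb (act X m n p) x, onOb (canonical n) x)) (Ob (level X n))
      {(y, z). y \<in> Ob (level X m) \<and> z \<in> Ob (subint_groupoid X n) \<and>
        onOb (canonical m) y = subint_act_Ob X m n p z}"
      by (rule bij_betwI[where g = "\<lambda>(y, z). subint_simplex X n z"])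
        (auto simp: canonical_simps act_Ob[OF pD] subint_act_Ob_subint subint_simplex_subint subint_eq_iff)
    show "bij_betw (\<lambda>f. (onAr (act X m n p) f, onAr (canonical n) f)) (Ar (level X n))
      {(g, h). g \<in> Ar (level X m) \<and> h \<in> Ar (subint_groupoid X n) \<and>
        onAr (canonical m) g = subint_act_Ar X m n p h}" (is "bij_betw ?c _ ?R")
    proof (rule bij_betw_imageI)
      show "inj_on ?c (Ar (level X n))"
      proof (rule inj_onI)
        fix a a' assume a: "a \<in> Ar (level X n)" "a' \<in> Ar (level X n)" and eq: "?c a = ?c a'"
        show "a = a'"
        proof (rule arrow_eqI[OF a])
          show "Dom (level X n) a = Dom (level X n) a'"
            using eq a by (simp add: canonical_simps subint_eq_iff dom.h_closed)
          show "ar.lg n a = ar.lg n a'"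
            using eq a ar.lg_active[OF p] by (metis fst_conv)
        qed
      qed
      show "?c ` Ar (level X n) = ?R"
      proof (intro equalityI subsetI)
        fix z assume "z \<in> ?c ` Ar (level X n)"
        then obtain a where "a \<in> Ar (level X n)" "z = ?c a" by blast
        then show "z \<in> ?R"
          using simplicial_map.act_onAr[OF simplicial_map_canonical pD]
            simplicial_map.J_Ar[OF simplicial_map_canonical]
          by (simp add: act_Ar[OF pD])
      next
        fix z assume "z \<in> ?R"
        then obtain b h where z: "z = (b, h)" "b \<in> Ar (level X m)" "h \<in> Ar (subint_groupoid X n)"
          "onAr (canonical m) b = subint_act_Ar X m n p h" by blast
        then obtain x y F where h: "h = (subint X n x, F, subint X n y)"
          "x \<in> Ob (level X n)" "y \<in> Ob (level X n)" "ob.arr n x y F"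
          by (auto elim: subint_arrowE)
        note F = ob.arr_marked[OF h(4)]
        have "(subint X m (Dom (level X m) b), transport (ar.lg m b), subint X m (Cod (level X m) b)) =
          (subint X m (onOb (act X m n p) x), F, subint X m (onOb (act X m n p) y))"
          using z h by (simp add: canonical_simps subint_act_Ar_subint[OF pD] ob.res_active[OF p _ _ F])
        then have b: "Dom (level X m) b = onOb (act X m n p) x" "Cod (level X m) b = onOb (act X m n p) y"
          "transport (ar.lg m b) = F"
          using z(2) h(2,3) by (auto simp: subint_eq_iff act_Ob[OF pD] dom.h_closed cod.h_closed)
        define l where "l = ar.lg m b"
        have l: "l \<in> Ar (level X 1)" by (simp add: l_def ar.lg_closed z(2))
        have Dl: "Dom (level X 1) l = ob.lg n x"
          by (simp add: l_def dom.h_lg[OF z(2)] b(1) ob.lg_active[OF p h(2)])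
        note x' = ob.pls_in_ivl[OF h(2), folded Dl]
        let ?c = "lift l n (ob.pls n x)"
        note c = lift_Ar[OF l x'] Dom_lift[OF l x'] lift_ivl[OF l x']
        have Cc: "Cod (level X (n + 2)) ?c = ob.pls n y"
          using transport_apply[OF x'] b(3) ob.marked_pls[OF F] by (simp add: l_def)
        define a where "a = ar.mdl n ?c"
        have a: "a \<in> Ar (level X n)" by (simp add: a_def ar.mdl_closed[OF c(1)])
        have Da: "Dom (level X n) a = x"
          by (simp add: a_def dom.h_mdl[OF c(1)] c(2) ob.mdl_pls[OF h(2)])
        have Ca: "Cod (level X n) a = y"
          by (simp add: a_def cod.h_mdl[OF c(1)] Cc ob.mdl_pls[OF h(3)])
        \<comment> \<open>The outer 3-simplex of the lift and \<open>ar.pls 1 l\<close> both lie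
          over l and have the same source, so they coincide; the middle edge of the latter is
          l.\<close>
        have la: "ar.lg n a = l"
        proof -
          let ?d = "ar.sh 1 n (long_map n) ?c"
          have d: "?d \<in> ar.ivl l 1" by (rule ar.sh_ivl[OF long_Delta c(3)])
          have "Dom (level X (1 + 2)) ?d = ob.pls 1 (ob.lg n x)"
            by (simp only: dom.h_sh[OF long_Delta c(1)] c(2) ob.sh_long_pls[OF h(2)])
          moreover have "ar.pls 1 l \<in> ar.ivl l 1"
            using ar.pls_in_ivl[OF l] ar.lg_1[OF l] by simp
          ultimately have "?d = ar.pls 1 l"
            using lift_unique[OF d refl] lift_unique[of "ar.pls 1 l" l 1, OF _ refl] dom.h_pls[OF l] Dl by simp
          then show ?thesis
            using ar.lg_mdl[OF c(1)] ar.mdl_pls[OF l] by (simp add: a_def)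
        qed
        have "onAr (act X m n p) a = b"
          by (rule arrow_eqI[OF act_Ar[OF pD a] z(2)])
            (simp_all add: act_Dom[OF pD a] Da b(1) ar.lg_active[OF p a] la l_def)
        moreover have "onAr (canonical n) a = h"
          using a b(3) by (simp add: canonical_simps Da Ca la h(1) l_def)
        ultimately show "z \<in> (\<lambda>f. (onAr (act X m n p) f, onAr (canonical n) f)) ` Ar (level X n)"
          using a z(1) by (intro image_eqI[of _ _ a]) simp_all
      qed
    qed
  qed
qed

end

section \<open>An arbitrary culf map compared with the canonical one\<close>

locale culf_to_subdivided = rigid_decomposition_groupoid X
  for X :: "('o, 'a) sgpd" +
  fixes J :: "nat \<Rightarrow> ('o, 'a, 'o subint, 'o subint_arrow) gfun"
  assumes J_culf: "strict_culf_map X (subdivided_intervals X) J"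
begin

sublocale J: strict_culf_map X "subdivided_intervals X" J
  by (rule J_culf)

definition simplex :: "nat \<Rightarrow> 'o \<Rightarrow> 'o" where
  "simplex n x = subint_simplex X n (onOb (J n) x)"

lemma
  assumes x: "x \<in> Ob (level X n)"
  shows simplex_Ob: "simplex n x \<in> Ob (level X n)"
    and J_onOb: "onOb (J n) x = subint X n (simplex n x)"
proof -
  obtain y where "y \<in> Ob (level X n)" "onOb (J n) x = subint X n y"
    using J.J_Ob[OF x] by auto
  then show "simplex n x \<in> Ob (level X n)" "onOb (J n) x = subint X n (simplex n x)"
    by (simp_all add: simplex_def subint_simplex_subint)
qed

lemma simplex_act:
  assumes "p \<in> Delta m n" "x \<in> Ob (level X n)"
  shows "simplex m (onOb (act X m n p) x) = onOb (act X m n p) (simplex n x)"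
  using J.act_onOb[OF assms] assms
  by (simp add: J_onOb act_Ob subint_act_Ob_subint simplex_Ob subint_eq_iff)

sublocale simplex: decomposition_map "\<lambda>n. Ob (level X n)" "\<lambda>m n p. onOb (act X m n p)"
  "\<lambda>n. Ob (level X n)" "\<lambda>m n p. onOb (act X m n p)" simplex
  by unfold_locales (auto simp: simplex_Ob simplex_act)

definition iso :: "nat \<Rightarrow> 'a \<Rightarrow> nat \<Rightarrow> 'o \<Rightarrow> 'o" where
  "iso n a = fst (snd (onAr (J n) a))"

lemma
  assumes a: "a \<in> Ar (level X n)"
  shows J_onAr: "onAr (J n) a = (subint X n (simplex n (Dom (level X n) a)), iso n a,
      subint X n (simplex n (Cod (level X n) a)))"
    and arr_iso: "ob.arr n (simplex n (Dom (level X n) a)) (simplex n (Cod (level X n) a)) (iso n a)"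
proof -
  note D = dom.h_closed[OF a] cod.h_closed[OF a]
  obtain x y F where F: "onAr (J n) a = (subint X n x, F, subint X n y)"
    "x \<in> Ob (level X n)" "y \<in> Ob (level X n)" "ob.arr n x y F"
    using J.J_Ar[OF a] by (auto elim: subint_arrowE)
  then have "x = simplex n (Dom (level X n) a)" "y = simplex n (Cod (level X n) a)" "F = iso n a"
    using J.J_Dom[OF a] J.J_Cod[OF a] D by (simp_all add: J_onOb subint_eq_iff simplex_Ob iso_def)
  then show "onAr (J n) a = (subint X n (simplex n (Dom (level X n) a)), iso n a,
      subint X n (simplex n (Cod (level X n) a)))"
    "ob.arr n (simplex n (Dom (level X n) a)) (simplex n (Cod (level X n) a)) (iso n a)"
    using F by simp_all
qed

text \<open>The long edge is a restriction along an active map, which leaves the underlying map of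
  an arrow of U_X unchanged.\<close>

lemma iso_long:
  assumes a: "a \<in> Ar (level X n)"
  shows "iso 1 (ar.lg n a) = iso n a"
proof -
  note D = simplex_Ob[OF dom.h_closed[OF a]] simplex_Ob[OF cod.h_closed[OF a]]
  have "onAr (J 1) (ar.lg n a) = subint_act_Ar X 1 n (long_map n) (onAr (J n) a)"
    using J.act_onAr[OF long_Delta a] by (simp add: ar.lg_def)
  then have "iso 1 (ar.lg n a) = ob.res 1 n (long_map n) (simplex n (Dom (level X n) a)) (iso n a)"
    using a by (simp add: J_onAr subint_act_Ar_subint[OF long_Delta D arr_iso[OF a]])
  then show ?thesis
    using ob.res_active[OF long_active D ob.arr_marked[OF arr_iso[OF a]]] by simp
qed

text \<open>Every simplex \<open>s\<close> of an interval is \<open>\<phi>\<^sub>s\<close> of the inclusion of the middle part, so an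
  arrow out of \<open>s\<close> determines the value at \<open>s\<close>.\<close>

lemma marked_mid:
  assumes F: "ob.marked (k + 2) s t F" and s: "s \<in> Ob (level X (k + 2))" "t \<in> Ob (level X (k + 2))"
  shows "F k s = t"
  using ob.marked_sh_pls[OF F s(1) mid_Delta] ob.sh_mid_pls[OF s(1)] ob.sh_mid_pls[OF s(2)] by simp

text \<open>The map attached to b is also the one attached to each a over b, and the latter
  preserves the subdivisions by the simplices assigned to the source and target of a;
  \<open>marked_mid\<close> turns this into a value.\<close>

lemma iso_simplex:
  assumes a: "a \<in> ar.ivl b k"
  shows "iso 1 b k (simplex (k + 2) (Dom (level X (k + 2)) a)) = simplex (k + 2) (Cod (level X (k + 2)) a)"
proof -
  have a': "a \<in> Ar (level X (k + 2))" "ar.lg (k + 2) a = b" using a by (simp_all add: ar.ivl_def)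
  show ?thesis
    using marked_mid[OF ob.arr_marked[OF arr_iso[OF a'(1)]]] iso_long[OF a'(1)] a'
    by (simp add: simplex_Ob dom.h_closed cod.h_closed)
qed

definition comparison :: "'o \<Rightarrow> nat \<Rightarrow> 'o \<Rightarrow> 'o" where
  "comparison f k = restrict (simplex (k + 2)) (ob.ivl f k)"

lemma comparison_apply: "s \<in> ob.ivl f k \<Longrightarrow> comparison f k s = simplex (k + 2) s"
  by (simp add: comparison_def)

lemma imap_comparison: "ob.imap f (simplex 1 f) (comparison f)"
  by (rule ob.imapI)
    (simp_all add: comparison_apply ob.sh_ivl simplex.h_ivl simplex.h_sh ivl_Ob,
      simp add: comparison_def)

text \<open>The culf square of the long edge, on objects: s corresponds to the pair of its long edge
  f and the simplex assigned to s.\<close>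

lemma simplex_bij:
  assumes f: "f \<in> Ob (level X 1)" and t: "t \<in> ob.ivl (simplex 1 f) k"
  shows "\<exists>!s. s \<in> ob.ivl f k \<and> simplex (k + 2) s = t"
proof -
  let ?l = "long_map (k + 2)"
  have t': "t \<in> Ob (level X (k + 2))" "ob.lg (k + 2) t = simplex 1 f" using t by (simp_all add: ob.ivl_def)
  have "onOb (J 1) f = subint_act_Ob X 1 (k + 2) ?l (subint X (k + 2) t)"
    using t' f by (simp add: J_onOb subint_act_Ob_subint ob.lg_def)
  then have "\<exists>!s. s \<in> Ob (level X (k + 2)) \<and> onOb (act X 1 (k + 2) ?l) s = f \<and>
      onOb (J (k + 2)) s = subint X (k + 2) t"
    using strict_pullback_ex1(1)[OF J.culf[OF long_active] f] t' by simp
  moreover have "(s \<in> Ob (level X (k + 2)) \<and> onOb (act X 1 (k + 2) ?l) s = f \<and>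
      onOb (J (k + 2)) s = subint X (k + 2) t) \<longleftrightarrow> (s \<in> ob.ivl f k \<and> simplex (k + 2) s = t)" for s
    using t' by (auto simp: ob.ivl_def ob.lg_def J_onOb subint_eq_iff simplex_Ob)
  ultimately show ?thesis by (simp only:)
qed

lemma iiso_comparison:
  assumes f: "f \<in> Ob (level X 1)"
  shows "ob.iiso f (simplex 1 f) (comparison f)"
proof -
  define G where "G k = restrict (\<lambda>t. THE s. s \<in> ob.ivl f k \<and> simplex (k + 2) s = t)
    (ob.ivl (simplex 1 f) k)" for k
  have G: "G k t \<in> ob.ivl f k" "simplex (k + 2) (G k t) = t" if "t \<in> ob.ivl (simplex 1 f) k" for k t
    using theI'[OF simplex_bij[OF f that]] that by (simp_all add: G_def)
  have Gu: "G k (simplex (k + 2) s) = s" if "s \<in> ob.ivl f k" for k s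
    using that simplex_bij[OF f simplex.h_ivl[OF that]] simplex.h_ivl[OF that]
    by (simp add: G_def the1_equality)
  have "ob.imap (simplex 1 f) f G"
  proof (rule ob.imapI)
    fix k show "G k \<in> extensional (ob.ivl (simplex 1 f) k)" by (simp add: G_def)
    fix t assume t: "t \<in> ob.ivl (simplex 1 f) k"
    then show "G k t \<in> ob.ivl f k" by (rule G)
    fix j q assume q: "q \<in> Delta j k"
    show "G j (ob.sh j k q t) = ob.sh j k q (G k t)"
      using Gu[OF ob.sh_ivl[OF q G(1)[OF t]]] simplex.h_sh[OF q ivl_Ob[OF G(1)[OF t]]] G(2)[OF t] by simp
  qed
  then show ?thesis
    unfolding ob.iiso_def using imap_comparison G Gu
    by (intro conjI exI[of _ G]) (auto simp: comparison_apply simplex.h_ivl)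
qed

lemma arr_comparison:
  assumes x: "x \<in> Ob (level X n)"
  shows "ob.arr n x (simplex n x) (comparison (ob.lg n x))"
  using iiso_comparison[OF ob.lg_closed[OF x]] x
  by (simp add: ob.arr_def simplex.h_lg comparison_apply ob.pls_in_ivl simplex.h_pls)

text \<open>The map \<open>simplex\<close> is simplicial, so it commutes with inclusions of
  intervals, which is the equation characterizing \<open>ob.res\<close>.\<close>

lemma res_comparison:
  assumes p: "p \<in> Delta m n" and x: "x \<in> Ob (level X n)"
  shows "ob.res m n p x (comparison (ob.lg n x)) = comparison (ob.lg m (onOb (act X m n p) x))"
proof (rule ob.res_unique[OF p x simplex_Ob[OF x], symmetric])
  show "ob.marked m (onOb (act X m n p) x) (onOb (act X m n p) (simplex n x))
      (comparison (ob.lg m (onOb (act X m n p) x)))"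
    using ob.arr_marked[OF arr_comparison[OF act_Ob[OF p x]]] by (simp add: simplex_act p x)
  show "ob.incl m n p (simplex n x) k (comparison (ob.lg m (onOb (act X m n p) x)) k s) =
      comparison (ob.lg n x) k (ob.incl m n p x k s)"
    if "s \<in> ob.ivl (ob.lg m (onOb (act X m n p) x)) k" for k s
    using that by (simp add: comparison_apply simplex.h_incl[OF p x] ob.incl_ivl[OF p x])
qed

definition from_canonical :: "nat \<Rightarrow> 'o \<Rightarrow> 'o subint_arrow" where
  "from_canonical n = restrict (\<lambda>x. (subint X n x, comparison (ob.lg n x), subint X n (simplex n x)))
     (Ob (level X n))"

lemma modification_from_canonical:
  "modification X (subdivided_intervals X) canonical J from_canonical"
proof (rule modificationI[OF simplicial_map_canonical J.simplicial_map_axioms], unfold subdivided_simps)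
  fix n show "from_canonical n \<in> extensional (Ob (level X n))" by (simp add: from_canonical_def)
next
  fix n x assume x: "x \<in> Ob (level X n)"
  then show "from_canonical n x \<in> Ar (subint_groupoid X n)"
    "Dom (subint_groupoid X n) (from_canonical n x) = onOb (canonical n) x"
    "Cod (subint_groupoid X n) (from_canonical n x) = onOb (J n) x"
    by (simp_all add: from_canonical_def subint_arrowI arr_comparison simplex_Ob canonical_simps J_onOb)
  fix m p assume p: "p \<in> Delta m n"
  show "subint_act_Ar X m n p (from_canonical n x) = from_canonical m (onOb (act X m n p) x)"
    using x by (simp add: from_canonical_def act_Ob[OF p] simplex_act[OF p] res_comparison[OF p]
        subint_act_Ar_subint[OF p x simplex_Ob[OF x] arr_comparison[OF x]])
next
  fix n a assume a: "a \<in> Ar (level X n)"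
  let ?x = "Dom (level X n) a" and ?y = "Cod (level X n) a"
  note D = dom.h_closed[OF a] cod.h_closed[OF a]
  note b = ar.lg_closed[OF a]
  have F: "ob.imap (ob.lg n (simplex n ?x)) (ob.lg n (simplex n ?y)) (iso n a)"
    by (rule ob.marked_imap[OF ob.arr_marked[OF arr_iso[OF a]]])
  note T = ob.marked_imap[OF marked_transport[OF a]]
  have "ob.icomp (ob.lg n ?x) (iso n a) (comparison (ob.lg n ?x)) =
    ob.icomp (ob.lg n ?x) (comparison (ob.lg n ?y)) (transport (ar.lg n a))"
  proof (rule ob.imap_eqI)
    show "ob.imap (ob.lg n ?x) (ob.lg n (simplex n ?y)) (ob.icomp (ob.lg n ?x) (iso n a) (comparison (ob.lg n ?x)))"
      by (rule ob.imap_icomp[OF _ F]) (use imap_comparison[of "ob.lg n ?x"] D in \<open>simp add: simplex.h_lg\<close>)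
    show "ob.imap (ob.lg n ?x) (ob.lg n (simplex n ?y))
      (ob.icomp (ob.lg n ?x) (comparison (ob.lg n ?y)) (transport (ar.lg n a)))"
      by (rule ob.imap_icomp[OF T]) (use imap_comparison[of "ob.lg n ?y"] D in \<open>simp add: simplex.h_lg\<close>)
    fix k s assume s: "s \<in> ob.ivl (ob.lg n ?x) k"
    then have s': "s \<in> ob.ivl (Dom (level X 1) (ar.lg n a)) k" by (simp add: dom.h_lg[OF a])
    \<comment> \<open>Naturality at a: the lift of the long edge of a at s is an arrow of X from s
      to its transport, so \<open>iso_simplex\<close> applies to it.\<close>
    have "iso n a k (simplex (k + 2) s) = simplex (k + 2) (transport (ar.lg n a) k s)"
      using iso_simplex[OF lift_ivl[OF b s']] iso_long[OF a]
      by (simp add: Dom_lift[OF b s'] transport_apply[OF s'])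
    then show "ob.icomp (ob.lg n ?x) (iso n a) (comparison (ob.lg n ?x)) k s =
      ob.icomp (ob.lg n ?x) (comparison (ob.lg n ?y)) (transport (ar.lg n a)) k s"
      using s ob.imap_ivl[OF T s] by (simp add: ob.icomp_apply comparison_apply)
  qed
  then show "Comp (subint_groupoid X n) (onAr (J n) a) (from_canonical n ?x) =
    Comp (subint_groupoid X n) (from_canonical n ?y) (onAr (canonical n) a)"
    using a D by (simp add: from_canonical_def J_onAr canonical_simps)
qed

lemma modification_unique:
  assumes "modification X (subdivided_intervals X) canonical J \<Gamma>"
  shows "\<Gamma> = from_canonical"
proof (rule modification_eqI[OF assms modification_from_canonical])
  interpret M: modification X "subdivided_intervals X" canonical J \<Gamma> by (rule assms)
  define G where "G n x = fst (snd (\<Gamma> n x))" for n x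
  have \<Gamma>: "\<Gamma> n x = (subint X n x, G n x, subint X n (simplex n x))"
    and arr: "ob.arr n x (simplex n x) (G n x)" if x: "x \<in> Ob (level X n)" for n x
  proof -
    obtain y z F where F: "\<Gamma> n x = (subint X n y, F, subint X n z)"
      "y \<in> Ob (level X n)" "z \<in> Ob (level X n)" "ob.arr n y z F"
      using M.comp_Ar[OF x] by (auto elim: subint_arrowE)
    then have "y = x" "z = simplex n x" "F = G n x"
      using M.comp_Dom[OF x] M.comp_Cod[OF x] x
      by (simp_all add: canonical_simps J_onOb subint_eq_iff simplex_Ob G_def)
    then show "\<Gamma> n x = (subint X n x, G n x, subint X n (simplex n x))"
      "ob.arr n x (simplex n x) (G n x)" using F by simp_all
  qed
  have long: "G 1 (ob.lg n x) = G n x" if x: "x \<in> Ob (level X n)" for n x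
  proof -
    have "subint_act_Ar X 1 n (long_map n) (\<Gamma> n x) = \<Gamma> 1 (ob.lg n x)"
      using M.whisker[OF long_Delta x] by (simp add: ob.lg_def)
    then have "G 1 (ob.lg n x) = ob.res 1 n (long_map n) x (G n x)"
      using x by (simp add: \<Gamma> subint_act_Ar_subint[OF long_Delta x simplex_Ob[OF x] arr[OF x]])
    then show ?thesis
      using ob.res_active[OF long_active x simplex_Ob[OF x] ob.arr_marked[OF arr[OF x]]] by simp
  qed
  fix n x assume x: "x \<in> Ob (level X n)"
  have "G n x = comparison (ob.lg n x)"
  proof (rule ob.imap_eqI[OF ob.marked_imap[OF ob.arr_marked[OF arr[OF x]]]
        ob.marked_imap[OF ob.arr_marked[OF arr_comparison[OF x]]]])
    fix k s assume s: "s \<in> ob.ivl (ob.lg n x) k"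
    then have s': "s \<in> Ob (level X (k + 2))" "ob.lg (k + 2) s = ob.lg n x" by (simp_all add: ob.ivl_def)
    have "G n x = G (k + 2) s" using long[OF x] long[OF s'(1)] s'(2) by simp
    then show "G n x k s = comparison (ob.lg n x) k s"
      using marked_mid[OF ob.arr_marked[OF arr[OF s'(1)]] s'(1) simplex_Ob[OF s'(1)]] s
      by (simp add: comparison_apply)
  qed
  then show "\<Gamma> n x = from_canonical n x"
    using x by (simp add: \<Gamma> from_canonical_def)
qed

end

theorem lemma6p6:
  fixes X :: "('o, 'a) sgpd"
  assumes "rigid_decomposition_groupoid X"
  shows "contractible_groupoid (map_groupoid X (subdivided_intervals X))"
proof -
  interpret rigid_decomposition_groupoid X by (rule assms)
  show ?thesis
  proof (rule contractibleI[OF groupoid_map])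
    show "canonical \<in> Ob (map_groupoid X (subdivided_intervals X))"
      by (simp add: map_groupoid_def strict_culf_canonical)
    fix J assume "J \<in> Ob (map_groupoid X (subdivided_intervals X))"
    then interpret J: culf_to_subdivided X J
      by (intro culf_to_subdivided.intro culf_to_subdivided_axioms.intro assms)
        (simp add: map_groupoid_def)
    show "\<exists>!f. f \<in> Ar (map_groupoid X (subdivided_intervals X)) \<and>
        Dom (map_groupoid X (subdivided_intervals X)) f = canonical \<and>
        Cod (map_groupoid X (subdivided_intervals X)) f = J"
      by (rule ex1I[of _ "(canonical, J.from_canonical, J)"])
        (auto simp: map_groupoid_def invertible_modification_iff strict_culf_canonical J.J_culf
          J.modification_from_canonical J.modification_unique)
  qed
qed

end
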